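(* Let $1\le p<\infty$. The refinable function $\varphi$ belongs to $L_p(\mathbb{R}^s)$ if and only if $\rho_p(\mathcal{A})<1$; that is, if and only if there is a vector $z\in V$ with $Tz=z$ such that the family $\mathcal{A}=\{T_d|_{U}: d\in D(M)\}$, with $U=U(z)$, satisfies $\rho_p(\mathcal{A})<1$.
   Context: Setting. $M\in\mathbb{Z}^{s\times s}$ is an expansive integer matrix (all its eigenvalues are larger than $1$ in absolute value), $m=|\det M|\ge 2$. $D(M)=\{d_0,\ldots,d_{m-1}\}\subset\mathbb{Z}^s$ is a complete set of representatives of $\mathbb{Z}^s/M\mathbb{Z}^s$ with $0\in D(M)$. $G=\{\sum_{i\ge1}M^{-i}d_i : d_i\in D(M)\}$ is assumed to be a tile, i.e. $\mu(G)=1$ (Lebesgue measure), so the sets $k+G$, $k\in\mathbb{Z}^s$, cover $\mathbb{R}^s$ with overlaps of measure zero. $c=(c_k)_{k\in\mathbb{Z}^s}$ is a finitely supported real sequence with $\sum_{k\in\mathbb{Z}^s}c_{Mk-d}=1$ for all $d\in D(M)$. The refinable function $\varphi$ is the compactly supported distribution on $\mathbb{R}^s$ with $\varphi(x)=\sum_{k\in\mathbb{Z}^s}c_k\,\varphi(Mx-k)$ and $\int\varphi=1$. Let $K=\{\sum_{j\ge1}M^{-j}\gamma_j:\gamma_j\in\mathrm{supp}(c)\}$ (then $\mathrm{supp}\,\varphi\subseteq K$), $\Omega\subset\mathbb{Z}^s$ a finite minimal set with $K\subseteq\Omega+G$, $N=|\Omega|$. The transition matrices are $(T_d)_{ab}=c_{Ma-b+d}$,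 $a,b\in\Omega$, $d\in D(M)$; their column sums are equal to one. Let $T=\frac1m\sum_{d\in D(M)}T_d$ and $V=\{w\in\mathbb{R}^N:\sum_jw_j=1\}$. For $z\in V$ with $Tz=z$, $U(z)\subset\mathbb{R}^N$ is the smallest common invariant linear subspace of the matrices $T_d$, $d\in D(M)$, that contains the vectors $T_dz-z$, $d\in D(M)$. If $\varphi\in L_p(\mathbb{R}^s)$ and $v(x)=(\varphi(x+k))_{k\in\Omega}$, $x\in G$, the relevant vector is $z=\int_Gv(x)\,dx$, and $U(z)$ is the span of the differences $v(y)-v(x)$ for almost all $x,y\in G$. The $p$-radius of a finite family $\mathcal{A}=\{A_d: d\in D(M)\}$ of $m$ operators (indexed by the digits, repetitions counted) is $$\rho_p(\mathcal{A})=\lim_{k\to\infty}\Bigl(m^{-k}\sum_{d_1,\ldots,d_k\in D(M)}\|A_{d_1}\cdots A_{d_k}\|^p\Bigr)^{1/(pk)};$$ it equals $0$ if the underlying space is $\{0\}$. *)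

theory Defs
  imports "HOL-Analysis.Analysis"
begin

section \<open>Dilation matrices, digit expansions and tiles\<close>

definition real_vec :: "int ^ 's \<Rightarrow> real ^ 's" where
  "real_vec k = (\<chi> i. of_int (k $ i))"

definition real_mat :: "int ^ 's ^ 's \<Rightarrow> real ^ 's ^ 's" where
  "real_mat M = map_matrix of_int M"

definition expansive :: "int ^ 's ^ 's \<Rightarrow> bool" where
  "expansive M \<longleftrightarrow>
     (\<forall>(l::complex) (v::complex ^ 's).
        v \<noteq> 0 \<and> map_matrix of_int M *v v = l *s v \<longrightarrow> 1 < norm l)"

definition complete_residues :: "int ^ 's ^ 's \<Rightarrow> (int ^ 's) set \<Rightarrow> bool" where
  "complete_residues M D \<longleftrightarrow> (\<forall>k. \<exists>!d. d \<in> D \<and> (\<exists>l. k - d = M *v l))"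

text \<open>
  The set of all sums \<open>M\<^sup>-\<^sup>1 \<gamma> 0 + M\<^sup>-\<^sup>2 \<gamma> 1 + \<dots>\<close> with all \<open>\<gamma> j\<close> in \<open>\<Gamma>\<close>. The tile \<open>G\<close>
  is obtained for \<open>\<Gamma> = D\<close>, the set \<open>K\<close> for \<open>\<Gamma> = supp c\<close>.
\<close>
definition digit_expansions :: "int ^ 's ^ 's \<Rightarrow> (int ^ 's) set \<Rightarrow> (real ^ 's) set" where
  "digit_expansions M \<Gamma> =
     {x. \<exists>\<gamma>. (\<forall>j. \<gamma> j \<in> \<Gamma>) \<and>
        (\<lambda>j::nat. ((\<lambda>y. matrix_inv (real_mat M) *v y) ^^ Suc j) (real_vec (\<gamma> j))) sums x}"

definition shifted_by :: "(int ^ 's) set \<Rightarrow> (real ^ 's) set \<Rightarrow> (real ^ 's) set" where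
  "shifted_by \<Omega> G = {real_vec k + x | k x. k \<in> \<Omega> \<and> x \<in> G}"

definition minimal_cover :: "(int ^ 's) set \<Rightarrow> (real ^ 's) set \<Rightarrow> (real ^ 's) set \<Rightarrow> bool" where
  "minimal_cover \<Omega> K G \<longleftrightarrow>
     finite \<Omega> \<and> K \<subseteq> shifted_by \<Omega> G \<and> (\<forall>\<Omega>'. \<Omega>' \<subset> \<Omega> \<longrightarrow> \<not> K \<subseteq> shifted_by \<Omega>' G)"


section \<open>Distributions\<close>

definition partial_deriv :: "'s::finite \<Rightarrow> (real ^ 's \<Rightarrow> real) \<Rightarrow> real ^ 's \<Rightarrow> real" where
  "partial_deriv i f x = frechet_derivative f (at x) (axis i 1)"

abbreviation partial_derivs :: "'s::finite list \<Rightarrow> (real ^ 's \<Rightarrow> real) \<Rightarrow> real ^ 's \<Rightarrow> real" where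
  "partial_derivs is f \<equiv> foldr partial_deriv is f"

text \<open>
  \<open>C\<^sup>\<infinity>\<close>: the partial derivatives of all orders are Frechet differentiable everywhere
  (and hence continuous).
\<close>
definition smooth :: "(real ^ 's::finite \<Rightarrow> real) \<Rightarrow> bool" where
  "smooth f \<longleftrightarrow> (\<forall>is x. partial_derivs is f differentiable (at x))"

definition fun_support :: "(real ^ 's \<Rightarrow> real) \<Rightarrow> (real ^ 's) set" where
  "fun_support f = closure {x. f x \<noteq> 0}"

definition test_fun :: "(real ^ 's::finite \<Rightarrow> real) \<Rightarrow> bool" where
  "test_fun f \<longleftrightarrow> smooth f \<and> compact (fun_support f)"

text \<open>
  A distribution is represented by a functional on all functions; only its values on test
  functions are relevant. Continuity is expressed by the usual seminorm estimate on each
  compact set, where \<open>b\<close> ranges over the common upper bounds of the derivatives of order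
  at most \<open>n\<close>.
\<close>
type_synonym 's functional = "(real ^ 's \<Rightarrow> real) \<Rightarrow> real"

definition distribution :: "'s::finite functional \<Rightarrow> bool" where
  "distribution u \<longleftrightarrow>
     (\<forall>f g a b. test_fun f \<and> test_fun g \<longrightarrow>
        u (\<lambda>x. a * f x + b * g x) = a * u f + b * u g) \<and>
     (\<forall>C. compact C \<longrightarrow>
        (\<exists>B n. \<forall>f b. test_fun f \<and> fun_support f \<subseteq> C \<and>
           (\<forall>is x. length is \<le> n \<longrightarrow> \<bar>partial_derivs is f x\<bar> \<le> b) \<longrightarrow> \<bar>u f\<bar> \<le> B * b))"

definition dist_supported_in :: "'s::finite functional \<Rightarrow> (real ^ 's) set \<Rightarrow> bool" where
  "dist_supported_in u C \<longleftrightarrow> (\<forall>f. test_fun f \<and> fun_support f \<inter> C = {} \<longrightarrow> u f = 0)"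

definition compactly_supported :: "'s::finite functional \<Rightarrow> bool" where
  "compactly_supported u \<longleftrightarrow> (\<exists>C. compact C \<and> dist_supported_in u C)"

text \<open>
  The integral of a compactly supported distribution is its value on any test function
  that equals 1 in a neighbourhood of the support.
\<close>
definition dist_has_integral :: "'s::finite functional \<Rightarrow> real \<Rightarrow> bool" where
  "dist_has_integral u I \<longleftrightarrow>
     (\<exists>C. compact C \<and> dist_supported_in u C \<and>
        (\<forall>f W. test_fun f \<and> open W \<and> C \<subseteq> W \<and> (\<forall>x\<in>W. f x = 1) \<longrightarrow> u f = I))"

text \<open>
  The distribution \<open>x \<mapsto> u (A x - b)\<close>, for invertible \<open>A\<close>: substitute \<open>y = A x - b\<close> in the
  integral of \<open>u (A x - b) f x\<close>.
\<close>
definition dist_pullback :: "real ^ 's ^ 's \<Rightarrow> real ^ 's \<Rightarrow> 's::finite functional \<Rightarrow> 's functional" where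
  "dist_pullback A b u = (\<lambda>f. u (\<lambda>y. f (matrix_inv A *v (y + b))) / \<bar>det A\<bar>)"

definition refinable_function ::
    "int ^ 's ^ 's \<Rightarrow> (int ^ 's \<Rightarrow> real) \<Rightarrow> 's::finite functional \<Rightarrow> bool" where
  "refinable_function M c \<phi> \<longleftrightarrow>
     distribution \<phi> \<and> compactly_supported \<phi> \<and>
     (\<forall>f. test_fun f \<longrightarrow>
        \<phi> f = (\<Sum>k | c k \<noteq> 0. c k * dist_pullback (real_mat M) (real_vec k) \<phi> f)) \<and>
     dist_has_integral \<phi> 1"

definition in_Lp :: "'s::finite functional \<Rightarrow> real \<Rightarrow> bool" where
  "in_Lp u p \<longleftrightarrow>
     (\<exists>F. F \<in> borel_measurable lebesgue \<and> integrable lebesgue (\<lambda>x. \<bar>F x\<bar> powr p) \<and>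
        (\<forall>f. test_fun f \<longrightarrow> u f = integral\<^sup>L lebesgue (\<lambda>x. F x * f x)))"


section \<open>Transition matrices and the p-radius\<close>

text \<open>The finite set \<open>\<Omega>\<close> is enumerated by an injective map \<open>\<omega>\<close> on a finite index type.\<close>
definition transition_matrix ::
    "int ^ 's ^ 's \<Rightarrow> (int ^ 's \<Rightarrow> real) \<Rightarrow> ('n::finite \<Rightarrow> int ^ 's) \<Rightarrow> int ^ 's \<Rightarrow> real ^ 'n ^ 'n" where
  "transition_matrix M c \<omega> d = (\<chi> a b. c (M *v \<omega> a - \<omega> b + d))"

definition mean_matrix :: "'d set \<Rightarrow> ('d \<Rightarrow> real ^ 'n ^ 'n) \<Rightarrow> real ^ 'n ^ 'n" where
  "mean_matrix D A = (1 / real (card D)) *\<^sub>R (\<Sum>d\<in>D. A d)"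

definition sum_one :: "(real ^ 'n::finite) set" where
  "sum_one = {w. (\<Sum>j\<in>UNIV. w $ j) = 1}"

definition invariant_subspace :: "'d set \<Rightarrow> ('d \<Rightarrow> real ^ 'n ^ 'n) \<Rightarrow> (real ^ 'n) set \<Rightarrow> bool" where
  "invariant_subspace D A S \<longleftrightarrow> subspace S \<and> (\<forall>d\<in>D. \<forall>w\<in>S. A d *v w \<in> S)"

definition difference_space ::
    "'d set \<Rightarrow> ('d \<Rightarrow> real ^ 'n ^ 'n) \<Rightarrow> real ^ 'n \<Rightarrow> (real ^ 'n) set" where
  "difference_space D A z = invariant_subspace D A hull {A d *v z - z | d. d \<in> D}"

definition onorm_on :: "'v::real_normed_vector set \<Rightarrow> ('v \<Rightarrow> 'v) \<Rightarrow> real" where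
  "onorm_on U f = (SUP w\<in>{w \<in> U. norm w \<le> 1}. norm (f w))"

text \<open>
  The p-radius of the restrictions to \<open>U\<close> of the operators \<open>A d\<close> with \<open>d \<in> D\<close>, for a subspace
  \<open>U\<close> invariant under all of them.
\<close>
definition p_radius ::
    "real \<Rightarrow> 'd set \<Rightarrow> ('d \<Rightarrow> 'v \<Rightarrow> 'v) \<Rightarrow> 'v::real_normed_vector set \<Rightarrow> real" where
  "p_radius p D A U =
     lim (\<lambda>k::nat.
       ((\<Sum>ds | set ds \<subseteq> D \<and> length ds = k. onorm_on U (foldr (\<circ>) (map A ds) id) powr p)
          / real (card D) ^ k) powr (1 / (p * real k)))"

end

theory Submission
  imports Defs
    "HOL-Computational_Algebra.Polynomial"
    "HOL-Computational_Algebra.Fundamental_Theorem_Algebra"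
begin

text \<open>
  Let \<open>A\<close> be the inverse of \<open>M\<close>. The maps \<open>y \<mapsto> A (y + d)\<close> with \<open>d \<in> D\<close> send the tile \<open>G\<close> to \<open>m\<close>
  pieces which cover \<open>G\<close> and overlap in null sets. If \<open>F\<close> solves the refinement equation and
  \<open>v y\<close> is the vector of the values \<open>F (y + k)\<close>, \<open>k \<in> \<Omega>\<close>, then the equation says exactly that
  \<open>v (A (y + d)) = T\<^sub>d (v y)\<close> on \<open>G\<close> (\<open>samples_branch\<close>). Hence on the cell with digits
  \<open>d\<^sub>1, \<dots>, d\<^sub>n\<close> the function \<open>v\<close> is a copy of itself to which \<open>T\<^bsub>d\<^sub>1\<^esub> \<dots> T\<^bsub>d\<^sub>n\<^esub>\<close> is applied, and its
  average over the cell is \<open>T\<^bsub>d\<^sub>1\<^esub> \<dots> T\<^bsub>d\<^sub>n\<^esub> z\<close>, where \<open>z\<close> is its average over \<open>G\<close>. Both directions of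
  the theorem read off the size of the products from this picture.

  Suppose that the distribution has a density \<open>F\<close> in \<open>L\<^sub>p\<close>. The averages of an \<open>L\<^sub>p\<close> function over
  the cells of level \<open>n\<close> approach the averages over the subcells in the \<open>p\<close>-th mean, because this is
  clear for continuous functions and these are dense. So the \<open>p\<close>-th mean over all words of the norm of
  \<open>T\<^bsub>d\<^sub>1\<^esub> \<dots> T\<^bsub>d\<^sub>n\<^esub> (T\<^sub>d z - z)\<close> tends to 0 (\<open>oscillation_tendsto_0\<close>, \<open>cell_difference_bound\<close>). The
  vectors with this property form an invariant subspace (\<open>vanishing_means_invariant\<close>), so that it
  holds on all of \<open>U z\<close>, and in finite dimension it passes to the operator norms. Their means are
  submultiplicative, and a single mean below 1 makes the \<open>p\<close>-radius smaller than 1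
  (\<open>p_radius_less_1\<close>).

  Suppose conversely that \<open>z\<close> has a \<open>p\<close>-radius below 1. The cascade algorithm starts with the function
  whose vector of values is constantly \<open>z\<close> on \<open>G\<close> and iterates the refinement equation. Its \<open>n\<close>-th
  increment has on the cells the values \<open>T\<^bsub>d\<^sub>1\<^esub> \<dots> T\<^bsub>d\<^sub>n\<^esub> (T\<^sub>d z - z)\<close> (\<open>cascade_step_samples\<close>), so it
  decays geometrically in \<open>L\<^sub>p\<close>, and the iteration converges to a solution \<open>F\<close> with integral 1
  (\<open>cascade_limit\<close>).

  It remains to see that \<open>F\<close> represents the given distribution, that is, that a compactly supported
  solution \<open>u\<close> of the refinement equation with integral 0 is zero (\<open>null_refinable.vanishes\<close>). Instead
  of the Fourier transform the proof uses polynomials. On a polynomial \<open>q\<close> the refinement acts as the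
  substitution \<open>q \<circ> A\<close>, up to terms of lower degree. Inductively these are annihilated by \<open>u\<close>, so
  \<open>u q = u (q \<circ> A\<^sup>n)\<close>, and this tends to \<open>u (q 0) = 0\<close>. Therefore \<open>u\<close> only sees Taylor remainders.
  After \<open>n\<close> refinements a remainder of order \<open>L\<close> has shrunk by the factor \<open>r\<^sup>n\<close> to the power \<open>L + 1\<close>,
  with \<open>r < 1\<close>, and for large \<open>L\<close> this beats the growth of the weights.

  Two geometric facts support this. The translates of \<open>G\<close> tile the space because \<open>G\<close> has measure 1
  (\<open>tiling\<close>). And every neighbourhood of a point of \<open>K\<close> meets \<open>K\<close> in positive measure, so the minimal
  set \<open>\<Omega>\<close> consists of those \<open>k\<close> for which \<open>k + G\<close> meets \<open>K\<close> in positive measure. This description is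
  compatible with the refinement equation, and the finite matrices \<open>T\<^sub>d\<close> describe it completely
  (\<open>index_closed\<close>).
\<close>

section \<open>Calculus of smooth functions\<close>

lemma partial_deriv_eq:
  "(f has_derivative f') (at x) \<Longrightarrow> partial_deriv i f x = f' (axis i 1)"
  unfolding partial_deriv_def by (metis frechet_derivative_at)

text \<open>
  Counting derivatives turns the closure properties of smooth functions into inductions: the
  derivatives of a product, of a reciprocal or of an affine substitution are again expressions of the
  same kind in functions that are differentiable one time less.
\<close>
definition smooth_upto :: "nat \<Rightarrow> (real ^ 's::finite \<Rightarrow> real) \<Rightarrow> bool" where
  "smooth_upto n f \<longleftrightarrow> (\<forall>is x. length is \<le> n \<longrightarrow> partial_derivs is f differentiable (at x))"

lemma smooth_iff_upto: "smooth f \<longleftrightarrow> (\<forall>n. smooth_upto n f)"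
  unfolding smooth_def smooth_upto_def by blast

lemma smooth_upto_0: "smooth_upto 0 f \<longleftrightarrow> (\<forall>x. f differentiable (at x))"
  unfolding smooth_upto_def by simp

lemma smooth_upto_Suc:
  "smooth_upto (Suc n) f \<longleftrightarrow> (\<forall>x. f differentiable (at x)) \<and> (\<forall>i. smooth_upto n (partial_deriv i f))"
proof (intro iffI conjI allI)
  assume *: "smooth_upto (Suc n) f"
  show "f differentiable at x" for x
    using *[unfolded smooth_upto_def, rule_format, of "[]"] by simp
  show "smooth_upto n (partial_deriv i f)" for i
    unfolding smooth_upto_def
  proof (intro allI impI)
    fix js :: "'a list" and x assume "length js \<le> n"
    thus "partial_derivs js (partial_deriv i f) differentiable at x"
      using *[unfolded smooth_upto_def, rule_format, of "js @ [i]"] by simp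
  qed
next
  assume *: "(\<forall>x. f differentiable (at x)) \<and> (\<forall>i. smooth_upto n (partial_deriv i f))"
  show "smooth_upto (Suc n) f"
    unfolding smooth_upto_def
  proof (intro allI impI)
    fix ks :: "'a list" and x assume len: "length ks \<le> Suc n"
    show "partial_derivs ks f differentiable at x"
    proof (cases ks rule: rev_cases)
      case Nil thus ?thesis using * by simp
    next
      case (snoc js j)
      thus ?thesis using *[THEN conjunct2, rule_format, of j] len
        unfolding smooth_upto_def by simp
    qed
  qed
qed

lemma smooth_upto_differentiable: "smooth_upto n f \<Longrightarrow> f differentiable (at x)"
  by (cases n) (auto simp: smooth_upto_0 smooth_upto_Suc)

lemma smooth_upto_mono: "smooth_upto n f \<Longrightarrow> k \<le> n \<Longrightarrow> smooth_upto k f"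
  unfolding smooth_upto_def by auto

lemma smooth_differentiable: "smooth f \<Longrightarrow> f differentiable (at x)"
  using smooth_iff_upto smooth_upto_differentiable by blast

lemma smooth_partial_deriv: "smooth f \<Longrightarrow> smooth (partial_deriv i f)"
  using smooth_iff_upto smooth_upto_Suc by blast

lemma smooth_partial_derivs: "smooth f \<Longrightarrow> smooth (partial_derivs is f)"
  by (induction "is") (auto intro: smooth_partial_deriv)

lemma smooth_continuous: "smooth f \<Longrightarrow> continuous_on S f"
  by (simp add: continuous_at_imp_continuous_on differentiable_imp_continuous_within
      smooth_differentiable)

text \<open>
  The rule of choice for a family of explicit functions that is closed under differentiation.
\<close>
lemma smooth_coinduct:
  assumes "P f" and "\<And>f x. P f \<Longrightarrow> f differentiable (at x)" and "\<And>f i. P f \<Longrightarrow> P (partial_deriv i f)"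
  shows "smooth f"
proof -
  have "smooth_upto n f" if "P f" for n f
    using that by (induction n arbitrary: f) (auto simp: smooth_upto_0 smooth_upto_Suc assms(2,3))
  with assms(1) show ?thesis by (simp add: smooth_iff_upto)
qed

lemma partial_deriv_const [simp]: "partial_deriv i (\<lambda>x. c) = (\<lambda>x. 0)"
  by (simp add: partial_deriv_def fun_eq_iff)

lemma smooth_const [simp]: "smooth (\<lambda>x. c)"
  by (rule smooth_coinduct[where P = "\<lambda>f. \<exists>c. f = (\<lambda>x. c)"]) auto

lemma smooth_upto_const [simp]: "smooth_upto n (\<lambda>x. c)"
  using smooth_const[unfolded smooth_iff_upto] by blast

lemma partial_derivs_zero [simp]: "partial_derivs is (\<lambda>x. 0) = (\<lambda>x. 0)"
  by (induction "is") auto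

lemma partial_derivs_const: "partial_derivs is (\<lambda>x. c) = (\<lambda>x. if is = [] then c else 0)"
  by (induction "is" rule: rev_induct) auto

lemma partial_deriv_linear_comb:
  assumes "\<And>x. f differentiable (at x)" "\<And>x. g differentiable (at x)"
  shows "partial_deriv i (\<lambda>x. a * f x + b * g x) = (\<lambda>x. a * partial_deriv i f x + b * partial_deriv i g x)"
proof
  fix x
  have f: "(f has_derivative frechet_derivative f (at x)) (at x)"
    and g: "(g has_derivative frechet_derivative g (at x)) (at x)"
    using assms frechet_derivative_works by blast+
  show "partial_deriv i (\<lambda>x. a * f x + b * g x) x = a * partial_deriv i f x + b * partial_deriv i g x"
    unfolding partial_deriv_def[of i f] partial_deriv_def[of i g]
    by (rule partial_deriv_eq) (intro has_derivative_add has_derivative_mult_right f g)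
qed

lemma smooth_upto_linear_comb:
  "smooth_upto n f \<Longrightarrow> smooth_upto n g \<Longrightarrow> smooth_upto n (\<lambda>x. a * f x + b * g x)"
proof (induction n arbitrary: f g)
  case 0
  show ?case unfolding smooth_upto_0
    by (intro allI derivative_intros smooth_upto_differentiable[OF 0(1)] smooth_upto_differentiable[OF 0(2)])
next
  case (Suc n)
  have df: "f differentiable (at x)" and dg: "g differentiable (at x)" for x
    using Suc.prems smooth_upto_Suc by blast+
  show ?case unfolding smooth_upto_Suc partial_deriv_linear_comb[OF df dg]
    using Suc.IH Suc.prems[unfolded smooth_upto_Suc] by (auto intro!: derivative_intros df dg)
qed

lemma smooth_linear_comb: "smooth f \<Longrightarrow> smooth g \<Longrightarrow> smooth (\<lambda>x. a * f x + b * g x)"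
  using smooth_upto_linear_comb smooth_iff_upto by blast

lemma smooth_add: "smooth f \<Longrightarrow> smooth g \<Longrightarrow> smooth (\<lambda>x. f x + g x)"
  using smooth_linear_comb[of f g 1 1] by simp

lemma smooth_diff: "smooth f \<Longrightarrow> smooth g \<Longrightarrow> smooth (\<lambda>x. f x - g x)"
  using smooth_linear_comb[of f g 1 "-1"] by simp

lemma smooth_cmult: "smooth f \<Longrightarrow> smooth (\<lambda>x. a * f x)"
  using smooth_linear_comb[of f f a 0] by simp

lemma partial_derivs_linear_comb:
  "smooth f \<Longrightarrow> smooth g \<Longrightarrow>
   partial_derivs is (\<lambda>x. a * f x + b * g x) = (\<lambda>x. a * partial_derivs is f x + b * partial_derivs is g x)"
  by (induction "is")
     (simp_all add: partial_deriv_linear_comb smooth_differentiable smooth_partial_derivs)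

lemma partial_derivs_add:
  "smooth f \<Longrightarrow> smooth g \<Longrightarrow>
   partial_derivs is (\<lambda>x. f x + g x) = (\<lambda>x. partial_derivs is f x + partial_derivs is g x)"
  using partial_derivs_linear_comb[of f g "is" 1 1] by simp

lemma partial_derivs_diff:
  "smooth f \<Longrightarrow> smooth g \<Longrightarrow>
   partial_derivs is (\<lambda>x. f x - g x) = (\<lambda>x. partial_derivs is f x - partial_derivs is g x)"
  using partial_derivs_linear_comb[of f g "is" 1 "-1"] by simp

lemma smooth_sum:
  "finite I \<Longrightarrow> (\<And>i. i \<in> I \<Longrightarrow> smooth (f i)) \<Longrightarrow> smooth (\<lambda>x. \<Sum>i\<in>I. f i x)"
  by (induction I rule: finite_induct) (auto intro: smooth_add)

lemma partial_derivs_sum: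
  assumes "finite I" "\<And>i. i \<in> I \<Longrightarrow> smooth (f i)"
  shows "partial_derivs is (\<lambda>x. \<Sum>i\<in>I. a i * f i x) = (\<lambda>x. \<Sum>i\<in>I. a i * partial_derivs is (f i) x)"
  using assms
proof (induction I rule: finite_induct)
  case (insert j I)
  have "partial_derivs is (\<lambda>x. a j * f j x + 1 * (\<Sum>i\<in>I. a i * f i x))
      = (\<lambda>x. a j * partial_derivs is (f j) x + 1 * partial_derivs is (\<lambda>x. \<Sum>i\<in>I. a i * f i x) x)"
    using insert.prems insert.hyps by (intro partial_derivs_linear_comb smooth_sum smooth_cmult) auto
  then show ?case using insert by simp
qed simp

lemma partial_deriv_mult:
  assumes "\<And>x. f differentiable (at x)" "\<And>x. g differentiable (at x)"
  shows "partial_deriv i (\<lambda>x. f x * g x) = (\<lambda>x. partial_deriv i f x * g x + f x * partial_deriv i g x)"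
proof
  fix x
  have f: "(f has_derivative frechet_derivative f (at x)) (at x)"
    and g: "(g has_derivative frechet_derivative g (at x)) (at x)"
    using assms frechet_derivative_works by blast+
  have "((\<lambda>x. f x * g x) has_derivative
      (\<lambda>h. f x * frechet_derivative g (at x) h + frechet_derivative f (at x) h * g x)) (at x)"
    by (rule has_derivative_mult[OF f g])
  from partial_deriv_eq[OF this]
  show "partial_deriv i (\<lambda>x. f x * g x) x = partial_deriv i f x * g x + f x * partial_deriv i g x"
    by (simp add: partial_deriv_def)
qed

lemma smooth_upto_mult:
  "smooth_upto n f \<Longrightarrow> smooth_upto n g \<Longrightarrow> smooth_upto n (\<lambda>x. f x * g x)"
proof (induction n arbitrary: f g)
  case 0
  show ?case unfolding smooth_upto_0
    by (intro allI derivative_intros smooth_upto_differentiable[OF 0(1)] smooth_upto_differentiable[OF 0(2)])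
next
  case (Suc n)
  have df: "f differentiable (at x)" and dg: "g differentiable (at x)" for x
    using Suc.prems smooth_upto_Suc by blast+
  have "smooth_upto n f" "smooth_upto n g"
    using Suc.prems smooth_upto_mono by fastforce+
  hence "smooth_upto n (\<lambda>x. 1 * (partial_deriv i f x * g x) + 1 * (f x * partial_deriv i g x))" for i
    using Suc.prems by (intro smooth_upto_linear_comb Suc.IH) (auto simp: smooth_upto_Suc)
  thus ?case unfolding smooth_upto_Suc partial_deriv_mult[OF df dg]
    by (auto intro!: derivative_intros df dg)
qed

lemma smooth_mult: "smooth f \<Longrightarrow> smooth g \<Longrightarrow> smooth (\<lambda>x. f x * g x)"
  using smooth_upto_mult smooth_iff_upto by blast

lemma smooth_prod:
  "finite I \<Longrightarrow> (\<And>i. i \<in> I \<Longrightarrow> smooth (f i)) \<Longrightarrow> smooth (\<lambda>x. \<Prod>i\<in>I. f i x)"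
  by (induction I rule: finite_induct) (auto intro: smooth_mult)

lemma smooth_inverse:
  assumes "smooth f" and nz: "\<And>x. f x \<noteq> 0"
  shows "smooth (\<lambda>x. inverse (f x))"
proof -
  have df: "f differentiable (at x)" for x using assms smooth_differentiable by blast
  have eq: "partial_deriv i (\<lambda>x. inverse (f x)) = (\<lambda>x. - partial_deriv i f x * (inverse (f x) * inverse (f x)))" for i
  proof
    fix x
    have f: "(f has_derivative frechet_derivative f (at x)) (at x)"
      using df frechet_derivative_works by blast
    show "partial_deriv i (\<lambda>x. inverse (f x)) x = - partial_deriv i f x * (inverse (f x) * inverse (f x))"
      using partial_deriv_eq[OF Deriv.has_derivative_inverse[OF nz f], of i] by (simp add: partial_deriv_def)
  qed
  have "smooth_upto n (\<lambda>x. inverse (f x))" for n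
  proof (induction n)
    case 0
    show ?case unfolding smooth_upto_0 by (intro allI derivative_intros df nz)
  next
    case (Suc n)
    have "smooth_upto n (\<lambda>x. (-1 * partial_deriv i f x + 0 * 0) * (inverse (f x) * inverse (f x)))" for i
      using smooth_partial_deriv[OF assms(1)] Suc
      by (intro smooth_upto_mult smooth_upto_linear_comb) (auto simp: smooth_iff_upto)
    then show ?case unfolding smooth_upto_Suc eq by (auto intro!: derivative_intros df nz)
  qed
  thus ?thesis by (simp add: smooth_iff_upto)
qed

subsection \<open>Affine substitutions\<close>

lemma partial_deriv_affine:
  fixes B :: "real ^ 's::finite ^ 's"
  assumes "\<And>x. g differentiable (at x)"
  shows "partial_deriv j (\<lambda>y. g (B *v y + t)) = (\<lambda>y. \<Sum>i\<in>UNIV. B $ i $ j * partial_deriv i g (B *v y + t))"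
proof
  fix y
  let ?D = "frechet_derivative g (at (B *v y + t))"
  have g: "(g has_derivative ?D) (at (B *v y + t))"
    using assms frechet_derivative_works by blast
  have lin: "linear ?D" using g has_derivative_linear by blast
  have "((\<lambda>y. B *v y + t) has_derivative (\<lambda>h. B *v h)) (at y)"
    using has_derivative_add_const[OF bounded_linear_imp_has_derivative[OF matrix_vector_mul_bounded_linear[of B]]] .
  from diff_chain_at[OF this g]
  have d: "((\<lambda>y. g (B *v y + t)) has_derivative (\<lambda>h. ?D (B *v h))) (at y)"
    by (simp add: o_def)
  have col: "B *v axis j 1 = (\<Sum>i\<in>UNIV. B $ i $ j *\<^sub>R axis i 1)"
    by (simp add: vec_eq_iff matrix_vector_mult_def axis_def if_distrib if_distribR sum.delta sum.delta' cong: if_cong)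
  have "partial_deriv j (\<lambda>y. g (B *v y + t)) y = ?D (B *v axis j 1)"
    by (rule partial_deriv_eq[OF d])
  also have "\<dots> = (\<Sum>i\<in>UNIV. B $ i $ j * ?D (axis i 1))"
    unfolding col using lin by (simp add: linear_sum linear_scale)
  finally show "partial_deriv j (\<lambda>y. g (B *v y + t)) y = (\<Sum>i\<in>UNIV. B $ i $ j * partial_deriv i g (B *v y + t))"
    by (simp add: partial_deriv_def)
qed

lemma smooth_upto_sum:
  "finite I \<Longrightarrow> (\<And>i. i \<in> I \<Longrightarrow> smooth_upto n (f i)) \<Longrightarrow> smooth_upto n (\<lambda>x. \<Sum>i\<in>I. a i * f i x)"
proof (induction I rule: finite_induct)
  case empty
  show ?case by simp
next
  case (insert j I)
  then have "smooth_upto n (\<lambda>x. a j * f j x + 1 * (\<Sum>i\<in>I. a i * f i x))"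
    by (intro smooth_upto_linear_comb) auto
  with insert show ?case by simp
qed

lemma smooth_affine:
  fixes B :: "real ^ 's::finite ^ 's"
  assumes "smooth g"
  shows "smooth (\<lambda>y. g (B *v y + t))"
proof -
  have "smooth_upto n (\<lambda>y. g (B *v y + t))" if "smooth g" for n g
    using that
  proof (induction n arbitrary: g)
    case 0
    have "(\<lambda>y. B *v y + t) differentiable at x" for x
      by (intro derivative_intros bounded_linear_imp_differentiable matrix_vector_mul_bounded_linear)
    with 0 show ?case unfolding smooth_upto_0
      using differentiable_chain_at[of "\<lambda>y. B *v y + t" _ g, unfolded o_def] smooth_differentiable by blast
  next
    case (Suc n)
    have "(\<lambda>y. B *v y + t) differentiable at x" for x
      by (intro derivative_intros bounded_linear_imp_differentiable matrix_vector_mul_bounded_linear)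
    with Suc.prems have "(\<lambda>y. g (B *v y + t)) differentiable at x" for x
      using differentiable_chain_at[of "\<lambda>y. B *v y + t" _ g, unfolded o_def] smooth_differentiable by blast
    then show ?case unfolding smooth_upto_Suc
      using Suc by (auto simp: partial_deriv_affine smooth_differentiable intro!: smooth_upto_sum smooth_partial_deriv)
  qed
  with assms show ?thesis by (simp add: smooth_iff_upto)
qed

lemma partial_derivs_affine_snoc:
  fixes B :: "real ^ 's::finite ^ 's"
  assumes "smooth g"
  shows "partial_derivs (is @ [j]) (\<lambda>y. g (B *v y + t)) =
    (\<lambda>y. \<Sum>i\<in>UNIV. B $ i $ j * partial_derivs is (\<lambda>y. partial_deriv i g (B *v y + t)) y)"
proof -
  have "partial_derivs (is @ [j]) (\<lambda>y. g (B *v y + t))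
      = partial_derivs is (\<lambda>y. \<Sum>i\<in>UNIV. B $ i $ j * partial_deriv i g (B *v y + t))"
    using arg_cong[OF partial_deriv_affine[OF smooth_differentiable[OF assms], of j B t], of "partial_derivs is"]
    by simp
  also have "\<dots> = (\<lambda>y. \<Sum>i\<in>UNIV. B $ i $ j * partial_derivs is (\<lambda>y. partial_deriv i g (B *v y + t)) y)"
    using assms by (intro partial_derivs_sum smooth_affine smooth_partial_deriv) auto
  finally show ?thesis .
qed

text \<open>
  Each derivative contributes a column of \<open>B\<close> by the chain rule, hence a factor
  \<open>CARD('s) * \<beta>\<close>. For \<open>B = A\<^sup>n\<close> this makes the derivatives of order \<open>k\<close> decay like \<open>r\<^bsup>n k\<^esup>\<close>.
\<close>
lemma partial_derivs_affine_bound: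
  fixes B :: "real ^ 's::finite ^ 's"
  assumes "smooth g" and "\<And>i j. \<bar>B $ i $ j\<bar> \<le> \<beta>"
    and "\<And>js. length js = length is \<Longrightarrow> \<bar>partial_derivs js g (B *v y + t)\<bar> \<le> b"
  shows "\<bar>partial_derivs is (\<lambda>y. g (B *v y + t)) y\<bar> \<le> (real CARD('s) * \<beta>) ^ length is * b"
  using assms(1,3)
proof (induction "is" arbitrary: g rule: rev_induct)
  case Nil
  then show ?case by simp
next
  case (snoc j "is")
  have "0 \<le> \<beta>" using assms(2)[of undefined undefined] by linarith
  have *: "\<bar>partial_derivs is (\<lambda>y. partial_deriv i g (B *v y + t)) y\<bar> \<le> (real CARD('s) * \<beta>) ^ length is * b" for i
  proof (rule snoc.IH)
    show "smooth (partial_deriv i g)" using snoc.prems smooth_partial_deriv by blast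
    show "\<bar>partial_derivs js (partial_deriv i g) (B *v y + t)\<bar> \<le> b" if "length js = length is" for js
      using snoc.prems(2)[of "js @ [i]"] that by simp
  qed
  have "\<bar>partial_derivs (is @ [j]) (\<lambda>y. g (B *v y + t)) y\<bar>
      \<le> (\<Sum>i\<in>UNIV. \<bar>B $ i $ j * partial_derivs is (\<lambda>y. partial_deriv i g (B *v y + t)) y\<bar>)"
    unfolding partial_derivs_affine_snoc[OF snoc.prems(1)] by (rule sum_abs)
  also have "\<dots> \<le> (\<Sum>i\<in>(UNIV::'s set). \<beta> * ((real CARD('s) * \<beta>) ^ length is * b))"
    unfolding abs_mult using * \<open>0 \<le> \<beta>\<close> by (intro sum_mono mult_mono assms(2)) auto
  finally show ?case by (simp add: mult_ac)
qed

text \<open>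
  If the derivatives of order \<open>n\<close> of \<open>q\<close> are constant, they transform independently of the
  translation part, so \<open>q (B y + t) - q (B y)\<close> has lower degree than \<open>q\<close>.
\<close>
lemma partial_derivs_affine_const:
  fixes B :: "real ^ 's::finite ^ 's"
  assumes "smooth g" and "\<And>js x y. length js = length is \<Longrightarrow> partial_derivs js g x = partial_derivs js g y"
  shows "partial_derivs is (\<lambda>y. g (B *v y + t)) y = partial_derivs is (\<lambda>y. g (B *v y + t')) y'"
  using assms
proof (induction "is" arbitrary: g rule: rev_induct)
  case Nil
  show ?case using Nil(2)[of "[]"] by simp
next
  case (snoc j "is")
  have "partial_derivs is (\<lambda>y. partial_deriv i g (B *v y + t)) y
      = partial_derivs is (\<lambda>y. partial_deriv i g (B *v y + t')) y'" for i
  proof (rule snoc.IH)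
    show "smooth (partial_deriv i g)" using snoc.prems smooth_partial_deriv by blast
    show "partial_derivs js (partial_deriv i g) x = partial_derivs js (partial_deriv i g) y"
      if "length js = length is" for js x y
      using snoc.prems(2)[of "js @ [i]" x y] that by simp
  qed
  then show ?case
    unfolding partial_derivs_affine_snoc[OF snoc.prems(1)] by simp
qed

subsection \<open>Mean value estimate\<close>

lemma has_derivative_partials:
  assumes "f differentiable (at x)"
  shows "(f has_derivative (\<lambda>h. \<Sum>i\<in>UNIV. h $ i * partial_deriv i f x)) (at x)"
proof -
  let ?D = "frechet_derivative f (at x)"
  have d: "(f has_derivative ?D) (at x)" using assms frechet_derivative_works by blast
  have lin: "linear ?D" using d has_derivative_linear by blast
  have "?D h = (\<Sum>i\<in>UNIV. h $ i * partial_deriv i f x)" for h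
  proof -
    have "?D h = ?D (\<Sum>i\<in>UNIV. h $ i *\<^sub>R axis i 1)"
      using basis_expansion[of h] by (simp add: scalar_mult_eq_scaleR)
    also have "\<dots> = (\<Sum>i\<in>UNIV. h $ i * ?D (axis i 1))"
      using lin by (simp add: linear_sum linear_scale)
    finally show ?thesis by (simp add: partial_deriv_def)
  qed
  hence "?D = (\<lambda>h. \<Sum>i\<in>UNIV. h $ i * partial_deriv i f x)" by blast
  with d show ?thesis by simp
qed

lemma mean_value_bound:
  fixes f :: "real ^ 's::finite \<Rightarrow> real"
  assumes "\<And>x. f differentiable (at x)"
    and "\<And>i y. y \<in> cball 0 R \<Longrightarrow> \<bar>partial_deriv i f y\<bar> \<le> b" and "x \<in> cball 0 R"
  shows "\<bar>f x - f 0\<bar> \<le> real CARD('s) * R * b"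
proof -
  have R: "0 \<le> R" using assms(3) norm_ge_zero[of x] by (auto simp del: norm_ge_zero)
  have b: "0 \<le> b" using assms(2)[of 0 undefined] R by simp
  have "norm (f x - f 0) \<le> (real CARD('s) * b) * norm (x - 0)"
  proof (rule differentiable_bound[where S = "cball 0 R"])
    fix y :: "real ^ 's" assume y: "y \<in> cball 0 R"
    show "(f has_derivative (\<lambda>h. \<Sum>i\<in>UNIV. h $ i * partial_deriv i f y)) (at y within cball 0 R)"
      using has_derivative_partials[OF assms(1)] has_derivative_at_withinI by blast
    show "onorm (\<lambda>h. \<Sum>i\<in>UNIV. h $ i * partial_deriv i f y) \<le> real CARD('s) * b"
    proof (rule onorm_le)
      fix h :: "real ^ 's"
      have "norm (\<Sum>i\<in>UNIV. h $ i * partial_deriv i f y) \<le> (\<Sum>i\<in>UNIV. \<bar>h $ i * partial_deriv i f y\<bar>)"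
        by (simp add: sum_abs)
      also have "\<dots> \<le> (\<Sum>i\<in>(UNIV::'s set). norm h * b)"
        unfolding abs_mult using y by (intro sum_mono mult_mono assms(2) component_le_norm_cart) auto
      finally show "norm (\<Sum>i\<in>UNIV. h $ i * partial_deriv i f y) \<le> real CARD('s) * b * norm h"
        by (simp add: mult_ac)
    qed
  qed (use assms(3) R in auto)
  also have "\<dots> \<le> (real CARD('s) * b) * R"
    using assms(3) b by (intro mult_left_mono) auto
  finally show ?thesis by (simp add: mult_ac)
qed

lemma constant_if_partials_vanish:
  assumes "smooth h" "\<And>i x. partial_deriv i h x = 0"
  shows "h x = h y"
proof -
  have "h x = h 0" for x
    using mean_value_bound[OF smooth_differentiable[OF assms(1)], of "norm x" 0 x] assms(2) by simp
  then show ?thesis by metis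
qed

subsection \<open>Symmetry of second derivatives\<close>

lemma has_derivative_along_axis:
  fixes f :: "real ^ 's::finite \<Rightarrow> real"
  assumes "\<And>x. f differentiable (at x)"
  shows "((\<lambda>s. f (y + s *\<^sub>R axis i 1)) has_real_derivative partial_deriv i f (y + s *\<^sub>R axis i 1)) (at s)"
proof -
  let ?D = "frechet_derivative f (at (y + s *\<^sub>R axis i 1))"
  have f: "(f has_derivative ?D) (at (y + s *\<^sub>R axis i 1))"
    using assms frechet_derivative_works by blast
  have "((\<lambda>s. y + s *\<^sub>R axis i 1) has_derivative (\<lambda>h. h *\<^sub>R axis i 1)) (at s)"
    by (auto intro!: derivative_eq_intros)
  from diff_chain_at[OF this f]
  have d: "((\<lambda>s. f (y + s *\<^sub>R axis i 1)) has_derivative (\<lambda>h. ?D (h *\<^sub>R axis i 1))) (at s)"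
    by (simp add: o_def)
  have "(\<lambda>h. ?D (h *\<^sub>R axis i 1)) = (\<lambda>h. partial_deriv i f (y + s *\<^sub>R axis i 1) * h)"
    using linear_scale[OF has_derivative_linear[OF f]] by (auto simp: partial_deriv_def)
  with d show ?thesis by (simp add: has_field_derivative_def)
qed

text \<open>
  The mean value theorem is applied in direction \<open>i\<close> and then in direction \<open>j\<close>. Since the second
  difference is symmetric in \<open>i\<close> and \<open>j\<close>, letting \<open>h\<close> tend to 0 yields the symmetry of the second
  derivatives.
\<close>
lemma second_difference:
  fixes f :: "real ^ 's::finite \<Rightarrow> real"
  assumes f: "smooth f" and h: "0 < h"
  shows "\<exists>\<xi>. dist \<xi> x \<le> 2 * h \<and>
    f (x + h *\<^sub>R axis i 1 + h *\<^sub>R axis j 1) - f (x + h *\<^sub>R axis i 1) - f (x + h *\<^sub>R axis j 1) + f x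
      = h * h * partial_deriv j (partial_deriv i f) \<xi>"
proof -
  let ?a = "axis i 1 :: real ^ 's" and ?b = "axis j 1 :: real ^ 's"
  have d: "f differentiable (at x)" for x using f smooth_differentiable by blast
  have d': "partial_deriv i f differentiable (at x)" for x
    using f smooth_differentiable smooth_partial_deriv by blast
  let ?\<phi> = "\<lambda>s. f (x + h *\<^sub>R ?b + s *\<^sub>R ?a) - f (x + s *\<^sub>R ?a)"
  have "\<exists>\<sigma>>0. \<sigma> < h \<and> ?\<phi> h - ?\<phi> 0 = (h - 0) * (partial_deriv i f (x + h *\<^sub>R ?b + \<sigma> *\<^sub>R ?a) - partial_deriv i f (x + \<sigma> *\<^sub>R ?a))"
    using h by (intro MVT2 DERIV_diff has_derivative_along_axis d) auto
  then obtain \<sigma> where s: "0 < \<sigma>" "\<sigma> < h"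
    and 1: "?\<phi> h - ?\<phi> 0 = h * (partial_deriv i f (x + h *\<^sub>R ?b + \<sigma> *\<^sub>R ?a) - partial_deriv i f (x + \<sigma> *\<^sub>R ?a))"
    by auto
  let ?\<psi> = "\<lambda>t. partial_deriv i f ((x + \<sigma> *\<^sub>R ?a) + t *\<^sub>R ?b)"
  have "\<exists>\<tau>>0. \<tau> < h \<and> ?\<psi> h - ?\<psi> 0 = (h - 0) * partial_deriv j (partial_deriv i f) ((x + \<sigma> *\<^sub>R ?a) + \<tau> *\<^sub>R ?b)"
    using h by (intro MVT2 has_derivative_along_axis d') auto
  then obtain \<tau> where t: "0 < \<tau>" "\<tau> < h"
    and 2: "?\<psi> h - ?\<psi> 0 = h * partial_deriv j (partial_deriv i f) ((x + \<sigma> *\<^sub>R ?a) + \<tau> *\<^sub>R ?b)"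
    by auto
  let ?\<xi> = "(x + \<sigma> *\<^sub>R ?a) + \<tau> *\<^sub>R ?b"
  have "dist ?\<xi> x = norm (\<sigma> *\<^sub>R ?a + \<tau> *\<^sub>R ?b)" by (simp add: dist_norm)
  also have "\<dots> \<le> norm (\<sigma> *\<^sub>R ?a) + norm (\<tau> *\<^sub>R ?b)" by (rule norm_triangle_ineq)
  also have "\<dots> \<le> 2 * h" using s t by simp
  finally have "dist ?\<xi> x \<le> 2 * h" .
  moreover have "f (x + h *\<^sub>R ?a + h *\<^sub>R ?b) - f (x + h *\<^sub>R ?a) - f (x + h *\<^sub>R ?b) + f x
      = h * h * partial_deriv j (partial_deriv i f) ?\<xi>"
    using 1 2 by (simp add: add_ac)
  ultimately show ?thesis by blast
qed

lemma partial_deriv_commute: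
  assumes f: "smooth f"
  shows "partial_deriv i (partial_deriv j f) = partial_deriv j (partial_deriv i f)"
proof
  fix x
  define h where "h n = inverse (real (Suc n))" for n
  have h: "0 < h n" for n by (simp add: h_def)
  have h0: "h \<longlonglongrightarrow> 0" unfolding h_def by (rule LIMSEQ_inverse_real_of_nat)
  let ?\<Delta> = "\<lambda>n i j. f (x + h n *\<^sub>R axis i 1 + h n *\<^sub>R axis j 1) - f (x + h n *\<^sub>R axis i 1) - f (x + h n *\<^sub>R axis j 1) + f x"
  have lim: "(\<lambda>n. ?\<Delta> n i j / (h n * h n)) \<longlonglongrightarrow> partial_deriv j (partial_deriv i f) x" for i j
  proof -
    obtain \<xi> where \<xi>: "dist (\<xi> n) x \<le> 2 * h n" "?\<Delta> n i j = h n * h n * partial_deriv j (partial_deriv i f) (\<xi> n)" for n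
      using second_difference[OF f h, of x _ i j] by metis
    have "\<xi> \<longlonglongrightarrow> x"
    proof (rule metric_tendsto_imp_tendsto[where f = "\<lambda>n. 2 * h n" and a = 0])
      show "(\<lambda>n. 2 * h n) \<longlonglongrightarrow> 0" using tendsto_mult_right[OF h0, of 2] by simp
      show "\<forall>\<^sub>F n in sequentially. dist (\<xi> n) x \<le> dist (2 * h n) 0"
        using \<xi>(1) h by (auto simp: dist_norm abs_of_pos)
    qed
    moreover have "isCont (partial_deriv j (partial_deriv i f)) x"
      by (intro differentiable_imp_continuous_within smooth_differentiable smooth_partial_deriv f)
    ultimately have "(\<lambda>n. partial_deriv j (partial_deriv i f) (\<xi> n)) \<longlonglongrightarrow> partial_deriv j (partial_deriv i f) x"
      by (rule isCont_tendsto_compose[rotated])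
    moreover have "?\<Delta> n i j / (h n * h n) = partial_deriv j (partial_deriv i f) (\<xi> n)" for n
      using \<xi>(2)[of n] h[of n] by simp
    ultimately show ?thesis by simp
  qed
  have sym: "?\<Delta> n j i = ?\<Delta> n i j" for n
  proof -
    have eq: "x + h n *\<^sub>R axis j 1 + h n *\<^sub>R axis i 1 = x + h n *\<^sub>R axis i 1 + h n *\<^sub>R axis j 1"
      by (metis add.assoc add.commute)
    show ?thesis unfolding eq by simp
  qed
  hence "(\<lambda>n. ?\<Delta> n i j / (h n * h n)) \<longlonglongrightarrow> partial_deriv i (partial_deriv j f) x"
    using lim[of j i] by (simp only: sym)
  thus "partial_deriv i (partial_deriv j f) x = partial_deriv j (partial_deriv i f) x"
    using lim[of i j] LIMSEQ_unique by blast
qed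

subsection \<open>Taylor polynomials\<close>

text \<open>
  The value at \<open>y\<close> of the \<open>n\<close>-th derivative of \<open>g\<close> at 0, as a form of degree \<open>n\<close>. This recursion
  spares multi-indices and turns the rule for its derivatives into an induction.
\<close>
fun taylor_form :: "nat \<Rightarrow> (real ^ 's::finite \<Rightarrow> real) \<Rightarrow> real ^ 's \<Rightarrow> real" where
  "taylor_form 0 g y = g 0"
| "taylor_form (Suc n) g y = (\<Sum>i\<in>UNIV. y $ i * taylor_form n (partial_deriv i g) y)"

lemma has_derivative_component: "((\<lambda>y. y $ i) has_derivative (\<lambda>h. h $ i)) (at x)"
  by (rule bounded_linear_imp_has_derivative[OF bounded_linear_vec_nth])

lemma partial_deriv_component: "partial_deriv j (\<lambda>y. y $ i) = (\<lambda>y. if i = j then 1 else 0)"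
proof
  show "partial_deriv j (\<lambda>y. y $ i) y = (if i = j then 1 else 0)" for y
    using partial_deriv_eq[OF has_derivative_component, of j i y] by (auto simp: axis_def)
qed

lemma smooth_component: "smooth (\<lambda>y. y $ i)"
  by (rule smooth_coinduct[where P = "\<lambda>f. f = (\<lambda>y. y $ i) \<or> (\<exists>c. f = (\<lambda>x. c))"])
     (auto simp: partial_deriv_component intro: has_derivative_component[THEN differentiableI])

lemma smooth_taylor_form: "smooth (taylor_form n g)"
proof (induction n arbitrary: g)
  case (Suc n)
  have "smooth (\<lambda>y. \<Sum>i\<in>UNIV. y $ i * taylor_form n (partial_deriv i g) y)"
    by (intro smooth_sum smooth_mult Suc smooth_component) auto
  moreover have "taylor_form (Suc n) g = (\<lambda>y. \<Sum>i\<in>UNIV. y $ i * taylor_form n (partial_deriv i g) y)"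
    by (rule ext) simp
  ultimately show ?case by simp
next
  case 0
  have "taylor_form 0 g = (\<lambda>y. g 0)" by (rule ext) simp
  then show ?case by simp
qed

text \<open>
  Euler's rule for forms. By the product rule the derivative of form number \<open>n + 1\<close> is form number \<open>n\<close>
  of \<open>partial_deriv j g\<close> plus a sum to which the induction hypothesis applies; the symmetry of the
  second derivatives identifies that sum as \<open>n\<close> further copies.
\<close>
lemma partial_deriv_taylor_form:
  "smooth g \<Longrightarrow> partial_deriv j (taylor_form (Suc n) g) = (\<lambda>y. real (Suc n) * taylor_form n (partial_deriv j g) y)"
proof (induction n arbitrary: g)
  have delta: "(\<Sum>i\<in>UNIV. (if i = j then 1 else 0) * t i) = t j" for t :: "'a \<Rightarrow> real"
  proof -
    have "(\<Sum>i\<in>UNIV. (if i = j then 1 else 0) * t i) = (\<Sum>i\<in>UNIV. if i = j then t i else 0)"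
      by (rule sum.cong) auto
    thus ?thesis by simp
  qed
  have sum: "partial_deriv j (taylor_form (Suc n) g) =
    (\<lambda>y. taylor_form n (partial_deriv j g) y + (\<Sum>i\<in>UNIV. y $ i * partial_deriv j (taylor_form n (partial_deriv i g)) y))" for g n
  proof -
    have "taylor_form (Suc n) g = (\<lambda>y. \<Sum>i\<in>UNIV. 1 * (y $ i * taylor_form n (partial_deriv i g) y))"
      by (rule ext) simp
    then have "partial_deriv j (taylor_form (Suc n) g)
        = partial_derivs [j] (\<lambda>y. \<Sum>i\<in>UNIV. 1 * (y $ i * taylor_form n (partial_deriv i g) y))"
      by simp
    also have "\<dots> = (\<lambda>y. \<Sum>i\<in>UNIV. 1 * partial_derivs [j] (\<lambda>y. y $ i * taylor_form n (partial_deriv i g) y) y)"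
      by (intro partial_derivs_sum smooth_mult smooth_component smooth_taylor_form) auto
    also have "\<dots> = (\<lambda>y. \<Sum>i\<in>UNIV. (if i = j then 1 else 0) * taylor_form n (partial_deriv i g) y
         + y $ i * partial_deriv j (taylor_form n (partial_deriv i g)) y)"
      by (simp only: foldr.simps o_apply id_apply mult_1 partial_deriv_component
          partial_deriv_mult[OF smooth_differentiable[OF smooth_component] smooth_differentiable[OF smooth_taylor_form]])
    also have "\<dots> = (\<lambda>y. taylor_form n (partial_deriv j g) y + (\<Sum>i\<in>UNIV. y $ i * partial_deriv j (taylor_form n (partial_deriv i g)) y))"
      unfolding sum.distrib delta ..
    finally show ?thesis .
  qed
  {
    case 0
    have "taylor_form 0 h = (\<lambda>y. h 0)" for h :: "real ^ 'a \<Rightarrow> real" by (rule ext) simp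
    then have "partial_deriv j (taylor_form 0 h) = (\<lambda>y. 0)" for h by simp
    then show ?case unfolding sum by (simp add: fun_eq_iff)
  next
    case (Suc n)
    have "partial_deriv j (taylor_form (Suc n) (partial_deriv i g)) =
        (\<lambda>y. real (Suc n) * taylor_form n (partial_deriv i (partial_deriv j g)) y)" for i
      using Suc.IH[OF smooth_partial_deriv[OF Suc.prems], of i] partial_deriv_commute[OF Suc.prems, of i j]
      by (simp del: taylor_form.simps)
    then show ?case unfolding sum[of "Suc n"]
      by (simp add: fun_eq_iff algebra_simps sum_distrib_left sum.distrib)
  }
qed

definition taylor_poly :: "nat \<Rightarrow> (real ^ 's::finite \<Rightarrow> real) \<Rightarrow> real ^ 's \<Rightarrow> real" where
  "taylor_poly n g y = (\<Sum>k\<le>n. taylor_form k g y / fact k)"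

lemma smooth_taylor_poly: "smooth (taylor_poly n g)"
proof -
  have "smooth (\<lambda>y. \<Sum>k\<le>n. 1 / fact k * taylor_form k g y)"
    by (intro smooth_sum smooth_cmult smooth_taylor_form) auto
  thus ?thesis by (simp add: taylor_poly_def[abs_def])
qed

lemma taylor_poly_at_0: "taylor_poly n g 0 = g 0"
proof -
  have "taylor_poly n g 0 = (\<Sum>k\<le>n. if k = 0 then g 0 else 0)"
    unfolding taylor_poly_def by (intro sum.cong) (auto simp: gr0_conv_Suc)
  thus ?thesis by simp
qed

lemma partial_deriv_taylor_poly:
  assumes "smooth g"
  shows "partial_deriv j (taylor_poly (Suc n) g) = taylor_poly n (partial_deriv j g)"
    and "partial_deriv j (taylor_poly 0 g) = (\<lambda>y. 0)"
proof -
  have 0: "partial_deriv j (taylor_form 0 g) = (\<lambda>y. 0)"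
  proof -
    have "taylor_form 0 g = (\<lambda>y. g 0)" by (rule ext) simp
    thus ?thesis by simp
  qed
  have *: "partial_deriv j (taylor_poly n g) = (\<lambda>y. \<Sum>k\<le>n. (1 / fact k) * partial_deriv j (taylor_form k g) y)" for n
    using partial_derivs_sum[of "{..n}" "\<lambda>k. taylor_form k g" "[j]" "\<lambda>k. 1 / fact k", OF finite_atMost smooth_taylor_form]
    by (simp add: taylor_poly_def[abs_def])
  show "partial_deriv j (taylor_poly 0 g) = (\<lambda>y. 0)" unfolding * by (simp add: 0)
  show "partial_deriv j (taylor_poly (Suc n) g) = taylor_poly n (partial_deriv j g)"
    unfolding *
  proof
    fix y
    have "(\<Sum>k\<le>Suc n. (1 / fact k) * partial_deriv j (taylor_form k g) y)
        = (\<Sum>k\<le>n. (1 / fact (Suc k)) * partial_deriv j (taylor_form (Suc k) g) y)"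
      unfolding sum.atMost_Suc_shift using 0 by simp
    also have "\<dots> = (\<Sum>k\<le>n. taylor_form k (partial_deriv j g) y / fact k)"
      by (intro sum.cong refl) (simp add: partial_deriv_taylor_form[OF assms] fact_Suc del: taylor_form.simps of_nat_Suc)
    finally show "(\<Sum>k\<le>Suc n. (1 / fact k) * partial_deriv j (taylor_form k g) y) = taylor_poly n (partial_deriv j g) y"
      by (simp add: taylor_poly_def)
  qed
qed

lemma partial_derivs_taylor_poly:
  "smooth g \<Longrightarrow> partial_derivs is (taylor_poly n g) =
     (if length is \<le> n then taylor_poly (n - length is) (partial_derivs is g) else (\<lambda>y. 0))"
proof (induction "is")
  case (Cons i "is")
  have s: "smooth (partial_derivs is g)" using Cons.prems smooth_partial_derivs by blast
  consider "length is < n" | "length is = n" | "n < length is" by linarith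
  then show ?case
  proof cases
    case 1
    then have "n - length is = Suc (n - length (i # is))" by simp
    then show ?thesis using 1 Cons partial_deriv_taylor_poly(1)[OF s] by simp
  qed (use Cons partial_deriv_taylor_poly(2)[OF s] in auto)
qed simp

text \<open>
  The derivatives of the remainder up to order \<open>n\<close> vanish at 0, and those of order \<open>n + 1\<close> are the ones
  of \<open>g\<close>. Every application of the mean value estimate lowers the order by one and costs a factor
  \<open>CARD('s) * R\<close>.
\<close>
lemma taylor_remainder_bound:
  fixes g :: "real ^ 's::finite \<Rightarrow> real"
  assumes g: "smooth g" and R: "0 \<le> R"
    and b: "\<And>is y. length is = Suc n \<Longrightarrow> y \<in> cball 0 R \<Longrightarrow> \<bar>partial_derivs is g y\<bar> \<le> b"
    and "length is \<le> n" "y \<in> cball 0 R"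
  shows "\<bar>partial_derivs is (\<lambda>y. g y - taylor_poly n g y) y\<bar> \<le> (real CARD('s) * R) ^ (Suc n - length is) * b"
proof -
  let ?r = "\<lambda>y. g y - taylor_poly n g y"
  have r: "smooth ?r" by (intro smooth_diff g smooth_taylor_poly)
  have eq: "partial_derivs is ?r = (\<lambda>y. partial_derivs is g y - partial_derivs is (taylor_poly n g) y)" for "is"
    by (intro partial_derivs_diff g smooth_taylor_poly)
  have "\<bar>partial_derivs is ?r y\<bar> \<le> (real CARD('s) * R) ^ k * b"
    if "length is + k = Suc n" "y \<in> cball 0 R" for "is" k y
    using that
  proof (induction k arbitrary: "is" y)
    case 0
    then show ?case using b[of "is" y] unfolding eq by (simp add: partial_derivs_taylor_poly g)
  next
    case (Suc k)
    have "partial_derivs is ?r 0 = 0"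
      using Suc.prems(1) unfolding eq by (simp add: partial_derivs_taylor_poly g taylor_poly_at_0)
    moreover have "\<bar>partial_derivs is ?r y - partial_derivs is ?r 0\<bar>
        \<le> real CARD('s) * R * ((real CARD('s) * R) ^ k * b)"
    proof (rule mean_value_bound)
      show "partial_derivs is ?r differentiable at x" for x
        using r smooth_def by blast
      show "\<bar>partial_deriv i (partial_derivs is ?r) z\<bar> \<le> (real CARD('s) * R) ^ k * b"
        if "z \<in> cball 0 R" for i z
        using Suc.IH[of "i # is" z] Suc.prems(1) that by simp
    qed (use Suc.prems in auto)
    ultimately show ?case by (simp add: mult_ac)
  qed
  from this[of "is" "Suc n - length is" y] show ?thesis using assms by simp
qed

subsection \<open>Smooth bumps\<close>

lemma poly_times_exp_minus_tendsto_0: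
  "((\<lambda>x::real. x ^ k * poly p x * exp (- x)) \<longlongrightarrow> 0) at_top"
proof (induction p arbitrary: k)
  case 0
  show ?case by simp
next
  case (pCons a p)
  have "((\<lambda>x::real. a * (x ^ k / exp x) + x ^ Suc k * poly p x * exp (- x)) \<longlongrightarrow> a * 0 + 0) at_top"
    by (intro tendsto_intros tendsto_power_div_exp_0 pCons)
  thus ?case by (simp add: field_simps exp_minus)
qed

text \<open>
  The function \<open>exp (- 1 / t)\<close>, together with the polynomials in \<open>1 / t\<close> that its derivatives bring in.
\<close>
definition flat_exp :: "real poly \<Rightarrow> real \<Rightarrow> real" where
  "flat_exp p t = (if 0 < t then poly p (1 / t) * exp (- (1 / t)) else 0)"

lemma DERIV_flat_exp:
  "(flat_exp p has_real_derivative flat_exp ([:0, 0, 1:] * (p - pderiv p)) t) (at t)"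
proof -
  consider "0 < t" | "t < 0" | "t = 0" by linarith
  thus ?thesis
  proof cases
    case 1
    have "((\<lambda>t. poly p (1 / t) * exp (- (1 / t))) has_real_derivative
        flat_exp ([:0, 0, 1:] * (p - pderiv p)) t) (at t)"
      using 1 unfolding flat_exp_def
      by (auto intro!: derivative_eq_intros DERIV_chain2[OF poly_DERIV] simp: field_simps power2_eq_square)
    moreover have "\<forall>\<^sub>F x in nhds t. poly p (1 / x) * exp (- (1 / x)) = flat_exp p x"
      using eventually_nhds_in_open[of "{0<..}" t] 1 by (auto simp: flat_exp_def elim: eventually_mono)
    ultimately show ?thesis by (subst (asm) DERIV_cong_ev[OF refl _ refl]) auto
  next
    case 2
    have "((\<lambda>t. 0) has_real_derivative flat_exp ([:0, 0, 1:] * (p - pderiv p)) t) (at t)"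
      using 2 by (simp add: flat_exp_def)
    moreover have "\<forall>\<^sub>F x in nhds t. 0 = flat_exp p x"
      using eventually_nhds_in_open[of "{..<0}" t] 2 by (auto simp: flat_exp_def elim: eventually_mono)
    ultimately show ?thesis by (subst (asm) DERIV_cong_ev[OF refl _ refl]) auto
  next
    case 3
    have "((\<lambda>t. inverse t ^ 1 * poly p (inverse t) * exp (- inverse t)) \<longlongrightarrow> 0) (at_right (0::real))"
      by (rule filterlim_compose[OF poly_times_exp_minus_tendsto_0 filterlim_inverse_at_top_right])
    then have right: "((\<lambda>t. flat_exp p t / t) \<longlongrightarrow> 0) (at_right 0)"
      by (rule Lim_transform_eventually)
         (auto simp: eventually_at_filter flat_exp_def field_simps)
    have left: "((\<lambda>t. flat_exp p t / t) \<longlongrightarrow> 0) (at_left 0)"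
      by (rule tendsto_eventually) (auto simp: eventually_at_filter flat_exp_def)
    have "((\<lambda>t. flat_exp p t / t) \<longlongrightarrow> 0) (at 0)"
      using left right by (simp add: filterlim_at_split)
    thus ?thesis using 3 by (simp add: has_field_derivative_iff flat_exp_def)
  qed
qed

lemma smooth_flat_exp: "smooth (\<lambda>x. flat_exp p (s * x $ i + a))"
proof (rule smooth_coinduct[where P = "\<lambda>f. \<exists>p c. f = (\<lambda>x. c * flat_exp p (s * x $ i + a))"])
  let ?D = "\<lambda>p. [:0, 0, 1:] * (p - pderiv p)"
  have d: "((\<lambda>x. c * flat_exp p (s * x $ i + a)) has_derivative
      (\<lambda>h. c * (flat_exp (?D p) (s * x $ i + a) * (s * h $ i)))) (at x)" for p c and x :: "real ^ 'a"
  proof -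
    have l: "((\<lambda>x. s * x $ i + a) has_derivative (\<lambda>h. s * h $ i)) (at x)"
      by (auto intro!: derivative_eq_intros has_derivative_component)
    have e: "(flat_exp p has_derivative (\<lambda>h. flat_exp (?D p) (s * x $ i + a) * h)) (at (s * x $ i + a))"
      using DERIV_flat_exp[of p] unfolding has_field_derivative_def by blast
    show ?thesis
      using has_derivative_mult_right[OF diff_chain_at[OF l e], of c] by (simp add: o_def)
  qed
  show "\<exists>pa c. (\<lambda>x. flat_exp p (s * x $ i + a)) = (\<lambda>x. c * flat_exp pa (s * x $ i + a))"
    by (rule exI[of _ p], rule exI[of _ 1]) simp
  fix f :: "real ^ 'a \<Rightarrow> real"
  assume "\<exists>p c. f = (\<lambda>x. c * flat_exp p (s * x $ i + a))"
  then obtain p c where f: "f = (\<lambda>x. c * flat_exp p (s * x $ i + a))" by blast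
  show "f differentiable at x" for x unfolding f using d differentiableI by blast
  fix j
  have "partial_deriv j f = (\<lambda>x. (c * s * (if i = j then 1 else 0)) * flat_exp (?D p) (s * x $ i + a))"
    unfolding f by (rule ext, subst partial_deriv_eq[OF d]) (auto simp: axis_def)
  thus "\<exists>p c. partial_deriv j f = (\<lambda>x. c * flat_exp p (s * x $ i + a))" by blast
qed

definition smooth_step :: "real \<Rightarrow> real" where
  "smooth_step t = flat_exp 1 t * inverse (flat_exp 1 t + flat_exp 1 (1 - t))"

lemma smooth_step_denominator: "0 < flat_exp 1 t + flat_exp 1 (1 - t)"
  by (auto simp: flat_exp_def intro: add_pos_nonneg)

lemma smooth_step_bounds: "0 \<le> smooth_step t" "smooth_step t \<le> 1"
proof -
  have "0 \<le> flat_exp 1 t" "0 \<le> flat_exp 1 (1 - t)" by (auto simp: flat_exp_def)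
  with smooth_step_denominator[of t] show "0 \<le> smooth_step t" "smooth_step t \<le> 1"
    by (auto simp: smooth_step_def field_simps)
qed

lemma smooth_step_0: "t \<le> 0 \<Longrightarrow> smooth_step t = 0"
  by (simp add: smooth_step_def flat_exp_def)

lemma smooth_step_1: "1 \<le> t \<Longrightarrow> smooth_step t = 1"
  by (simp add: smooth_step_def flat_exp_def)

lemma smooth_smooth_step: "smooth (\<lambda>x. smooth_step (s * x $ i + a))"
proof -
  have eq: "(\<lambda>x. flat_exp 1 (1 - (s * x $ i + a))) = (\<lambda>x. flat_exp 1 (- s * x $ i + (1 - a)))"
    by (simp add: algebra_simps)
  show ?thesis unfolding smooth_step_def
  proof (intro smooth_mult smooth_inverse smooth_add smooth_flat_exp)
    show "smooth (\<lambda>x. flat_exp 1 (1 - (s * x $ i + a)))" unfolding eq by (rule smooth_flat_exp)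
    show "flat_exp 1 (s * x $ i + a) + flat_exp 1 (1 - (s * x $ i + a)) \<noteq> 0" for x
      using smooth_step_denominator[of "s * x $ i + a"] by linarith
  qed
qed

text \<open>
  The bigger \<open>n\<close>, the steeper the flanks of the bump inside the box.
\<close>
definition box_bump :: "real \<Rightarrow> real ^ 's \<Rightarrow> real ^ 's \<Rightarrow> real ^ 's::finite \<Rightarrow> real" where
  "box_bump n a b x = (\<Prod>i\<in>UNIV. smooth_step (n * (x $ i - a $ i)) * smooth_step (n * (b $ i - x $ i)))"

lemma smooth_box_bump: "smooth (box_bump n a b)"
proof -
  have "smooth (\<lambda>x. smooth_step (n * x $ i + (- n * a $ i)))"
    "smooth (\<lambda>x. smooth_step ((- n) * x $ i + n * b $ i))" for i
    by (rule smooth_smooth_step)+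
  hence "smooth (\<lambda>x. smooth_step (n * (x $ i - a $ i)))"
    "smooth (\<lambda>x. smooth_step (n * (b $ i - x $ i)))" for i
    by (simp_all add: algebra_simps)
  thus ?thesis unfolding box_bump_def[abs_def] by (intro smooth_prod smooth_mult) auto
qed

lemma box_bump_bounds: "0 \<le> box_bump n a b x" "box_bump n a b x \<le> 1"
  unfolding box_bump_def
  by (auto intro!: prod_nonneg prod_le_1 mult_le_one smooth_step_bounds mult_nonneg_nonneg)

lemma box_bump_outside:
  assumes "0 \<le> n" "x \<notin> box a b"
  shows "box_bump n a b x = 0"
proof -
  obtain i where "x $ i - a $ i \<le> 0 \<or> b $ i - x $ i \<le> 0"
    using assms(2) by (auto simp: mem_box_cart not_less)
  hence "smooth_step (n * (x $ i - a $ i)) * smooth_step (n * (b $ i - x $ i)) = 0"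
    using assms(1) by (auto simp: smooth_step_0 mult_nonneg_nonpos)
  thus ?thesis unfolding box_bump_def by (intro prod_zero) auto
qed

lemma box_bump_inside:
  assumes "\<And>i. 1 \<le> n * (x $ i - a $ i)" "\<And>i. 1 \<le> n * (b $ i - x $ i)"
  shows "box_bump n a b x = 1"
  using assms by (simp add: box_bump_def smooth_step_1)

lemma box_bump_tendsto_indicator:
  "(\<lambda>n. box_bump (real n) a b x) \<longlonglongrightarrow> indicator (box a b) x"
proof (cases "x \<in> box a b")
  case False
  then show ?thesis by (simp add: box_bump_outside)
next
  case True
  then have pos: "0 < x $ i - a $ i" "0 < b $ i - x $ i" for i
    by (auto simp: mem_box_cart)
  have "\<forall>\<^sub>F n in sequentially. 1 \<le> real n * y" if y: "0 < y" for y
  proof -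
    obtain N :: nat where N: "1 < real N * y" using reals_Archimedean3[OF y] by blast
    have "1 \<le> real n * y" if "N \<le> n" for n
    proof -
      have "real N * y \<le> real n * y" using that y by (intro mult_right_mono) auto
      with N show ?thesis by linarith
    qed
    thus ?thesis using eventually_sequentially by blast
  qed
  then have "\<forall>\<^sub>F n in sequentially. \<forall>i. 1 \<le> real n * (x $ i - a $ i) \<and> 1 \<le> real n * (b $ i - x $ i)"
    using pos by (intro eventually_all_finite eventually_conj) auto
  then have "\<forall>\<^sub>F n in sequentially. box_bump (real n) a b x = 1"
    by eventually_elim (simp add: box_bump_inside)
  with True show ?thesis by (simp add: tendsto_eventually)
qed

lemma fun_support_subset_closed: "closed S \<Longrightarrow> (\<And>x. f x \<noteq> 0 \<Longrightarrow> x \<in> S) \<Longrightarrow> fun_support f \<subseteq> S"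
  unfolding fun_support_def by (rule closure_minimal) auto

lemma test_funI:
  fixes f :: "real ^ 's::finite \<Rightarrow> real"
  assumes "smooth f" "\<And>x. f x \<noteq> 0 \<Longrightarrow> x \<in> S" "bounded S"
  shows "test_fun f"
  unfolding test_fun_def fun_support_def compact_eq_bounded_closed
  using assms bounded_subset[of S "{x. f x \<noteq> 0}"] by (auto intro: bounded_closure)

lemma test_box_bump: "0 \<le> n \<Longrightarrow> test_fun (box_bump n a b)"
  by (rule test_funI[OF smooth_box_bump, of _ _ _ "box a b"]) (use box_bump_outside in blast, rule bounded_box)

lemma cutoff_exists:
  fixes R :: real
  obtains \<eta> :: "real ^ 's::finite \<Rightarrow> real" where
    "test_fun \<eta>" "\<And>x. x \<in> cball 0 R \<Longrightarrow> \<eta> x = 1" "\<And>x. 0 \<le> \<eta> x" "\<And>x. \<eta> x \<le> 1"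
proof
  let ?a = "(\<chi> i. - (\<bar>R\<bar> + 1)) :: real ^ 's" and ?b = "(\<chi> i. \<bar>R\<bar> + 1) :: real ^ 's"
  show "test_fun (box_bump 1 ?a ?b)" by (rule test_box_bump) simp
  show "0 \<le> box_bump 1 ?a ?b x" "box_bump 1 ?a ?b x \<le> 1" for x by (rule box_bump_bounds)+
  fix x :: "real ^ 's" assume x: "x \<in> cball 0 R"
  then have "norm x \<le> R" by simp
  then have x: "- \<bar>R\<bar> \<le> x $ i" "x $ i \<le> \<bar>R\<bar>" for i
    using component_le_norm_cart[of x i] by linarith+
  have "1 \<le> 1 * (x $ i - ?a $ i)" "1 \<le> 1 * (?b $ i - x $ i)" for i
    using x[of i] by simp_all
  thus "box_bump 1 ?a ?b x = 1" by (rule box_bump_inside)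
qed

section \<open>The fundamental lemma of the calculus of variations\<close>

text \<open>
  The bumps in the box are test functions that increase in steepness to the indicator of the box, so
  dominated convergence carries the assumption over to the box.
\<close>
lemma box_integral_zero:
  fixes F :: "real ^ 's::finite \<Rightarrow> real"
  assumes [measurable]: "F \<in> borel_measurable borel"
    and loc: "\<And>R. integrable lborel (\<lambda>x. indicator (cball 0 R) x * F x)"
    and zero: "\<And>f. test_fun f \<Longrightarrow> (\<integral>x. F x * f x \<partial>lborel) = 0"
  shows "(\<integral>x. indicator (box a b) x * F x \<partial>lborel) = 0"
proof -
  obtain R where R: "box a b \<subseteq> cball 0 R"
    using bounded_box[of a b] by (auto simp: bounded_iff subset_iff)
  have [measurable]: "box_bump n a b \<in> borel_measurable borel" for n
    by (intro borel_measurable_continuous_onI smooth_continuous smooth_box_bump)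
  have "(\<lambda>n. \<integral>x. F x * box_bump (real n) a b x \<partial>lborel) \<longlonglongrightarrow> (\<integral>x. F x * indicator (box a b) x \<partial>lborel)"
  proof (rule integral_dominated_convergence[where w = "\<lambda>x. \<bar>indicator (cball 0 R) x * F x\<bar>"])
    show "integrable lborel (\<lambda>x. \<bar>indicator (cball 0 R) x * F x\<bar>)"
      using loc by (rule integrable_abs)
    show "AE x in lborel. (\<lambda>n. F x * box_bump (real n) a b x) \<longlonglongrightarrow> F x * indicator (box a b) x"
      by (intro AE_I2 tendsto_intros box_bump_tendsto_indicator)
    show "AE x in lborel. norm (F x * box_bump (real n) a b x) \<le> \<bar>indicator (cball 0 R) x * F x\<bar>" for n
    proof (rule AE_I2)
      fix x
      show "norm (F x * box_bump (real n) a b x) \<le> \<bar>indicator (cball 0 R) x * F x\<bar>"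
      proof (cases "x \<in> box a b")
        case True
        then have "x \<in> cball 0 R" using R by blast
        then show ?thesis using box_bump_bounds[of "real n" a b x]
          by (simp add: abs_mult mult_left_le)
      qed (simp add: box_bump_outside)
    qed
  qed measurable
  moreover have "(\<integral>x. F x * box_bump (real n) a b x \<partial>lborel) = 0" for n
    by (intro zero test_box_bump) simp
  ultimately have "(\<lambda>n :: nat. 0) \<longlonglongrightarrow> (\<integral>x. F x * indicator (box a b) x \<partial>lborel)"
    by (simp only:)
  then have "(\<integral>x. F x * indicator (box a b) x \<partial>lborel) = 0"
    by (simp only: LIMSEQ_const_iff)
  then show ?thesis by (simp add: mult.commute)
qed

text \<open>
  The sets over which \<open>F\<close> has integral 0 form a Dynkin system, and the boxes are a generator of the
  Borel sets that is stable under intersections.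
\<close>
lemma AE_zero_if_box_integrals_zero:
  fixes F :: "'a::euclidean_space \<Rightarrow> real"
  assumes F: "integrable lborel F"
    and zero: "\<And>a b. (\<integral>x. indicator (box a b) x * F x \<partial>lborel) = 0"
    and total: "(\<integral>x. F x \<partial>lborel) = 0"
  shows "AE x in lborel. F x = 0"
proof (rule sigma_finite_measure.density_zero[OF sigma_finite_lborel F])
  have [measurable]: "F \<in> borel_measurable borel" using F by auto
  have int: "integrable lborel (\<lambda>x. indicator X x * F x)" if "X \<in> sets borel" for X
    using integrable_mult_indicator[of X lborel F] F that by simp
  fix X :: "'a set" assume "X \<in> sets lborel"
  then have X: "X \<in> sigma_sets UNIV (range (\<lambda>(a, b). box a b))"
    by (simp add: borel_eq_box)
  have "Int_stable (range (\<lambda>(a, b). box a b :: 'a set))"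
    by (auto simp: Int_stable_def box_Int_box)
  moreover have "range (\<lambda>(a, b). box a b :: 'a set) \<subseteq> Pow UNIV" by simp
  ultimately have "(\<integral>x. indicator X x * F x \<partial>lborel) = 0" using X
  proof (induction rule: sigma_sets_induct_disjoint)
    case (basic Y)
    then show ?case using zero by auto
  next
    case empty
    show ?case by simp
  next
    case (compl Y)
    then have Y: "Y \<in> sets borel" by (simp add: borel_eq_box)
    have "(\<integral>x. indicator (UNIV - Y) x * F x \<partial>lborel) = (\<integral>x. F x - indicator Y x * F x \<partial>lborel)"
      by (intro Bochner_Integration.integral_cong) (auto simp: indicator_def)
    also have "\<dots> = 0" using compl F int[OF Y] total by simp
    finally show ?case .
  next
    case (union Y)
    then have Y: "Y i \<in> sets lborel" for i by (auto simp: borel_eq_box)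
    have "(LINT x:(\<Union>i. Y i)|lborel. F x) = (\<Sum>i. LINT x:Y i|lborel. F x)"
    proof (rule lebesgue_integral_countable_add[OF Y])
      show "set_integrable lborel (\<Union>i. Y i) F"
        unfolding set_integrable_def using int[of "\<Union>i. Y i"] Y by auto
      show "\<And>i j. i \<noteq> j \<Longrightarrow> Y i \<inter> Y j = {}" using union(1) by (auto simp: disjoint_family_on_def)
    qed
    also have "\<dots> = 0" using union by (simp add: set_lebesgue_integral_def)
    finally show ?case by (simp add: set_lebesgue_integral_def)
  qed
  then show "set_lebesgue_integral lborel X F = 0"
    by (simp add: set_lebesgue_integral_def)
qed

theorem fundamental_lemma_variations:
  fixes F :: "real ^ 's::finite \<Rightarrow> real"
  assumes [measurable]: "F \<in> borel_measurable borel"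
    and loc: "\<And>R. integrable lborel (\<lambda>x. indicator (cball 0 R) x * F x)"
    and zero: "\<And>f. test_fun f \<Longrightarrow> (\<integral>x. F x * f x \<partial>lborel) = 0"
  shows "AE x in lborel. F x = 0"
proof -
  let ?b = "\<lambda>n. (\<chi> i. real n) :: real ^ 's"
  let ?F = "\<lambda>n x. indicator (box (- ?b n) (?b n)) x * F x"
  have "AE x in lborel. ?F n x = 0" for n
  proof (rule AE_zero_if_box_integrals_zero)
    obtain R where R: "box (- ?b n) (?b n) \<subseteq> cball 0 R"
      using bounded_box[of "- ?b n" "?b n"] by (auto simp: bounded_iff subset_iff)
    have "integrable lborel (\<lambda>x. indicator (box (- ?b n) (?b n)) x *\<^sub>R (indicator (cball 0 R) x * F x))"
      by (intro integrable_mult_indicator loc) auto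
    moreover have "(\<lambda>x. indicator (box (- ?b n) (?b n)) x *\<^sub>R (indicator (cball 0 R) x * F x)) = ?F n"
      using R by (auto simp: indicator_def fun_eq_iff)
    ultimately show "integrable lborel (?F n)" by simp
    show "(\<integral>x. ?F n x \<partial>lborel) = 0"
      by (rule box_integral_zero[OF assms])
    show "(\<integral>x. indicator (box a b) x * ?F n x \<partial>lborel) = 0" for a b
    proof -
      obtain c d where cd: "box a b \<inter> box (- ?b n) (?b n) = box c d"
        unfolding box_Int_box by blast
      have "(\<lambda>x. indicator (box a b) x * ?F n x) = (\<lambda>x. indicator (box c d) x * F x)"
        unfolding cd[symmetric] by (auto simp: indicator_def fun_eq_iff)
      then show ?thesis using box_integral_zero[OF assms, of c d] by (simp only:)
    qed
  qed
  then have "AE x in lborel. \<forall>n. ?F n x = 0" unfolding AE_all_countable by blast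
  then show ?thesis
  proof eventually_elim
    case (elim x)
    obtain n :: nat where n: "norm x < real n" using reals_Archimedean2 by blast
    have "x \<in> box (- ?b n) (?b n)"
      unfolding mem_box_cart
    proof (intro allI conjI)
      fix i
      show "(- ?b n) $ i < x $ i" "x $ i < ?b n $ i"
        using n component_le_norm_cart[of x i] by simp_all
    qed
    then show ?case using elim[rule_format, of n] by simp
  qed
qed

section \<open>Powers of the inverse of an expansive matrix\<close>

text \<open>
  Geometric decay along the orbit of a single vector, with constants that may depend on the vector.
  This form suits an induction on an annihilating polynomial.
\<close>
definition decaying :: "'a::real_normed_field ^ 's ^ 's \<Rightarrow> 'a ^ 's::finite \<Rightarrow> bool" where
  "decaying P v \<longleftrightarrow> (\<exists>C r. 0 \<le> r \<and> r < 1 \<and> (\<forall>n. norm (((*v) P ^^ n) v) \<le> C * r ^ n))"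

definition poly_at :: "complex ^ 's ^ 's \<Rightarrow> complex poly \<Rightarrow> complex ^ 's \<Rightarrow> complex ^ 's::finite" where
  "poly_at P p v = (\<Sum>i\<le>degree p. coeff p i *s ((*v) P ^^ i) v)"

lemma poly_at_upto: "degree p \<le> n \<Longrightarrow> poly_at P p v = (\<Sum>i\<le>n. coeff p i *s ((*v) P ^^ i) v)"
  unfolding poly_at_def by (rule sum.mono_neutral_left) (auto simp: coeff_eq_0)

lemma funpow_matrix_add:
  fixes P :: "complex ^ 's ^ 's::finite"
  shows "((*v) P ^^ i) (v + w) = ((*v) P ^^ i) v + ((*v) P ^^ i) w"
  by (induction i) (auto simp: matrix_vector_right_distrib)

lemma funpow_matrix_smult:
  fixes P :: "complex ^ 's ^ 's::finite"
  shows "((*v) P ^^ i) (c *s v) = c *s ((*v) P ^^ i) v"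
  by (induction i) (auto simp: vector_scalar_commute)

lemma poly_at_linear_factor:
  "poly_at P ([:k, 1:] * q) v = poly_at P q (P *v v + k *s v)" (is ?A)
  "poly_at P ([:k, 1:] * q) v = P *v poly_at P q v + k *s poly_at P q v" (is ?B)
proof -
  let ?n = "degree q"
  have "degree ([:k, 1:] * q) \<le> Suc ?n"
    using degree_mult_le[of "[:k, 1:]" q] by simp
  then have "poly_at P ([:k, 1:] * q) v
      = (\<Sum>i\<le>Suc ?n. (k * coeff q i + coeff (pCons 0 q) i) *s ((*v) P ^^ i) v)"
    by (simp add: poly_at_upto)
  also have "\<dots> = (\<Sum>i\<le>Suc ?n. k *s (coeff q i *s ((*v) P ^^ i) v))
      + (\<Sum>i\<le>Suc ?n. coeff (pCons 0 q) i *s ((*v) P ^^ i) v)"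
    by (simp only: vector_sadd_rdistrib sum.distrib vector_smult_assoc)
  also have "(\<Sum>i\<le>Suc ?n. k *s (coeff q i *s ((*v) P ^^ i) v))
      = (\<Sum>i\<le>?n. coeff q i *s ((*v) P ^^ i) (k *s v))"
  proof -
    have "k *s (coeff q i *s ((*v) P ^^ i) v) = coeff q i *s ((*v) P ^^ i) (k *s v)" for i
      unfolding funpow_matrix_smult by (simp add: vec_eq_iff)
    then show ?thesis by (simp add: coeff_eq_0)
  qed
  also have "(\<Sum>i\<le>Suc ?n. coeff (pCons 0 q) i *s ((*v) P ^^ i) v)
      = (\<Sum>i\<le>?n. coeff q i *s ((*v) P ^^ i) (P *v v))"
    by (simp add: sum.atMost_Suc_shift funpow_swap1 del: sum.atMost_Suc)
  finally have *: "poly_at P ([:k, 1:] * q) v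
      = (\<Sum>i\<le>?n. coeff q i *s ((*v) P ^^ i) (k *s v)) + (\<Sum>i\<le>?n. coeff q i *s ((*v) P ^^ i) (P *v v))" .
  show ?A unfolding * unfolding poly_at_def
    by (simp only: funpow_matrix_add vector_add_ldistrib sum.distrib add.commute)
  have "P *v poly_at P q v = (\<Sum>i\<le>?n. coeff q i *s ((*v) P ^^ i) (P *v v))"
  proof -
    have "P *v (\<Sum>i\<in>I. f i) = (\<Sum>i\<in>I. P *v f i)" if "finite I" for I :: "nat set" and f
      using that by (induction I rule: finite_induct) (auto simp: matrix_vector_right_distrib)
    then show ?thesis unfolding poly_at_def by (simp add: vector_scalar_commute funpow_swap1)
  qed
  moreover have "k *s poly_at P q v = (\<Sum>i\<le>?n. coeff q i *s ((*v) P ^^ i) (k *s v))"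
    unfolding poly_at_def
    by (simp add: vec_eq_iff sum_distrib_left funpow_matrix_smult mult_ac)
  ultimately show ?B unfolding * by (simp add: add.commute)
qed

lemma norm_smult_vec: "norm (l *s v) = norm l * norm (v :: complex ^ 's::finite)"
  by (simp add: norm_vec_def norm_mult L2_set_right_distrib)

text \<open>
  With \<open>w = P v - l v\<close> one has \<open>P\<^bsup>n+1\<^esup> v = l P\<^sup>n v + P\<^sup>n w\<close>. A recursion with \<open>|l| < 1\<close> and a
  geometrically decaying perturbation has geometrically decaying solutions, at any rate above both.
\<close>
lemma decaying_if_residual_decaying:
  fixes P :: "complex ^ 's ^ 's::finite"
  assumes "norm l < 1" and "decaying P (P *v v + (- l) *s v)"
  shows "decaying P v"
proof -
  obtain C r where r: "0 \<le> r" "r < 1"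
    and C: "\<And>n. norm (((*v) P ^^ n) (P *v v + (- l) *s v)) \<le> C * r ^ n"
    using assms(2) unfolding decaying_def by blast
  \<comment> \<open>Any rate strictly above both \<open>r\<close> and \<open>|l|\<close> avoids the resonance \<open>r = |l|\<close>.\<close>
  obtain t where t: "max r (norm l) < t" "t < 1" using r assms(1) dense[of "max r (norm l)" 1] by auto
  have C0: "0 \<le> C" using order_trans[OF norm_ge_zero C[of 0]] by simp
  define K where "K = max (norm v) (C / (t - norm l))"
  have "norm (((*v) P ^^ n) v) \<le> K * t ^ n" for n
  proof (induction n)
    case 0
    show ?case by (simp add: K_def)
  next
    case (Suc n)
    have "((*v) P ^^ Suc n) v = ((*v) P ^^ n) (P *v v + (- l) *s v) + l *s ((*v) P ^^ n) v"
      unfolding funpow_matrix_add funpow_matrix_smult by (simp add: funpow_swap1 vec_eq_iff)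
    then have "norm (((*v) P ^^ Suc n) v) \<le> C * r ^ n + norm l * (K * t ^ n)"
      using norm_triangle_ineq[of "((*v) P ^^ n) (P *v v + (- l) *s v)" "l *s ((*v) P ^^ n) v"] C[of n]
        mult_left_mono[OF Suc, of "norm l"]
      by (simp add: norm_smult_vec)
    also have "\<dots> \<le> C * t ^ n + norm l * (K * t ^ n)"
      using C0 r t by (intro add_right_mono mult_left_mono power_mono) auto
    also have "\<dots> = (C + norm l * K) * t ^ n" by (simp add: algebra_simps)
    also have "\<dots> \<le> (K * t) * t ^ n"
    proof (rule mult_right_mono)
      have "C / (t - norm l) \<le> K" by (simp add: K_def)
      then have "C \<le> K * (t - norm l)" using t by (simp add: field_simps)
      then show "C + norm l * K \<le> K * t" by (simp add: algebra_simps)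
      show "0 \<le> t ^ n" using t r by auto
    qed
    finally show ?case by (simp add: mult_ac)
  qed
  then show ?thesis unfolding decaying_def using t r by (intro exI[of _ K] exI[of _ t]) auto
qed

text \<open>
  The factor of the annihilating polynomial that belongs to a root \<open>l\<close> is removed in one of two ways.
  If \<open>|l| < 1\<close> it is moved to the vector, by the preceding lemma; otherwise \<open>l\<close> is not an eigenvalue,
  so that \<open>P - l\<close> is injective and the factor can be cancelled. This replaces the Jordan normal form.
\<close>
lemma decaying_if_annihilated:
  fixes P :: "complex ^ 's ^ 's::finite"
  assumes eig: "\<And>l v. v \<noteq> 0 \<Longrightarrow> P *v v = l *s v \<Longrightarrow> norm l < 1"
  shows "p \<noteq> 0 \<Longrightarrow> poly_at P p v = 0 \<Longrightarrow> decaying P v"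
proof (induction "degree p" arbitrary: p v)
  case 0
  then have "degree p = 0" by simp
  then obtain c where c: "p = [:c:]" by (rule degree_eq_zeroE)
  have "c \<noteq> 0" using 0(2) c by simp
  moreover have "c *s v = 0" using 0(3) unfolding c poly_at_def by simp
  ultimately have "v = 0" by (simp add: vec_eq_iff)
  have "((*v) P ^^ n) 0 = 0" for n by (induction n) auto
  with \<open>v = 0\<close> show ?case unfolding decaying_def by (intro exI[of _ 0]) auto
next
  case (Suc d)
  then have "\<not> constant (poly p)" by (simp add: constant_degree)
  then obtain l where "poly p l = 0" using fundamental_theorem_of_algebra by blast
  then obtain q where p: "p = [:- l, 1:] * q" by (auto simp: poly_eq_0_iff_dvd elim: dvdE)
  with Suc.prems have q: "q \<noteq> 0" by auto
  have d: "d = degree q" using Suc.hyps(2) q unfolding p by (subst (asm) degree_mult_eq) auto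
  show ?case
  proof (cases "norm l < 1")
    case True
    show ?thesis
      by (rule decaying_if_residual_decaying[OF True], rule Suc.hyps(1)[OF d q])
         (use Suc.prems(2) in \<open>simp only: p poly_at_linear_factor(1)\<close>)
  next
    case False
    have "P *v poly_at P q v = l *s poly_at P q v"
      using Suc.prems(2) unfolding p poly_at_linear_factor(2) by (simp add: vector_smult_lneg)
    with eig False have "poly_at P q v = 0" by blast
    then show ?thesis by (rule Suc.hyps(1)[OF d q])
  qed
qed

lemma of_real_scale: "complex_of_real a *s w = a *\<^sub>R w"
  by (simp add: vec_eq_iff scaleR_conv_of_real[where 'a = complex])

text \<open>
  The vectors \<open>v, P v, P\<^sup>2 v, \<dots>\<close> are linearly dependent, which provides an annihilating polynomial.
\<close>
lemma decaying_if_eigenvalues_small: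
  fixes P :: "complex ^ 's ^ 's::finite"
  assumes eig: "\<And>l v. v \<noteq> 0 \<Longrightarrow> P *v v = l *s v \<Longrightarrow> norm l < 1"
  shows "decaying P v"
proof -
  let ?w = "\<lambda>i. ((*v) P ^^ i) v"
  let ?n = "Suc DIM(complex ^ 's)"
  have "\<exists>p. p \<noteq> 0 \<and> poly_at P p v = 0"
  proof (cases "inj_on ?w {..<?n}")
    case False
    then obtain i j where ij: "i < j" "?w i = ?w j"
      by (auto simp: inj_on_def) (metis linorder_neqE_nat)
    let ?p = "monom 1 j - monom (1::complex) i"
    have "coeff ?p j = 1" using ij by simp
    then have "?p \<noteq> 0" by force
    have "degree ?p \<le> j" using ij by (intro degree_diff_le) (auto simp: degree_monom_eq)
    then have "poly_at P ?p v = (\<Sum>k\<le>j. (if k = j then ?w k else 0) - (if k = i then ?w k else 0))"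
      by (auto simp: poly_at_upto coeff_diff intro!: sum.cong)
    also have "\<dots> = ?w j - ?w i"
      using ij by (simp add: sum_subtractf)
    finally have "poly_at P ?p v = 0" using ij by simp
    with \<open>?p \<noteq> 0\<close> show ?thesis by blast
  next
    case True
    then have "card (?w ` {..<?n}) = ?n" by (simp add: card_image)
    then have "dependent (?w ` {..<?n})" by (intro dependent_biggerset) auto
    then obtain u where u: "\<exists>x\<in>?w ` {..<?n}. u x \<noteq> 0" "(\<Sum>x\<in>?w ` {..<?n}. u x *\<^sub>R x) = 0"
      by (auto simp: dependent_finite)
    define p where "p = (\<Sum>i<?n. monom (complex_of_real (u (?w i))) i)"
    have coeff: "coeff p i = (if i < ?n then complex_of_real (u (?w i)) else 0)" for i
      by (simp add: p_def coeff_sum)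
    have "p \<noteq> 0" using u(1) coeff by (auto simp: poly_eq_iff)
    have "degree p \<le> ?n" by (rule degree_le) (simp add: coeff)
    then have "poly_at P p v = (\<Sum>i\<le>?n. coeff p i *s ?w i)" by (rule poly_at_upto)
    also have "\<dots> = (\<Sum>i<?n. u (?w i) *\<^sub>R ?w i)"
      unfolding lessThan_Suc_atMost[symmetric]
      by (simp add: coeff of_real_scale)
    also have "\<dots> = 0" using u(2) True by (simp add: sum.reindex)
    finally show ?thesis using \<open>p \<noteq> 0\<close> by blast
  qed
  then obtain p where p: "p \<noteq> 0" "poly_at P p v = 0" by blast
  show ?thesis by (rule decaying_if_annihilated[OF _ p]) (rule eig)
qed

definition complexify :: "real ^ 's \<Rightarrow> complex ^ 's::finite" where
  "complexify x = (\<chi> i. of_real (x $ i))"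

lemma norm_complexify: "norm (complexify x) = norm x"
  by (simp add: complexify_def norm_vec_def)

lemma complexify_mult: "map_matrix of_int M *v complexify x = complexify (real_mat M *v x)"
  unfolding vec_eq_iff
proof
  fix i
  show "(map_matrix of_int M *v complexify x) $ i = complexify (real_mat M *v x) $ i"
    unfolding complexify_def matrix_vector_mult_def real_mat_def map_matrix_def
    by (simp only: vec_lambda_beta of_real_sum of_real_mult of_real_of_int_eq)
qed

lemma inj_complexify:
  assumes "complexify x = 0"
  shows "x = 0"
proof -
  have "norm x = 0" unfolding norm_complexify[symmetric] assms by simp
  then show ?thesis by simp
qed

lemma invertible_if_no_kernel:
  fixes A :: "'a::field ^ 's ^ 's::finite"
  assumes "\<And>x. A *v x = 0 \<Longrightarrow> x = 0"
  shows "invertible A"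
proof -
  have "\<exists>B. B ** A = mat 1" unfolding matrix_left_invertible_ker using assms by blast
  then show ?thesis by (simp add: invertible_left_inverse)
qed

lemma expansive_invertible:
  assumes "expansive M"
  shows "invertible (real_mat M)" "invertible (map_matrix of_int M :: complex ^ 's ^ 's::finite)"
proof -
  have ker: "map_matrix of_int M *v x = 0 \<Longrightarrow> x = 0" for x :: "complex ^ 's"
    using assms[unfolded expansive_def, rule_format, where l = 0 and v = x] by auto
  show "invertible (map_matrix of_int M :: complex ^ 's ^ 's)"
    by (rule invertible_if_no_kernel) (rule ker)
  show "invertible (real_mat M)"
  proof (rule invertible_if_no_kernel)
    fix x assume "real_mat M *v x = 0"
    then have "map_matrix of_int M *v complexify x = complexify 0" by (simp only: complexify_mult)
    also have "complexify 0 = 0" unfolding complexify_def by (simp add: vec_eq_iff)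
    finally have "complexify x = 0" by (rule ker)
    then show "x = 0" by (rule inj_complexify)
  qed
qed

lemma matrix_inv_cancel:
  fixes A :: "'a::field ^ 's ^ 's::finite"
  assumes "invertible A"
  shows "matrix_inv A *v (A *v x) = x" "A *v (matrix_inv A *v x) = x"
proof -
  have "A ** matrix_inv A = mat 1 \<and> matrix_inv A ** A = mat 1"
    using assms unfolding invertible_def matrix_inv_def by (rule someI_ex)
  then show "matrix_inv A *v (A *v x) = x" "A *v (matrix_inv A *v x) = x"
    by (simp_all add: matrix_vector_mul_assoc)
qed

lemma funpow_matrix_linear: "linear (((*v) (A :: real ^ 's ^ 's::finite)) ^^ n)"
proof (induction n)
  case (Suc n)
  have "((*v) A ^^ Suc n) = (*v) A \<circ> ((*v) A ^^ n)" by simp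
  then show ?case using Suc linear_compose by (metis matrix_vector_mul_linear)
qed (simp add: linear_id[unfolded id_def] id_def)

text \<open>
  The eigenvalues of the inverse are smaller than 1 in absolute value, so all its orbits decay. The
  finitely many orbits of the unit vectors give uniform constants.
\<close>
theorem expansive_inverse_powers:
  fixes M :: "int ^ 's ^ 's::finite"
  assumes "expansive M"
  shows "\<exists>C r. 0 < C \<and> 0 < r \<and> r < 1 \<and>
    (\<forall>n x. norm (((*v) (matrix_inv (real_mat M)) ^^ n) x) \<le> C * r ^ n * norm x)"
proof -
  let ?N = "map_matrix of_int M :: complex ^ 's ^ 's"
  let ?P = "matrix_inv ?N" and ?A = "matrix_inv (real_mat M)"
  note inv = expansive_invertible[OF assms]
  have eig: "norm l < 1" if "v \<noteq> 0" "?P *v v = l *s v" for l v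
  proof -
    have v: "v = l *s (?N *v v)"
      using arg_cong[OF that(2), of "(*v) ?N"] inv(2) by (simp add: matrix_inv_cancel vector_scalar_commute)
    then have "l \<noteq> 0" using that(1) by auto
    then have "?N *v v = (1 / l) *s v"
      by (subst v) (simp add: vector_smult_assoc)
    then have "1 < norm (1 / l)"
      using assms that(1) unfolding expansive_def by blast
    then show ?thesis using \<open>l \<noteq> 0\<close> by (simp add: norm_divide)
  qed
  have step: "?P *v complexify x = complexify (?A *v x)" for x
    using arg_cong[OF complexify_mult[of M "?A *v x"], of "(*v) ?P"] inv by (simp add: matrix_inv_cancel)
  have "complexify (((*v) ?A ^^ n) x) = ((*v) ?P ^^ n) (complexify x)" for n x
    by (induction n) (simp_all flip: step)
  moreover have "decaying ?P (complexify x)" for x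
    by (rule decaying_if_eigenvalues_small) (rule eig)
  ultimately have "decaying ?A x" for x
    unfolding decaying_def by (metis norm_complexify)
  then have "\<exists>C r. 0 \<le> r \<and> r < 1 \<and> (\<forall>n. norm (((*v) ?A ^^ n) (axis i 1)) \<le> C * r ^ n)" for i
    unfolding decaying_def by blast
  then obtain C r where r: "\<And>i. 0 \<le> r i" "\<And>i. r i < 1"
    and C: "\<And>i n. norm (((*v) ?A ^^ n) (axis i 1)) \<le> C i * r i ^ n"
    by metis
  define t where "t = max (1/2) (Max (range r))"
  have t: "0 < t" "t < 1" "r i \<le> t" for i
    using r(2) by (auto simp: t_def le_max_iff_disj)
  have C0: "0 \<le> C i" for i using order_trans[OF norm_ge_zero C[of 0 i]] by simp
  define K where "K = (\<Sum>i\<in>UNIV. C i) + 1"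
  have "norm (((*v) ?A ^^ n) x) \<le> K * t ^ n * norm x" for n x
  proof -
    have "((*v) ?A ^^ n) x = ((*v) ?A ^^ n) (\<Sum>i\<in>UNIV. x $ i *\<^sub>R axis i 1)"
      using basis_expansion[of x] by (simp add: scalar_mult_eq_scaleR)
    also have "\<dots> = (\<Sum>i\<in>UNIV. x $ i *\<^sub>R ((*v) ?A ^^ n) (axis i 1))"
      using funpow_matrix_linear[of n ?A] by (simp add: linear_sum linear_scale)
    finally have "norm (((*v) ?A ^^ n) x) \<le> (\<Sum>i\<in>UNIV. norm (x $ i *\<^sub>R ((*v) ?A ^^ n) (axis i 1)))"
      by (metis norm_sum)
    also have "\<dots> \<le> (\<Sum>i\<in>UNIV. norm x * (C i * t ^ n))"
    proof (rule sum_mono)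
      fix i
      have "norm (((*v) ?A ^^ n) (axis i 1)) \<le> C i * t ^ n"
        using C[of n i] mult_left_mono[OF power_mono[OF t(3)[of i] r(1)[of i]] C0[of i], of n] by linarith
      then show "norm (x $ i *\<^sub>R ((*v) ?A ^^ n) (axis i 1)) \<le> norm x * (C i * t ^ n)"
        using component_le_norm_cart[of x i] unfolding norm_scaleR real_norm_def
        by (intro mult_mono) auto
    qed
    also have "\<dots> = (\<Sum>i\<in>UNIV. C i) * t ^ n * norm x"
      by (simp add: sum_distrib_left sum_distrib_right mult_ac)
    also have "\<dots> \<le> K * t ^ n * norm x"
      using t unfolding K_def by (intro mult_right_mono) auto
    finally show ?thesis .
  qed
  moreover have "0 < K" unfolding K_def using C0 by (simp add: sum_nonneg add_nonneg_pos)
  ultimately show ?thesis using t by blast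
qed

section \<open>Digit expansions\<close>

text \<open>
  The inverse branches of the expanding map given by \<open>M\<close>. The tile \<open>G\<close> and the set \<open>K\<close> are the attractors
  of the branches with digits in \<open>D\<close> and in the support of the mask.
\<close>
definition branch :: "int ^ 's ^ 's \<Rightarrow> int ^ 's \<Rightarrow> real ^ 's \<Rightarrow> real ^ 's::finite" where
  "branch M k y = matrix_inv (real_mat M) *v (y + real_vec k)"

lemma real_vec_simps:
  "real_vec (k + l) = real_vec k + real_vec l" "real_vec (k - l) = real_vec k - real_vec l"
  "real_vec 0 = 0"
  by (simp_all add: real_vec_def vec_eq_iff)

lemma real_vec_mult: "real_vec (M *v k) = real_mat M *v real_vec k"
  by (simp add: real_vec_def real_mat_def map_matrix_def vec_eq_iff matrix_vector_mult_def)

lemma inj_real_vec: "inj real_vec"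
  by (auto simp: inj_def real_vec_def vec_eq_iff)

lemma range_real_vec: "range real_vec = {x. \<forall>i. x $ i \<in> \<int>}"
proof (intro equalityI subsetI)
  fix x :: "real ^ 'a" assume "x \<in> {x. \<forall>i. x $ i \<in> \<int>}"
  then have "x = real_vec (\<chi> i. \<lfloor>x $ i\<rfloor>)" by (auto simp: real_vec_def vec_eq_iff elim: Ints_cases)
  then show "x \<in> range real_vec" by blast
qed (auto simp: real_vec_def)

lemma closed_range_real_vec: "closed (range (real_vec :: int ^ 's::finite \<Rightarrow> real ^ 's))"
proof -
  have "closed ((\<lambda>x :: real ^ 's. x $ i) -` \<int>)" for i
    by (intro closed_vimage closed_Ints continuous_intros)
  then have "closed (\<Inter>i. (\<lambda>x :: real ^ 's. x $ i) -` \<int>)" by blast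
  moreover have "(\<Inter>i. (\<lambda>x :: real ^ 's. x $ i) -` \<int>) = range real_vec"
    unfolding range_real_vec by auto
  ultimately show ?thesis by simp
qed

locale expansive_matrix =
  fixes M :: "int ^ 's::finite ^ 's"
  assumes expansive: "expansive M"
begin

abbreviation "A \<equiv> matrix_inv (real_mat M)"
abbreviation "apow n \<equiv> ((*v) A) ^^ n"

lemma A_cancel [simp]: "A *v (real_mat M *v x) = x" "real_mat M *v (A *v x) = x"
  using expansive_invertible[OF expansive] by (simp_all add: matrix_inv_cancel)

lemma apow_bound_ex: "\<exists>C r. 0 < C \<and> 0 < r \<and> r < 1 \<and> (\<forall>n x. norm (apow n x) \<le> C * r ^ n * norm x)"
  by (rule expansive_inverse_powers[OF expansive])

definition "C\<^sub>M = fst (SOME (C, r). 0 < C \<and> 0 < r \<and> r < 1 \<and> (\<forall>n x. norm (apow n x) \<le> C * r ^ n * norm x))"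
definition "r\<^sub>M = snd (SOME (C, r). 0 < C \<and> 0 < r \<and> r < 1 \<and> (\<forall>n x. norm (apow n x) \<le> C * r ^ n * norm x))"

lemma contraction: "0 < C\<^sub>M" "0 < r\<^sub>M" "r\<^sub>M < 1" "norm (apow n x) \<le> C\<^sub>M * r\<^sub>M ^ n * norm x"
proof -
  let ?P = "\<lambda>(C, r). 0 < C \<and> 0 < r \<and> r < 1 \<and> (\<forall>n x. norm (apow n x) \<le> C * r ^ n * norm x)"
  have "?P (SOME x. ?P x)" by (rule someI_ex) (use apow_bound_ex in auto)
  then show "0 < C\<^sub>M" "0 < r\<^sub>M" "r\<^sub>M < 1" "norm (apow n x) \<le> C\<^sub>M * r\<^sub>M ^ n * norm x"
    unfolding C\<^sub>M_def r\<^sub>M_def by (auto simp: case_prod_unfold)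
qed

lemma apow_bound:
  assumes "norm x \<le> B"
  shows "norm (apow n x) \<le> C\<^sub>M * r\<^sub>M ^ n * B"
proof -
  have "0 \<le> C\<^sub>M * r\<^sub>M ^ n" using contraction(1,2) by simp
  from order_trans[OF contraction(4) mult_left_mono[OF assms this]] show ?thesis .
qed

lemma apow_linear: "linear (apow n)"
  by (rule funpow_matrix_linear)

lemma apow_tendsto_0:
  assumes "\<And>n. norm (x n) \<le> B"
  shows "(\<lambda>n. apow n (x n)) \<longlonglongrightarrow> 0"
proof (rule Lim_null_comparison)
  have "norm (apow n (x n)) \<le> C\<^sub>M * r\<^sub>M ^ n * B" for n
    by (rule apow_bound[OF assms])
  then show "\<forall>\<^sub>F n in sequentially. norm (apow n (x n)) \<le> C\<^sub>M * r\<^sub>M ^ n * B" by simp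
  have "(\<lambda>n. C\<^sub>M * r\<^sub>M ^ n * B) \<longlonglongrightarrow> C\<^sub>M * 0 * B"
    using contraction by (intro tendsto_intros LIMSEQ_realpow_zero) auto
  then show "(\<lambda>n. C\<^sub>M * r\<^sub>M ^ n * B) \<longlonglongrightarrow> 0" by simp
qed

lemma branch_eq_iff: "branch M k y = x \<longleftrightarrow> y = real_mat M *v x - real_vec k"
  unfolding branch_def by (metis A_cancel add_diff_cancel diff_add_cancel)

lemma branch_inverse: "branch M k (real_mat M *v x - real_vec k) = x"
  by (simp add: branch_eq_iff)

lemma branch_add_lattice: "branch M k y + real_vec l = branch M (k + M *v l) y"
  by (simp add: branch_def real_vec_simps real_vec_mult matrix_vector_right_distrib add_ac)

lemma branch_affine: "branch M k y = A *v y + A *v real_vec k"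
  by (simp add: branch_def matrix_vector_right_distrib)

lemma continuous_on_branch: "continuous_on S (branch M k)"
  unfolding branch_def
  by (rule continuous_on_compose2[OF matrix_vector_mult_linear_continuous_on[of UNIV A]])
     (auto intro!: continuous_intros)

lemma summable_digits:
  assumes "\<And>j. norm (g j) \<le> B"
  shows "summable (\<lambda>j. apow (Suc j) (g j))"
proof (rule summable_comparison_test')
  show "summable (\<lambda>j. C\<^sub>M * r\<^sub>M ^ Suc j * B)"
    using contraction by (intro summable_mult2 summable_mult) (simp add: summable_Suc_iff)
  show "norm (apow (Suc j) (g j)) \<le> C\<^sub>M * r\<^sub>M ^ Suc j * B" for j
    by (rule apow_bound[OF assms])
qed

lemma finite_digit_bound:
  assumes "finite \<Gamma>"
  obtains B where "0 \<le> B" "\<And>k. k \<in> \<Gamma> \<Longrightarrow> norm (real_vec k) \<le> B"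
proof
  show "0 \<le> (\<Sum>k\<in>\<Gamma>. norm (real_vec k))" by (intro sum_nonneg) auto
  show "norm (real_vec k) \<le> (\<Sum>k\<in>\<Gamma>. norm (real_vec k))" if "k \<in> \<Gamma>" for k
    using assms that by (intro member_le_sum) auto
qed

abbreviation "expansions \<equiv> digit_expansions M"

lemma expansionsI:
  assumes "\<And>j. \<gamma> j \<in> \<Gamma>" "(\<lambda>j. apow (Suc j) (real_vec (\<gamma> j))) sums x"
  shows "x \<in> expansions \<Gamma>"
  unfolding digit_expansions_def mem_Collect_eq using assms by (intro exI[of _ \<gamma>]) auto

text \<open>
  A bounded set from whose points one can always continue by \<open>x \<mapsto> M x - k\<close> without leaving the set
  consists of digit expansions: the orbit determines the digits, and the remainder \<open>A\<^sup>n y\<^sub>n\<close> tends to 0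
  because the orbit stays bounded. This yields both the closedness of the attractors and the location
  of the supports of solutions of the refinement equation.
\<close>
lemma expansionsI_backward_invariant:
  assumes "bounded S" and step: "\<And>x. x \<in> S \<Longrightarrow> \<exists>k\<in>\<Gamma>. real_mat M *v x - real_vec k \<in> S"
  shows "S \<subseteq> expansions \<Gamma>"
proof
  fix x assume x: "x \<in> S"
  obtain k where k: "\<And>x. x \<in> S \<Longrightarrow> k x \<in> \<Gamma>" "\<And>x. x \<in> S \<Longrightarrow> real_mat M *v x - real_vec (k x) \<in> S"
    using step by metis
  define y where "y n = ((\<lambda>x. real_mat M *v x - real_vec (k x)) ^^ n) x" for n
  define \<gamma> where "\<gamma> n = k (y n)" for n
  have yS: "y n \<in> S" for n by (induction n) (auto simp: y_def x k)
  have y: "y n = A *v (y (Suc n) + real_vec (\<gamma> n))" for n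
    by (simp add: y_def \<gamma>_def)
  have partial: "x = (\<Sum>j<n. apow (Suc j) (real_vec (\<gamma> j))) + apow n (y n)" for n
  proof (induction n)
    case 0 show ?case by (simp add: y_def)
  next
    case (Suc n)
    have "apow n (y n) = apow (Suc n) (y (Suc n) + real_vec (\<gamma> n))"
      by (subst y) (simp add: funpow_swap1)
    also have "\<dots> = apow (Suc n) (y (Suc n)) + apow (Suc n) (real_vec (\<gamma> n))"
      by (rule linear_add[OF apow_linear])
    finally show ?case using Suc by simp
  qed
  obtain B where B: "\<And>x. x \<in> S \<Longrightarrow> norm x \<le> B" using \<open>bounded S\<close> unfolding bounded_iff by blast
  have "(\<lambda>n. apow n (y n)) \<longlonglongrightarrow> 0" by (rule apow_tendsto_0) (rule B[OF yS])
  then have "(\<lambda>n. x - apow n (y n)) \<longlonglongrightarrow> x - 0" by (intro tendsto_intros)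
  moreover have "(\<Sum>j<n. apow (Suc j) (real_vec (\<gamma> j))) = x - apow n (y n)" for n
    using partial[of n] by (simp add: algebra_simps)
  ultimately have "(\<lambda>j. apow (Suc j) (real_vec (\<gamma> j))) sums x" by (simp add: sums_def)
  moreover have "\<gamma> j \<in> \<Gamma>" for j using k(1)[OF yS] by (simp add: \<gamma>_def)
  ultimately show "x \<in> expansions \<Gamma>" by (rule expansionsI[rotated])
qed

lemma expansions_backward:
  assumes "x \<in> expansions \<Gamma>"
  shows "\<exists>k\<in>\<Gamma>. real_mat M *v x - real_vec k \<in> expansions \<Gamma>"
proof -
  obtain \<gamma> where g: "\<And>j. \<gamma> j \<in> \<Gamma>" and s: "(\<lambda>j. apow (Suc j) (real_vec (\<gamma> j))) sums x"
    using assms unfolding digit_expansions_def by blast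
  have "(\<lambda>j. apow (Suc (Suc j)) (real_vec (\<gamma> (Suc j)))) sums (x - A *v real_vec (\<gamma> 0))"
    using s by (subst sums_Suc_iff) simp
  then have "(\<lambda>j. real_mat M *v (apow (Suc (Suc j)) (real_vec (\<gamma> (Suc j))))) sums
      (real_mat M *v (x - A *v real_vec (\<gamma> 0)))"
    by (rule bounded_linear.sums[OF matrix_vector_mul_bounded_linear])
  then have "(\<lambda>j. apow (Suc j) (real_vec (\<gamma> (Suc j)))) sums (real_mat M *v x - real_vec (\<gamma> 0))"
    by (simp add: matrix_vector_mult_diff_distrib)
  then have "real_mat M *v x - real_vec (\<gamma> 0) \<in> expansions \<Gamma>"
    by (intro expansionsI[where \<gamma> = "\<lambda>j. \<gamma> (Suc j)"] g)
  with g show ?thesis by blast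
qed

lemma branch_expansions:
  assumes "y \<in> expansions \<Gamma>" "k \<in> \<Gamma>"
  shows "branch M k y \<in> expansions \<Gamma>"
proof -
  obtain \<gamma> where g: "\<And>j. \<gamma> j \<in> \<Gamma>" and s: "(\<lambda>j. apow (Suc j) (real_vec (\<gamma> j))) sums y"
    using assms unfolding digit_expansions_def by blast
  let ?\<gamma> = "case_nat k \<gamma>"
  have "(\<lambda>j. A *v (apow (Suc j) (real_vec (\<gamma> j)))) sums (A *v y)"
    by (rule bounded_linear.sums[OF matrix_vector_mul_bounded_linear s])
  then have "(\<lambda>j. apow (Suc (Suc j)) (real_vec (?\<gamma> (Suc j)))) sums (branch M k y - apow (Suc 0) (real_vec (?\<gamma> 0)))"
    by (simp add: branch_def matrix_vector_right_distrib)
  then have "(\<lambda>j. apow (Suc j) (real_vec (?\<gamma> j))) sums branch M k y"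
    by (subst (asm) sums_Suc_iff) (simp only: diff_add_cancel)
  moreover have "?\<gamma> j \<in> \<Gamma>" for j using g assms(2) by (cases j) auto
  ultimately show ?thesis by (rule expansionsI[rotated])
qed

lemma bounded_expansions:
  assumes "finite \<Gamma>"
  shows "bounded (expansions \<Gamma>)"
proof -
  obtain B where B: "0 \<le> B" "\<And>k. k \<in> \<Gamma> \<Longrightarrow> norm (real_vec k) \<le> B" using finite_digit_bound[OF assms] by blast
  have sm: "summable (\<lambda>j. C\<^sub>M * r\<^sub>M ^ Suc j * B)"
    using contraction by (intro summable_mult2 summable_mult) (simp add: summable_Suc_iff)
  have "norm x \<le> (\<Sum>j. C\<^sub>M * r\<^sub>M ^ Suc j * B)" if x: "x \<in> expansions \<Gamma>" for x
  proof -
    obtain \<gamma> where g: "\<And>j. \<gamma> j \<in> \<Gamma>" and s: "(\<lambda>j. apow (Suc j) (real_vec (\<gamma> j))) sums x"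
      using x unfolding digit_expansions_def by blast
    have "norm (apow (Suc j) (real_vec (\<gamma> j))) \<le> C\<^sub>M * r\<^sub>M ^ Suc j * B" for j
      by (rule apow_bound[OF B(2)[OF g]])
    then have "norm (\<Sum>j. apow (Suc j) (real_vec (\<gamma> j))) \<le> (\<Sum>j. C\<^sub>M * r\<^sub>M ^ Suc j * B)"
      by (intro norm_suminf_le sm)
    then show ?thesis by (simp only: sums_unique[OF s, symmetric])
  qed
  then show ?thesis unfolding bounded_iff by blast
qed

lemma expansions_nonempty:
  assumes "\<Gamma> \<noteq> {}"
  shows "expansions \<Gamma> \<noteq> {}"
proof -
  obtain k where "k \<in> \<Gamma>" using assms by blast
  moreover have "(\<lambda>j. apow (Suc j) (real_vec k)) sums (\<Sum>j. apow (Suc j) (real_vec k))"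
    by (rule summable_sums[OF summable_digits[of _ "norm (real_vec k)"]]) simp
  ultimately have "(\<Sum>j. apow (Suc j) (real_vec k)) \<in> expansions \<Gamma>"
    by (intro expansionsI[where \<gamma> = "\<lambda>_. k"])
  then show ?thesis by blast
qed

text \<open>
  The closure of the set of expansions is bounded and still covered by the images under the finitely
  many branches. So it is backward invariant as well and consists of expansions.
\<close>
lemma compact_expansions:
  assumes "finite \<Gamma>"
  shows "compact (expansions \<Gamma>)"
proof -
  let ?K = "expansions \<Gamma>"
  have bd: "bounded ?K" by (rule bounded_expansions[OF assms])
  then have "compact (closure ?K)" by (simp add: compact_eq_bounded_closed bounded_closure)
  then have "closed (\<Union>k\<in>\<Gamma>. branch M k ` closure ?K)"
    using assms by (intro closed_UN ballI compact_imp_closed compact_continuous_image continuous_on_branch)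
  moreover have "?K \<subseteq> (\<Union>k\<in>\<Gamma>. branch M k ` closure ?K)"
  proof
    fix x assume "x \<in> ?K"
    then obtain k where "k \<in> \<Gamma>" "real_mat M *v x - real_vec k \<in> ?K" using expansions_backward by blast
    then show "x \<in> (\<Union>k\<in>\<Gamma>. branch M k ` closure ?K)"
      using branch_inverse[of k x] closure_subset by (metis UN_I image_eqI subsetD)
  qed
  ultimately have sub: "closure ?K \<subseteq> (\<Union>k\<in>\<Gamma>. branch M k ` closure ?K)"
    by (rule closure_minimal[rotated])
  have "closure ?K \<subseteq> ?K"
  proof (rule expansionsI_backward_invariant)
    show "bounded (closure ?K)" using bd by (rule bounded_closure)
    fix x assume "x \<in> closure ?K"
    then obtain k y where "k \<in> \<Gamma>" "y \<in> closure ?K" "branch M k y = x" using sub by blast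
    then show "\<exists>k\<in>\<Gamma>. real_mat M *v x - real_vec k \<in> closure ?K" by (auto simp: branch_eq_iff)
  qed
  then have "closed ?K" by (metis closure_subset_eq)
  with bd show ?thesis by (simp add: compact_eq_bounded_closed)
qed

text \<open>
  Expand the integer part \<open>k\<close> of \<open>M\<^sup>n x\<close> in \<open>n\<close> digits. Up to an error that tends to 0, the point \<open>x\<close> is then
  \<open>A\<^sup>n k\<close>, hence a digit expansion plus a lattice point. The set of all such sums is closed.
\<close>
lemma expansions_cover:
  assumes "finite \<Gamma>" and residues: "\<And>k. \<exists>j\<in>\<Gamma>. \<exists>l. k - j = M *v l"
  shows "\<exists>l. x - real_vec l \<in> expansions \<Gamma>"
proof -
  let ?K = "expansions \<Gamma>"
  let ?S = "\<Union>x\<in>?K. \<Union>y\<in>range real_vec. {x + y}"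
  obtain q where q: "q \<in> ?K" using expansions_nonempty[of \<Gamma>] residues[of 0] by blast
  \<comment> \<open>\<open>n\<close> digits are split off from \<open>k\<close>, the expansion of \<open>q\<close> supplies the others, and a lattice point is left.\<close>
  have digits: "\<exists>l. apow n (real_vec k + q) - real_vec l \<in> ?K" if "q \<in> ?K" for n k q
    using that
  proof (induction n arbitrary: k q)
    case 0
    then show ?case by (intro exI[of _ k]) simp
  next
    case (Suc n)
    obtain j l where jl: "j \<in> \<Gamma>" "k = j + M *v l" using residues[of k] by (metis add.commute diff_add_cancel)
    have "A *v (real_vec k + q) = real_vec l + branch M j q"
      using branch_add_lattice[of j q l] by (simp add: jl(2) branch_def add_ac)
    then have "apow (Suc n) (real_vec k + q) = apow n (real_vec l + branch M j q)"
      by (simp add: funpow_swap1)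
    with Suc.IH[OF branch_expansions[OF Suc.prems jl(1)], of l] show ?case by simp
  qed
  have "closed ?S" by (intro compact_closed_sums compact_expansions closed_range_real_vec assms)
  define z where "z n = ((*v) (real_mat M) ^^ n) x" for n
  have Az: "apow n (z n) = x" for n
  proof (induction n)
    case (Suc n)
    have zs: "z (Suc n) = real_mat M *v z n" by (simp add: z_def)
    have "apow (Suc n) (z (Suc n)) = apow n (A *v (real_mat M *v z n))"
      by (simp only: funpow_Suc_right o_apply zs)
    then show ?case using Suc by simp
  qed (simp add: z_def)
  define k where "k n = (\<chi> i. \<lfloor>z n $ i\<rfloor>)" for n
  have "norm (z n - real_vec (k n)) \<le> real CARD('s)" for n
  proof -
    have "norm (z n - real_vec (k n)) \<le> (\<Sum>i\<in>UNIV. \<bar>(z n - real_vec (k n)) $ i\<bar>)"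
      by (rule norm_le_l1_cart)
    also have "\<dots> \<le> (\<Sum>i\<in>(UNIV :: 's set). 1)"
      by (intro sum_mono) (simp add: k_def real_vec_def, linarith)
    finally show ?thesis by simp
  qed
  then have "norm (z n - (real_vec (k n) + q)) \<le> real CARD('s) + norm q" for n
    using norm_triangle_ineq4[of "z n - real_vec (k n)" q] by (smt (verit, best) diff_diff_eq)
  then have "(\<lambda>n. apow n (z n - (real_vec (k n) + q))) \<longlonglongrightarrow> 0"
    by (rule apow_tendsto_0)
  moreover have "apow n (z n - (real_vec (k n) + q)) = x - apow n (real_vec (k n) + q)" for n
    using linear_diff[OF apow_linear] Az by metis
  ultimately have "(\<lambda>n. x - apow n (real_vec (k n) + q)) \<longlonglongrightarrow> 0" by simp
  then have "(\<lambda>n. x - (x - apow n (real_vec (k n) + q))) \<longlonglongrightarrow> x - 0" by (intro tendsto_intros)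
  then have lim: "(\<lambda>n. apow n (real_vec (k n) + q)) \<longlonglongrightarrow> x" by simp
  have "apow n (real_vec (k n) + q) \<in> ?S" for n
  proof -
    obtain l where "apow n (real_vec (k n) + q) - real_vec l \<in> ?K" using digits[OF q] by blast
    then show ?thesis by (intro UN_I[of "apow n (real_vec (k n) + q) - real_vec l"] UN_I[of "real_vec l"]) auto
  qed
  from closed_sequentially[OF \<open>closed ?S\<close> this lim] have "x \<in> ?S" .
  then obtain y l where "y \<in> ?K" "x = y + real_vec l" by blast
  then have "x - real_vec l \<in> ?K" by simp
  then show ?thesis ..
qed

end

section \<open>Words over a finite alphabet\<close>

definition words :: "'d set \<Rightarrow> nat \<Rightarrow> 'd list set" where
  "words D n = {ds. set ds \<subseteq> D \<and> length ds = n}"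

lemma words_0: "words D 0 = {[]}"
  by (auto simp: words_def)

lemma sum_words_Cons: "(\<Sum>ds\<in>words D (Suc n). f ds) = (\<Sum>d\<in>D. \<Sum>ds\<in>words D n. f (d # ds))"
proof -
  have "words D (Suc n) = (\<lambda>(d, ds). d # ds) ` (D \<times> words D n)"
    by (auto simp: words_def length_Suc_conv image_iff)
  then have "(\<Sum>ds\<in>words D (Suc n). f ds) = (\<Sum>(d, ds)\<in>D \<times> words D n. f (d # ds))"
    by (simp add: sum.reindex inj_on_def case_prod_unfold)
  then show ?thesis by (simp add: sum.cartesian_product)
qed

lemma sum_words_append:
  "(\<Sum>ds\<in>words D (n + k). f ds) = (\<Sum>ds\<in>words D n. \<Sum>es\<in>words D k. f (ds @ es))"
proof (induction n arbitrary: f)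
  case 0 then show ?case by (simp add: words_0)
next
  case (Suc n)
  then show ?case by (simp add: sum_words_Cons)
qed

lemma sum_words_snoc: "(\<Sum>ds\<in>words D (Suc n). f ds) = (\<Sum>ds\<in>words D n. \<Sum>d\<in>D. f (ds @ [d]))"
  using sum_words_append[of f D n 1] by (simp add: sum_words_Cons words_0)

section \<open>Affine substitutions and the tiling\<close>

lemma nn_integral_lborel_translate:
  fixes f :: "'a::euclidean_space \<Rightarrow> ennreal"
  assumes [measurable]: "f \<in> borel_measurable borel"
  shows "(\<integral>\<^sup>+x. f (x + c) \<partial>lborel) = (\<integral>\<^sup>+x. f x \<partial>lborel)"
proof -
  have "(\<integral>\<^sup>+x. f x \<partial>lborel) = (\<integral>\<^sup>+x. f x \<partial>distr lborel borel ((+) c))"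
    by (simp add: lborel_distr_plus)
  also have "\<dots> = (\<integral>\<^sup>+x. f (c + x) \<partial>lborel)" by (rule nn_integral_distr) auto
  finally show ?thesis by (simp add: add.commute)
qed

lemma one_inner_Basis: "b \<in> Basis \<Longrightarrow> ((\<chi> i. 1) :: real ^ 's::finite) \<bullet> b = 1"
  by (auto simp: Basis_vec_def inner_axis)

text \<open>
  Uniqueness of Haar measure: for the unit cube \<open>Q\<close>, the double integral of \<open>h (B x)\<close> times the indicator
  of \<open>y - B x \<in> Q\<close> is evaluated in both orders, using only translation invariance. The constant is left
  undetermined here; for \<open>M\<close> it is found from the tiling.
\<close>
lemma nn_integral_linear_substitution:
  fixes B :: "real ^ 's::finite ^ 's"
  assumes inv: "invertible B"
  shows "\<exists>k\<ge>0. \<forall>h\<in>borel_measurable borel. (\<integral>\<^sup>+x. h (B *v x) \<partial>lborel) = ennreal k * (\<integral>\<^sup>+x. h x \<partial>lborel)"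
proof -
  let ?Q = "cbox 0 (\<chi> i. 1) :: (real ^ 's) set"
  have Q: "(\<integral>\<^sup>+x. indicator ?Q x \<partial>lborel) = 1"
  proof -
    have "emeasure lborel ?Q = 1"
      by (subst emeasure_lborel_cbox) (auto simp: one_inner_Basis)
    then show ?thesis by simp
  qed
  have [measurable]: "(*v) B \<in> borel_measurable borel"
    by (intro borel_measurable_continuous_onI matrix_vector_mult_linear_continuous_on)
  define \<kappa> where "\<kappa> = (\<integral>\<^sup>+x. indicator ?Q (- (B *v x)) \<partial>lborel)"
  have "\<kappa> < \<infinity>"
  proof -
    have "- (B *v x) \<in> ?Q \<Longrightarrow> x \<in> (\<lambda>y. matrix_inv B *v (- y)) ` ?Q" for x
      by (rule image_eqI[of _ _ "- (B *v x)"]) (simp_all add: matrix_inv_cancel[OF inv])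
    then have "\<kappa> \<le> (\<integral>\<^sup>+x. indicator ((\<lambda>y. matrix_inv B *v (- y)) ` ?Q) x \<partial>lborel)"
      unfolding \<kappa>_def by (intro nn_integral_mono) (auto simp: indicator_def)
    also have "compact ((\<lambda>y. matrix_inv B *v (- y)) ` ?Q)"
      by (intro compact_continuous_image compact_cbox
          continuous_on_compose2[OF matrix_vector_mult_linear_continuous_on[of UNIV]] continuous_intros) auto
    then have "emeasure lborel ((\<lambda>y. matrix_inv B *v (- y)) ` ?Q) < \<infinity>"
      "(\<lambda>y. matrix_inv B *v (- y)) ` ?Q \<in> sets borel"
      by (rule emeasure_bounded_finite[OF compact_imp_bounded], rule borel_compact)
    then have "(\<integral>\<^sup>+x. indicator ((\<lambda>y. matrix_inv B *v (- y)) ` ?Q) x \<partial>lborel) < \<infinity>"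
      by simp
    finally show ?thesis .
  qed
  moreover have "(\<integral>\<^sup>+x. h (B *v x) \<partial>lborel) = \<kappa> * (\<integral>\<^sup>+x. h x \<partial>lborel)"
    if [measurable]: "h \<in> borel_measurable borel" for h
  proof -
    have "(\<integral>\<^sup>+x. h (B *v x) \<partial>lborel) = (\<integral>\<^sup>+x. h (B *v x) * (\<integral>\<^sup>+y. indicator ?Q y \<partial>lborel) \<partial>lborel)"
      by (simp only: Q mult_1_right)
    also have "\<dots> = (\<integral>\<^sup>+x. h (B *v x) * (\<integral>\<^sup>+y. indicator ?Q (y + - (B *v x)) \<partial>lborel) \<partial>lborel)"
      by (subst nn_integral_lborel_translate) auto
    also have "\<dots> = (\<integral>\<^sup>+x. (\<integral>\<^sup>+y. h (B *v x) * indicator ?Q (y + - (B *v x)) \<partial>lborel) \<partial>lborel)"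
      by (subst nn_integral_cmult) auto
    also have "\<dots> = (\<integral>\<^sup>+y. (\<integral>\<^sup>+x. h (B *v x) * indicator ?Q (y + - (B *v x)) \<partial>lborel) \<partial>lborel)"
      by (intro lborel_pair.Fubini') measurable
    also have "\<dots> = (\<integral>\<^sup>+y. (\<integral>\<^sup>+x. h (B *v (x + matrix_inv B *v y)) * indicator ?Q (y + - (B *v (x + matrix_inv B *v y))) \<partial>lborel) \<partial>lborel)"
      by (subst nn_integral_lborel_translate[where f = "\<lambda>x. h (B *v x) * indicator ?Q (y + - (B *v x))" for y]) auto
    also have "\<dots> = (\<integral>\<^sup>+y. (\<integral>\<^sup>+x. h (y + B *v x) * indicator ?Q (- (B *v x)) \<partial>lborel) \<partial>lborel)"
      by (simp add: matrix_vector_right_distrib matrix_inv_cancel[OF inv] add.commute)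
    also have "\<dots> = (\<integral>\<^sup>+x. (\<integral>\<^sup>+y. h (y + B *v x) * indicator ?Q (- (B *v x)) \<partial>lborel) \<partial>lborel)"
      by (intro lborel_pair.Fubini') measurable
    also have "\<dots> = (\<integral>\<^sup>+x. (\<integral>\<^sup>+y. h (y + B *v x) \<partial>lborel) * indicator ?Q (- (B *v x)) \<partial>lborel)"
      by (subst nn_integral_multc) auto
    also have "\<dots> = (\<integral>\<^sup>+x. (\<integral>\<^sup>+y. h y \<partial>lborel) * indicator ?Q (- (B *v x)) \<partial>lborel)"
      by (subst nn_integral_lborel_translate) auto
    also have "\<dots> = (\<integral>\<^sup>+y. h y \<partial>lborel) * \<kappa>"
      unfolding \<kappa>_def by (subst nn_integral_cmult) auto
    finally show ?thesis by (simp add: mult.commute)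
  qed
  ultimately show ?thesis
    by (intro exI[of _ "enn2real \<kappa>"]) auto
qed

lemma distr_affine_lborel:
  fixes B :: "real ^ 's::finite ^ 's"
  assumes inv: "invertible B"
  shows "\<exists>k\<ge>0. \<forall>t. distr lborel borel (\<lambda>x. B *v x + t) = density lborel (\<lambda>_. ennreal k)"
proof -
  have [measurable]: "(*v) B \<in> borel_measurable borel"
    by (intro borel_measurable_continuous_onI matrix_vector_mult_linear_continuous_on)
  obtain k where k: "k \<ge> 0" "\<And>h. h \<in> borel_measurable borel \<Longrightarrow> (\<integral>\<^sup>+x. h (B *v x) \<partial>lborel) = ennreal k * (\<integral>\<^sup>+x. h x \<partial>lborel)"
    using nn_integral_linear_substitution[OF inv] by blast
  have "distr lborel borel (\<lambda>x. B *v x + t) = density lborel (\<lambda>_. ennreal k)" for t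
  proof (rule measure_eqI)
    fix X assume "X \<in> sets (distr lborel borel (\<lambda>x. B *v x + t))"
    then have X[measurable]: "X \<in> sets borel" by simp
    have "emeasure (distr lborel borel (\<lambda>x. B *v x + t)) X = (\<integral>\<^sup>+x. indicator X x \<partial>distr lborel borel (\<lambda>x. B *v x + t))"
      by simp
    also have "\<dots> = (\<integral>\<^sup>+x. indicator X (B *v x + t) \<partial>lborel)"
      by (rule nn_integral_distr) auto
    also have "\<dots> = ennreal k * (\<integral>\<^sup>+x. indicator X (x + t) \<partial>lborel)"
      by (rule k(2)) measurable
    also have "\<dots> = ennreal k * (\<integral>\<^sup>+x. indicator X x \<partial>lborel)"
      by (subst nn_integral_lborel_translate) auto
    also have "\<dots> = emeasure (density lborel (\<lambda>_. ennreal k)) X"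
      by (subst emeasure_density) (auto simp: nn_integral_cmult)
    finally show "emeasure (distr lborel borel (\<lambda>x. B *v x + t)) X = emeasure (density lborel (\<lambda>_. ennreal k)) X" .
  qed simp
  with k(1) show ?thesis by blast
qed

lemma nn_integral_scaled_lborel:
  "h \<in> borel_measurable borel \<Longrightarrow> (\<integral>\<^sup>+x. h x \<partial>density lborel (\<lambda>_. ennreal k)) = ennreal k * (\<integral>\<^sup>+x. h x \<partial>lborel)"
  by (subst nn_integral_density) (auto simp: nn_integral_cmult)

lemma AE_affine:
  fixes B :: "real ^ 's::finite ^ 's"
  assumes inv: "invertible B" and ae: "AE x in lborel. P x"
  shows "AE x in lborel. P (B *v x + t)"
proof -
  have [measurable]: "(*v) B \<in> borel_measurable borel"
    by (intro borel_measurable_continuous_onI matrix_vector_mult_linear_continuous_on)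
  obtain k where k: "distr lborel borel (\<lambda>x. B *v x + t) = density lborel (\<lambda>_. ennreal k)"
    using distr_affine_lborel[OF inv] by blast
  obtain N where N: "N \<in> null_sets lborel" "{x. \<not> P x} \<subseteq> N"
    using ae by (auto elim!: AE_E simp: null_sets_def)
  have "AE x in density lborel (\<lambda>_. ennreal k). x \<notin> N"
    using N AE_not_in[OF N(1)] by (subst AE_density) auto
  then have "AE x in lborel. B *v x + t \<notin> N"
    unfolding k[symmetric] using N by (subst (asm) AE_distr_iff) (auto simp: null_sets_def)
  then show ?thesis using N(2) by (auto elim!: eventually_mono)
qed

lemma AE_translate:
  fixes P :: "real ^ 's::finite \<Rightarrow> bool"
  shows "AE x in lborel. P x \<Longrightarrow> AE x in lborel. P (x + t)"
  using AE_affine[of "mat 1" P t] by (auto simp: invertible_def intro!: exI[of _ "mat 1"])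

lemma sum_if_ex1:
  fixes a :: "'a \<Rightarrow> 'b::comm_monoid_add"
  assumes "finite E" "\<exists>!d. d \<in> E \<and> P d"
  shows "(\<Sum>d\<in>E. if P d then b else 0) = b"
proof -
  obtain d where d: "d \<in> E" "P d" "\<And>e. e \<in> E \<Longrightarrow> P e \<Longrightarrow> e = d" using assms(2) by (elim ex1E) blast
  have "(\<Sum>d\<in>E. if P d then b else 0) = (\<Sum>e\<in>E. if e = d then b else 0)"
  proof (rule sum.cong[OF refl])
    fix e assume "e \<in> E"
    show "(if P e then b else 0) = (if e = d then b else 0)"
    proof (cases "e = d")
      case False
      then have "\<not> P e" using d(3) \<open>e \<in> E\<close> by blast
      then show ?thesis using False by simp
    qed (use d(2) in simp)
  qed
  also have "\<dots> = b" using assms(1) d(1) by simp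
  finally show ?thesis .
qed

lemma nn_integral_count_space_ex1:
  assumes "\<exists>!l. P l"
  shows "(\<integral>\<^sup>+l. (if P l then a else 0) \<partial>count_space UNIV) = (a :: ennreal)"
proof -
  obtain k where k: "P k" "\<forall>l. P l \<longrightarrow> l = k" using assms by (rule ex1E)
  have "(if P l then a else 0) = a * indicator {k} l" for l
  proof (cases "l = k")
    case True
    with k(1) show ?thesis by simp
  next
    case False
    then have "\<not> P l" using k(2) by blast
    then show ?thesis using False by simp
  qed
  then have "(\<integral>\<^sup>+l. (if P l then a else 0) \<partial>count_space UNIV) = (\<integral>\<^sup>+l. a * indicator {k} l \<partial>count_space UNIV)"
    by (intro nn_integral_cong)
  also have "\<dots> = a * 1" by (subst nn_integral_cmult) auto
  also have "\<dots> = a" by simp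
  finally show ?thesis .
qed

definition unit_cube :: "(real ^ 's::finite) set" where
  "unit_cube = {x. \<forall>i. 0 \<le> x $ i \<and> x $ i < 1}"

lemma unit_cube_sets [measurable]: "unit_cube \<in> sets borel"
  unfolding unit_cube_def by measurable

lemma emeasure_unit_cube: "emeasure lborel (unit_cube :: (real ^ 's::finite) set) = 1"
proof (rule antisym)
  have "emeasure lborel (unit_cube :: (real ^ 's) set) \<le> emeasure lborel (cbox 0 (\<chi> i. 1) :: (real ^ 's) set)"
    by (intro emeasure_mono) (auto simp: unit_cube_def mem_box_cart less_imp_le)
  also have "\<dots> = 1" by (subst emeasure_lborel_cbox) (auto simp: one_inner_Basis)
  finally show "emeasure lborel (unit_cube :: (real ^ 's) set) \<le> 1" .
  have "1 = emeasure lborel (box 0 (\<chi> i. 1) :: (real ^ 's) set)"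
    by (subst emeasure_lborel_box) (auto simp: one_inner_Basis)
  also have "\<dots> \<le> emeasure lborel (unit_cube :: (real ^ 's) set)"
    by (intro emeasure_mono) (auto simp: unit_cube_def mem_box_cart less_imp_le)
  finally show "1 \<le> emeasure lborel (unit_cube :: (real ^ 's) set)" .
qed

lemma unit_cube_tiles: "\<exists>!l. x + real_vec l \<in> unit_cube"
proof (rule ex1I[of _ "\<chi> i. - \<lfloor>x $ i\<rfloor>"])
  show "x + real_vec (\<chi> i. - \<lfloor>x $ i\<rfloor>) \<in> unit_cube"
    by (simp add: unit_cube_def real_vec_def) linarith
  fix l assume l: "x + real_vec l \<in> unit_cube"
  have "l $ i = - \<lfloor>x $ i\<rfloor>" for i
  proof -
    have "0 \<le> x $ i + of_int (l $ i)" "x $ i + of_int (l $ i) < 1"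
      using l by (auto simp: unit_cube_def real_vec_def)
    then have "\<lfloor>x $ i\<rfloor> = - (l $ i)" by (intro floor_unique) auto
    then show ?thesis by simp
  qed
  then show "l = (\<chi> i. - \<lfloor>x $ i\<rfloor>)" by (simp add: vec_eq_iff)
qed

locale lattice_tile = expansive_matrix M for M :: "int ^ 's::finite ^ 's" +
  fixes D :: "(int ^ 's) set"
  assumes residues: "complete_residues M D" and finite_D: "finite D"
    and tile: "emeasure lborel (digit_expansions M D) = 1"
begin

abbreviation "G \<equiv> digit_expansions M D"
abbreviation "m \<equiv> real (card D)"

lemma residueE: obtains d l where "d \<in> D" "k = d + M *v l"
  using residues unfolding complete_residues_def by (metis add.commute diff_add_cancel)

lemma D_nonempty: "D \<noteq> {}"
  using residueE[of 0] by blast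

lemma m_pos: "0 < m"
  using finite_D D_nonempty by (simp add: card_gt_0_iff)

lemma digit_unique: "d \<in> D \<Longrightarrow> d' \<in> D \<Longrightarrow> d' - d = M *v l \<Longrightarrow> d' = d"
proof -
  assume *: "d \<in> D" "d' \<in> D" "d' - d = M *v l"
  have "d' - d' = M *v 0" by simp
  with * residues[unfolded complete_residues_def, rule_format, of d'] show ?thesis by metis
qed

lemma compact_G: "compact G"
  by (rule compact_expansions[OF finite_D])

lemma G_sets [measurable]: "G \<in> sets borel"
  using compact_G borel_compact by blast

lemma G_cover: "\<exists>l. x - real_vec l \<in> G"
proof (rule expansions_cover[OF finite_D])
  show "\<exists>j\<in>D. \<exists>l. k - j = M *v l" for k using residueE[of k] by (metis add_diff_cancel_left')
qed

lemma borel_measurable_lattice_sum: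
  fixes f :: "real ^ 's \<Rightarrow> int ^ 's \<Rightarrow> ennreal"
  assumes "\<And>l. (\<lambda>x. f x l) \<in> borel_measurable borel"
  shows "(\<lambda>x. \<integral>\<^sup>+l. f x l \<partial>count_space UNIV) \<in> borel_measurable borel"
proof -
  interpret sigma_finite_measure "count_space (UNIV :: (int ^ 's) set)"
    by (rule sigma_finite_measure_count_space)
  have "(\<lambda>(l, x). f x l) \<in> borel_measurable (count_space UNIV \<Otimes>\<^sub>M borel)"
    by (rule measurable_pair_measure_countable1) (auto simp: assms)
  then have "(\<lambda>(x, l). f x l) \<in> borel_measurable (borel \<Otimes>\<^sub>M count_space UNIV)"
    by (subst (asm) measurable_pair_swap_iff) (simp add: case_prod_unfold)
  then show ?thesis by (rule borel_measurable_nn_integral)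
qed

text \<open>
  The number of translates of the tile that contain \<open>x\<close> is at least 1. Its integral over the unit cube is
  the measure of \<open>G\<close>, which is 1, so it equals 1 almost everywhere in the cube, and everywhere else by
  periodicity.
\<close>
lemma tiling: "AE x in lborel. \<exists>!l. x - real_vec l \<in> G"
proof -
  \<comment> \<open>\<open>?N x\<close> counts the translates of the tile that contain \<open>x\<close>.\<close>
  let ?N = "\<lambda>x. \<integral>\<^sup>+l. indicator G (x - real_vec l) \<partial>count_space UNIV"
  let ?Q = "indicator unit_cube :: real ^ 's \<Rightarrow> ennreal"
  have N[measurable]: "?N \<in> borel_measurable borel"
    by (rule borel_measurable_lattice_sum) measurable
  have N1: "1 \<le> ?N x" for x
  proof -
    obtain l where "x - real_vec l \<in> G" using G_cover by blast
    then have "(\<integral>\<^sup>+l'. indicator {l} l' \<partial>count_space UNIV) \<le> ?N x"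
      by (intro nn_integral_mono) (auto simp: indicator_def)
    then show ?thesis by simp
  qed
  have "(\<integral>\<^sup>+x. ?Q x * ?N x \<partial>lborel) = (\<integral>\<^sup>+x. (\<integral>\<^sup>+l. ?Q x * indicator G (x - real_vec l) \<partial>count_space UNIV) \<partial>lborel)"
    by (subst nn_integral_cmult) auto
  also have "\<dots> = (\<integral>\<^sup>+l. (\<integral>\<^sup>+x. ?Q x * indicator G (x - real_vec l) \<partial>lborel) \<partial>count_space UNIV)"
    by (rule nn_integral_count_space_nn_integral) auto
  also have "\<dots> = (\<integral>\<^sup>+l. (\<integral>\<^sup>+x. ?Q (x + real_vec l) * indicator G x \<partial>lborel) \<partial>count_space UNIV)"
  proof (rule nn_integral_cong)
    fix l
    show "(\<integral>\<^sup>+x. ?Q x * indicator G (x - real_vec l) \<partial>lborel) = (\<integral>\<^sup>+x. ?Q (x + real_vec l) * indicator G x \<partial>lborel)"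
      using nn_integral_lborel_translate[of "\<lambda>x. ?Q x * indicator G (x - real_vec l)" "real_vec l"] by simp
  qed
  also have "\<dots> = (\<integral>\<^sup>+x. (\<integral>\<^sup>+l. ?Q (x + real_vec l) * indicator G x \<partial>count_space UNIV) \<partial>lborel)"
    by (rule nn_integral_count_space_nn_integral[symmetric]) auto
  also have "\<dots> = (\<integral>\<^sup>+x. indicator G x \<partial>lborel)"
  proof (intro nn_integral_cong)
    fix x :: "real ^ 's"
    have "(\<integral>\<^sup>+l. ?Q (x + real_vec l) * indicator G x \<partial>count_space UNIV)
        = (\<integral>\<^sup>+l. (if x + real_vec l \<in> unit_cube then indicator G x else 0) \<partial>count_space UNIV)"
      by (intro nn_integral_cong) (auto simp: indicator_def)
    also have "\<dots> = indicator G x" by (rule nn_integral_count_space_ex1[OF unit_cube_tiles])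
    finally show "(\<integral>\<^sup>+l. ?Q (x + real_vec l) * indicator G x \<partial>count_space UNIV) = indicator G x" .
  qed
  also have "\<dots> = 1" using tile by simp
  finally have QN: "(\<integral>\<^sup>+x. ?Q x * ?N x \<partial>lborel) = 1" .
  have "(\<integral>\<^sup>+x. ?Q x * ?N x \<partial>lborel) = (\<integral>\<^sup>+x. ?Q x + ?Q x * (?N x - 1) \<partial>lborel)"
    by (intro nn_integral_cong) (simp add: indicator_times_eq_if add_diff_inverse_ennreal[OF N1] split: split_indicator)
  also have "\<dots> = 1 + (\<integral>\<^sup>+x. ?Q x * (?N x - 1) \<partial>lborel)"
    by (subst nn_integral_add) (auto simp: emeasure_unit_cube)
  finally have "1 + (\<integral>\<^sup>+x. ?Q x * (?N x - 1) \<partial>lborel) = 1 + 0"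
    unfolding QN by simp
  then have "(\<integral>\<^sup>+x. ?Q x * (?N x - 1) \<partial>lborel) = 0"
    unfolding ennreal_add_left_cancel by simp
  then have "AE x in lborel. ?Q x * (?N x - 1) = 0"
    by (subst (asm) nn_integral_0_iff_AE) auto
  then have "AE x in lborel. x \<in> unit_cube \<longrightarrow> (\<exists>!l. x - real_vec l \<in> G)"
  proof eventually_elim
    case (elim x)
    show ?case
    proof
      assume "x \<in> unit_cube"
      with elim have le: "?N x \<le> 1" by (simp add: diff_eq_0_iff_ennreal)
      obtain l where l: "x - real_vec l \<in> G" using G_cover by blast
      show "\<exists>!l. x - real_vec l \<in> G"
      proof (rule ex1I[of _ l], rule l, rule ccontr)
        fix l' assume l': "x - real_vec l' \<in> G" "l' \<noteq> l"
        have "(\<integral>\<^sup>+k. indicator {l, l'} k \<partial>count_space UNIV) \<le> ?N x"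
          using l l' by (intro nn_integral_mono) (auto simp: indicator_def)
        then have "2 \<le> ?N x" using l'(2) by simp
        then have "(2::ennreal) \<le> 1" using le by (rule order_trans)
        then show False by simp
      qed
    qed
  qed
  then have "AE x in lborel. \<forall>k :: int ^ 's. x + real_vec k \<in> unit_cube \<longrightarrow> (\<exists>!l. x + real_vec k - real_vec l \<in> G)"
    by (subst AE_all_countable) (intro allI AE_translate)
  then show ?thesis
  proof eventually_elim
    case (elim x)
    obtain k where "x + real_vec k \<in> unit_cube" using unit_cube_tiles by blast
    with elim have "\<exists>!l. x + real_vec k - real_vec l \<in> G" by blast
    then obtain l where l: "x + real_vec k - real_vec l \<in> G"
      "\<forall>l'. x + real_vec k - real_vec l' \<in> G \<longrightarrow> l' = l" by (rule ex1E)
    show ?case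
    proof (rule ex1I[of _ "l - k"])
      show "x - real_vec (l - k) \<in> G" using l(1) by (simp add: real_vec_simps algebra_simps)
      fix l' assume "x - real_vec l' \<in> G"
      then have "l' + k = l" by (intro l(2)[rule_format]) (simp add: real_vec_simps algebra_simps)
      then show "l' = l - k" by (simp add: algebra_simps)
    qed
  qed
qed

lemma invertible_A: "invertible A"
  using invertible_def A_cancel expansive_invertible(1)[OF expansive]
  by (metis invertible_right_inverse matrix_inv_cancel matrix_vector_mul_assoc matrix_eq matrix_vector_mul_lid)

lemma AE_branch: "AE y in lborel. P y \<Longrightarrow> AE y in lborel. P (branch M k y)"
  unfolding branch_affine by (rule AE_affine[OF invertible_A])

lemma AE_dilate: "AE y in lborel. P y \<Longrightarrow> AE y in lborel. P (real_mat M *v y - real_vec k)"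
  using AE_affine[OF expansive_invertible(1)[OF expansive], of P "- real_vec k"] by simp

lemma branch_measurable [measurable]: "branch M k \<in> borel_measurable borel"
  by (intro borel_measurable_continuous_onI continuous_on_branch)

lemma dilate_measurable [measurable]: "(\<lambda>x. real_mat M *v x - c) \<in> borel_measurable borel"
  by (intro borel_measurable_continuous_onI continuous_intros matrix_vector_mult_linear_continuous_on)

lemma G_iff: "x \<in> G \<longleftrightarrow> (\<exists>d\<in>D. real_mat M *v x - real_vec d \<in> G)"
  using expansions_backward branch_expansions branch_inverse by metis

text \<open>
  \<open>M G\<close> is the union of the \<open>d + G\<close> with \<open>d \<in> D\<close>, and these are among the translates that tile the space.
\<close>
lemma G_split: "AE x in lborel. x \<in> G \<longrightarrow> (\<exists>!d. d \<in> D \<and> real_mat M *v x - real_vec d \<in> G)"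
  using AE_dilate[OF tiling, of 0]
proof eventually_elim
  case (elim x)
  then have uniq: "\<exists>!l. real_mat M *v x - real_vec l \<in> G" by (simp add: real_vec_simps)
  show ?case
  proof
    assume "x \<in> G"
    then obtain d where d: "d \<in> D" "real_mat M *v x - real_vec d \<in> G" using G_iff by blast
    show "\<exists>!d. d \<in> D \<and> real_mat M *v x - real_vec d \<in> G"
      by (rule ex1I[of _ d]) (use d uniq in blast)+
  qed
qed

lemma indicator_G_split:
  "AE x in lborel. (if x \<in> G then b x else 0) = (\<Sum>d\<in>D. if real_mat M *v x - real_vec d \<in> G then b x else (0::'b::comm_monoid_add))"
  using G_split
proof eventually_elim
  case (elim x)
  show ?case
  proof (cases "x \<in> G")
    case True
    with elim have "\<exists>!d. d \<in> D \<and> real_mat M *v x - real_vec d \<in> G" by blast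
    from sum_if_ex1[OF finite_D this, of "b x"] True show ?thesis by simp
  next
    case False
    then have "\<And>d. d \<in> D \<Longrightarrow> real_mat M *v x - real_vec d \<notin> G" using G_iff by blast
    then show ?thesis using False by simp
  qed
qed

text \<open>
  The scaling constant \<open>k\<close> is determined by integrating the decomposition of \<open>G\<close> into \<open>m\<close> pieces, which
  gives \<open>1 = m * k\<close>.
\<close>
lemma distr_dilate: "distr lborel borel (\<lambda>x. real_mat M *v x - c) = density lborel (\<lambda>_. ennreal (1 / m))"
proof -
  obtain k where k: "k \<ge> 0" "\<And>t. distr lborel borel (\<lambda>x. real_mat M *v x + t) = density lborel (\<lambda>_. ennreal k)"
    using distr_affine_lborel[OF expansive_invertible(1)[OF expansive]] by blast
  have nn: "(\<integral>\<^sup>+x. h (real_mat M *v x - c) \<partial>lborel) = ennreal k * (\<integral>\<^sup>+x. h x \<partial>lborel)"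
    if [measurable]: "h \<in> borel_measurable borel" for h c
  proof -
    have "(\<integral>\<^sup>+x. h (real_mat M *v x - c) \<partial>lborel) = (\<integral>\<^sup>+x. h x \<partial>distr lborel borel (\<lambda>x. real_mat M *v x - c))"
      by (rule nn_integral_distr[symmetric]) auto
    also have "distr lborel borel (\<lambda>x. real_mat M *v x - c) = density lborel (\<lambda>_. ennreal k)"
      using k(2)[of "- c"] by simp
    also have "(\<integral>\<^sup>+x. h x \<partial>density lborel (\<lambda>_. ennreal k)) = ennreal k * (\<integral>\<^sup>+x. h x \<partial>lborel)"
      by (rule nn_integral_scaled_lborel) auto
    finally show ?thesis .
  qed
  have "1 = (\<integral>\<^sup>+x. indicator G x \<partial>lborel)" using tile by simp
  also have "\<dots> = (\<integral>\<^sup>+x. (if x \<in> G then 1 else 0) \<partial>lborel)"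
    by (intro nn_integral_cong) (simp add: indicator_def)
  also have "\<dots> = (\<integral>\<^sup>+x. (\<Sum>d\<in>D. if real_mat M *v x - real_vec d \<in> G then 1 else 0) \<partial>lborel)"
    by (rule nn_integral_cong_AE) (rule indicator_G_split)
  also have "\<dots> = (\<Sum>d\<in>D. \<integral>\<^sup>+x. indicator G (real_mat M *v x - real_vec d) \<partial>lborel)"
    by (subst nn_integral_sum) (auto intro!: sum.cong nn_integral_cong simp: indicator_def simp del: of_bool_def)
  also have "\<dots> = ennreal m * ennreal k"
    using tile by (simp add: nn ennreal_of_nat_eq_real_of_nat)
  finally have "ennreal (m * k) = ennreal 1" using k(1) by (simp add: ennreal_mult)
  then have "m * k = 1" using k(1) by (subst (asm) ennreal_inj) auto
  then have "k = 1 / m" using m_pos by (simp add: field_simps)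
  with k(2)[of "- c"] show ?thesis by simp
qed

lemma nn_integral_dilate:
  assumes [measurable]: "h \<in> borel_measurable borel"
  shows "(\<integral>\<^sup>+x. h (real_mat M *v x - c) \<partial>lborel) = ennreal (1 / m) * (\<integral>\<^sup>+x. h x \<partial>lborel)"
proof -
  have "(\<integral>\<^sup>+x. h (real_mat M *v x - c) \<partial>lborel) = (\<integral>\<^sup>+x. h x \<partial>distr lborel borel (\<lambda>x. real_mat M *v x - c))"
    by (rule nn_integral_distr[symmetric]) auto
  then show ?thesis unfolding distr_dilate by (simp add: nn_integral_scaled_lborel)
qed

lemma integral_dilate:
  fixes h :: "real ^ 's \<Rightarrow> real"
  assumes h: "integrable lborel h"
  shows "integrable lborel (\<lambda>x. h (real_mat M *v x - c))"
    "(\<integral>x. h (real_mat M *v x - c) \<partial>lborel) = (1 / m) * (\<integral>x. h x \<partial>lborel)"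
proof -
  have [measurable]: "h \<in> borel_measurable borel" using h by auto
  have "integrable (density lborel (\<lambda>_. ennreal (1 / m))) h"
    using h m_pos by (subst integrable_density) auto
  then show "integrable lborel (\<lambda>x. h (real_mat M *v x - c))"
    unfolding distr_dilate[of c, symmetric] by (subst (asm) integrable_distr_eq) auto
  have "(\<integral>x. h (real_mat M *v x - c) \<partial>lborel) = (\<integral>x. h x \<partial>distr lborel borel (\<lambda>x. real_mat M *v x - c))"
    by (rule integral_distr[symmetric]) auto
  also have "\<dots> = (1 / m) * (\<integral>x. h x \<partial>lborel)"
    unfolding distr_dilate using m_pos by (subst integral_density) auto
  finally show "(\<integral>x. h (real_mat M *v x - c) \<partial>lborel) = (1 / m) * (\<integral>x. h x \<partial>lborel)" .
qed

lemma nn_integral_G_split: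
  assumes [measurable]: "h \<in> borel_measurable borel"
  shows "(\<integral>\<^sup>+x\<in>G. h x \<partial>lborel) = ennreal (1 / m) * (\<Sum>d\<in>D. \<integral>\<^sup>+y\<in>G. h (branch M d y) \<partial>lborel)"
proof -
  have "(\<integral>\<^sup>+x\<in>G. h x \<partial>lborel) = (\<integral>\<^sup>+x. (if x \<in> G then h x else 0) \<partial>lborel)"
    by (intro nn_integral_cong) (simp add: indicator_def)
  also have "\<dots> = (\<integral>\<^sup>+x. (\<Sum>d\<in>D. if real_mat M *v x - real_vec d \<in> G then h x else 0) \<partial>lborel)"
    by (rule nn_integral_cong_AE) (rule indicator_G_split)
  also have "\<dots> = (\<integral>\<^sup>+x. (\<Sum>d\<in>D. h (branch M d (real_mat M *v x - real_vec d)) * indicator G (real_mat M *v x - real_vec d)) \<partial>lborel)"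
    by (intro nn_integral_cong sum.cong) (auto simp: branch_inverse indicator_def)
  also have "\<dots> = (\<Sum>d\<in>D. \<integral>\<^sup>+x. h (branch M d (real_mat M *v x - real_vec d)) * indicator G (real_mat M *v x - real_vec d) \<partial>lborel)"
    by (rule nn_integral_sum) auto
  also have "\<dots> = (\<Sum>d\<in>D. ennreal (1 / m) * (\<integral>\<^sup>+y\<in>G. h (branch M d y) \<partial>lborel))"
    by (intro sum.cong refl nn_integral_dilate[where h = "\<lambda>y. h (branch M d y) * indicator G y" for d]) auto
  finally show ?thesis by (simp add: sum_distrib_left)
qed

lemma integral_G_split:
  fixes h :: "real ^ 's \<Rightarrow> real"
  assumes [measurable]: "h \<in> borel_measurable borel"
    and int: "\<And>d. d \<in> D \<Longrightarrow> integrable lborel (\<lambda>y. indicator G y * h (branch M d y))"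
  shows "(\<integral>x. indicator G x * h x \<partial>lborel) = (1 / m) * (\<Sum>d\<in>D. \<integral>y. indicator G y * h (branch M d y) \<partial>lborel)"
proof -
  have "(\<integral>x. indicator G x * h x \<partial>lborel) = (\<integral>x. (if x \<in> G then h x else 0) \<partial>lborel)"
    by (intro Bochner_Integration.integral_cong) (auto simp: indicator_def)
  also have "\<dots> = (\<integral>x. (\<Sum>d\<in>D. if real_mat M *v x - real_vec d \<in> G then h x else 0) \<partial>lborel)"
    by (rule integral_cong_AE[OF _ _ indicator_G_split]) auto
  also have "\<dots> = (\<integral>x. (\<Sum>d\<in>D. indicator G (real_mat M *v x - real_vec d) * h (branch M d (real_mat M *v x - real_vec d))) \<partial>lborel)"
    by (intro Bochner_Integration.integral_cong sum.cong) (auto simp: branch_inverse indicator_def)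
  also have "\<dots> = (\<Sum>d\<in>D. \<integral>x. indicator G (real_mat M *v x - real_vec d) * h (branch M d (real_mat M *v x - real_vec d)) \<partial>lborel)"
    by (intro Bochner_Integration.integral_sum integral_dilate(1)[OF int])
  also have "\<dots> = (\<Sum>d\<in>D. (1 / m) * (\<integral>y. indicator G y * h (branch M d y) \<partial>lborel))"
    by (intro sum.cong refl integral_dilate(2)[OF int])
  finally show ?thesis by (simp add: sum_distrib_left)
qed

lemma nn_integral_lattice:
  assumes [measurable]: "h \<in> borel_measurable borel"
  shows "(\<integral>\<^sup>+x. h x \<partial>lborel) = (\<integral>\<^sup>+l. (\<integral>\<^sup>+y\<in>G. h (y + real_vec l) \<partial>lborel) \<partial>count_space UNIV)"
proof -
  have "(\<integral>\<^sup>+x. h x \<partial>lborel) = (\<integral>\<^sup>+x. (\<integral>\<^sup>+l. (if x - real_vec l \<in> G then h x else 0) \<partial>count_space UNIV) \<partial>lborel)"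
    by (rule nn_integral_cong_AE) (use tiling in eventually_elim, simp only: nn_integral_count_space_ex1)
  also have "\<dots> = (\<integral>\<^sup>+l. (\<integral>\<^sup>+x. (if x - real_vec l \<in> G then h x else 0) \<partial>lborel) \<partial>count_space UNIV)"
    by (rule nn_integral_count_space_nn_integral) auto
  also have "\<dots> = (\<integral>\<^sup>+l. (\<integral>\<^sup>+y\<in>G. h (y + real_vec l) \<partial>lborel) \<partial>count_space UNIV)"
  proof (rule nn_integral_cong)
    fix l :: "int ^ 's"
    have "(\<integral>\<^sup>+x. (if x - real_vec l \<in> G then h x else 0) \<partial>lborel)
        = (\<integral>\<^sup>+x. (if x + real_vec l - real_vec l \<in> G then h (x + real_vec l) else 0) \<partial>lborel)"
      by (rule nn_integral_lborel_translate[symmetric]) measurable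
    also have "\<dots> = (\<integral>\<^sup>+y\<in>G. h (y + real_vec l) \<partial>lborel)"
      by (intro nn_integral_cong) (simp add: indicator_def)
    finally show "(\<integral>\<^sup>+x. (if x - real_vec l \<in> G then h x else 0) \<partial>lborel) = (\<integral>\<^sup>+y\<in>G. h (y + real_vec l) \<partial>lborel)" .
  qed
  finally show ?thesis .
qed

subsection \<open>Words of digits\<close>

abbreviation "branches ds y \<equiv> foldr (branch M) ds y"

text \<open>
  The cell of a word of length \<open>n\<close> is a copy of \<open>G\<close> contracted by \<open>A\<^sup>n\<close>.
\<close>
lemma branches_diff: "branches js y - branches js y' = apow (length js) (y - y')"
  by (induction js) (auto simp: branch_def matrix_vector_mult_diff_distrib[symmetric])

lemma branches_measurable [measurable]: "(\<lambda>y. branches ds y) \<in> borel_measurable borel"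
  by (induction ds) auto

lemma AE_branches: "AE y in lborel. P y \<Longrightarrow> AE y in lborel. P (branches ds y)"
proof (induction ds arbitrary: P)
  case (Cons d ds)
  from Cons.IH[OF AE_branch[OF Cons.prems, of d]] show ?case by simp
qed simp

lemma branches_G: "y \<in> G \<Longrightarrow> set ds \<subseteq> D \<Longrightarrow> branches ds y \<in> G"
  by (induction ds) (auto intro: branch_expansions)

text \<open>
  The integral over the tile is the mean over its \<open>m\<^sup>n\<close> cells of level \<open>n\<close>, each of them parametrised
  by \<open>G\<close>.
\<close>
lemma nn_integral_G_words:
  "h \<in> borel_measurable borel \<Longrightarrow>
   (\<integral>\<^sup>+x\<in>G. h x \<partial>lborel) = ennreal (1 / m ^ n) * (\<Sum>ds\<in>words D n. \<integral>\<^sup>+y\<in>G. h (branches ds y) \<partial>lborel)"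
proof (induction n arbitrary: h)
  case 0
  then show ?case by (simp add: words_0)
next
  case (Suc n)
  have [measurable]: "h \<in> borel_measurable borel" by fact
  have "(\<integral>\<^sup>+x\<in>G. h x \<partial>lborel) = ennreal (1 / m) * (\<Sum>d\<in>D. \<integral>\<^sup>+y\<in>G. h (branch M d y) \<partial>lborel)"
    by (rule nn_integral_G_split) auto
  also have "\<dots> = ennreal (1 / m) * (\<Sum>d\<in>D. ennreal (1 / m ^ n) * (\<Sum>ds\<in>words D n. \<integral>\<^sup>+y\<in>G. h (branch M d (branches ds y)) \<partial>lborel))"
    by (subst Suc.IH[where h = "\<lambda>y. h (branch M d y)" for d]) auto
  also have "\<dots> = ennreal (1 / m ^ Suc n) * (\<Sum>ds\<in>words D (Suc n). \<integral>\<^sup>+y\<in>G. h (branches ds y) \<partial>lborel)"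
    using m_pos by (simp add: sum_words_Cons sum_distrib_left[symmetric] mult.assoc[symmetric] ennreal_mult[symmetric])
  finally show ?case .
qed

end

section \<open>Uniqueness of refinable distributions\<close>

lemma in_fun_support: "f x \<noteq> 0 \<Longrightarrow> x \<in> fun_support f"
  unfolding fun_support_def by (rule subsetD[OF closure_subset]) simp

lemma partial_derivs_outside_support:
  "x \<notin> fun_support f \<Longrightarrow> partial_derivs is f x = 0"
proof (induction "is" arbitrary: x)
  case Nil
  then show ?case using in_fun_support by fastforce
next
  case (Cons i "is")
  have op: "open (- fun_support f)" unfolding fun_support_def by (intro open_Compl closed_closure)
  have "((\<lambda>x. 0) has_derivative (\<lambda>x. 0)) (at x)" by simp
  then have "(partial_derivs is f has_derivative (\<lambda>x. 0)) (at x)"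
  proof (rule has_derivative_transform_within_open[OF _ op])
    show "x \<in> - fun_support f" using Cons.prems by simp
    show "0 = partial_derivs is f y" if "y \<in> - fun_support f" for y
      using Cons.IH[of y] that by simp
  qed
  from partial_deriv_eq[OF this, of i] show ?case by simp
qed

lemma test_fun_smooth: "test_fun f \<Longrightarrow> smooth f"
  by (simp add: test_fun_def)

lemma test_fun_partial_deriv:
  assumes "test_fun f"
  shows "test_fun (partial_deriv i f)"
proof (rule test_funI[where S = "fun_support f"])
  show "smooth (partial_deriv i f)" using assms by (simp add: test_fun_def smooth_partial_deriv)
  show "bounded (fun_support f)" using assms by (simp add: test_fun_def compact_imp_bounded)
  show "x \<in> fun_support f" if "partial_deriv i f x \<noteq> 0" for x
    using that partial_derivs_outside_support[of x f "[i]"] by auto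
qed

lemma test_fun_derivs_bounded:
  assumes f: "test_fun f"
  shows "\<exists>B\<ge>0. \<forall>x. \<bar>partial_derivs is f x\<bar> \<le> B"
proof -
  have "compact (partial_derivs is f ` fun_support f)"
    using f by (intro compact_continuous_image smooth_continuous smooth_partial_derivs) (auto simp: test_fun_def)
  then obtain B where B: "0 < B" "\<And>x. x \<in> fun_support f \<Longrightarrow> \<bar>partial_derivs is f x\<bar> \<le> B"
    using compact_imp_bounded bounded_pos by (metis image_eqI real_norm_def)
  have "\<bar>partial_derivs is f x\<bar> \<le> B" for x
    using B partial_derivs_outside_support[of x f "is"] by (cases "x \<in> fun_support f") auto
  with B(1) show ?thesis by (intro exI[of _ B]) auto
qed

lemma test_fun_mult: "test_fun f \<Longrightarrow> smooth g \<Longrightarrow> test_fun (\<lambda>x. f x * g x)"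
  by (intro test_funI[where S = "fun_support f"] smooth_mult in_fun_support)
     (auto simp: test_fun_def compact_imp_bounded)

lemma test_fun_linear_comb:
  assumes "test_fun f" "test_fun g"
  shows "test_fun (\<lambda>x. a * f x + b * g x)"
proof (rule test_funI[where S = "fun_support f \<union> fun_support g"])
  show "smooth (\<lambda>x. a * f x + b * g x)" using assms by (simp add: test_fun_def smooth_linear_comb)
  show "bounded (fun_support f \<union> fun_support g)" using assms by (simp add: test_fun_def compact_imp_bounded)
  show "x \<in> fun_support f \<union> fun_support g" if "a * f x + b * g x \<noteq> 0" for x
  proof (cases "f x = 0")
    case True
    then have "g x \<noteq> 0" using that by auto
    with in_fun_support[of g x] show ?thesis by blast
  next
    case False
    with in_fun_support[of f x] show ?thesis by blast
  qed
qed

lemma finite_multi_indices: "finite {is :: 's::finite list. length is \<le> n}"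
  using finite_lists_length_le[of "UNIV :: 's set" n] by simp

text \<open>
  Multiplication by a fixed test function is continuous for the seminorms of the derivatives. The bound
  is pointwise, so that \<open>g\<close> has to be controlled only on the support of \<open>\<eta>\<close>.
\<close>
lemma leibniz_bound:
  assumes "test_fun (\<eta> :: real ^ 's::finite \<Rightarrow> real)"
  shows "\<exists>B\<ge>0. \<forall>(g :: real ^ 's \<Rightarrow> real) b x. smooth g \<and> (\<forall>js. length js \<le> length is \<longrightarrow> \<bar>partial_derivs js g x\<bar> \<le> b)
    \<longrightarrow> \<bar>partial_derivs is (\<lambda>x. \<eta> x * g x) x\<bar> \<le> B * b"
  using assms
proof (induction "is" arbitrary: \<eta> rule: rev_induct)
  case Nil
  obtain B where B: "0 \<le> B" "\<And>x. \<bar>\<eta> x\<bar> \<le> B" using test_fun_derivs_bounded[OF Nil, of "[]"] by auto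
  show ?case
  proof (intro exI[of _ B] conjI allI impI B(1))
    fix g :: "real ^ 's \<Rightarrow> real" and b x
    assume *: "smooth g \<and> (\<forall>js. length js \<le> length [] \<longrightarrow> \<bar>partial_derivs js g x\<bar> \<le> b)"
    then have "\<bar>g x\<bar> \<le> b" by (elim conjE allE[of _ "[]"]) simp
    then show "\<bar>partial_derivs [] (\<lambda>x. \<eta> x * g x) x\<bar> \<le> B * b"
      using B by (simp add: abs_mult mult_mono)
  qed
next
  case (snoc j "is")
  obtain B1 where B1: "0 \<le> B1" "\<And>g b x. smooth g \<Longrightarrow> (\<And>js. length js \<le> length is \<Longrightarrow> \<bar>partial_derivs js g x\<bar> \<le> b)
    \<Longrightarrow> \<bar>partial_derivs is (\<lambda>x. partial_deriv j \<eta> x * g x) x\<bar> \<le> B1 * b"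
    using snoc.IH[OF test_fun_partial_deriv[OF snoc.prems]] by blast
  obtain B2 where B2: "0 \<le> B2" "\<And>g b x. smooth g \<Longrightarrow> (\<And>js. length js \<le> length is \<Longrightarrow> \<bar>partial_derivs js g x\<bar> \<le> b)
    \<Longrightarrow> \<bar>partial_derivs is (\<lambda>x. \<eta> x * g x) x\<bar> \<le> B2 * b"
    using snoc.IH[OF snoc.prems] by blast
  show ?case
  proof (intro exI[of _ "B1 + B2"] conjI allI impI)
    show "0 \<le> B1 + B2" using B1(1) B2(1) by simp
    fix g :: "real ^ 's \<Rightarrow> real" and b x
    assume *: "smooth g \<and> (\<forall>js. length js \<le> length (is @ [j]) \<longrightarrow> \<bar>partial_derivs js g x\<bar> \<le> b)"
    have g: "smooth g" and \<eta>: "smooth \<eta>" using * snoc.prems by (auto simp: test_fun_def)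
    have b1: "\<bar>partial_derivs js g x\<bar> \<le> b" if "length js \<le> length is" for js
      using * that by simp
    have b2: "\<bar>partial_derivs js (partial_deriv j g) x\<bar> \<le> b" if "length js \<le> length is" for js
      using *[THEN conjunct2, rule_format, of "js @ [j]"] that by simp
    have "partial_derivs (is @ [j]) (\<lambda>x. \<eta> x * g x)
        = partial_derivs is (\<lambda>x. partial_deriv j \<eta> x * g x + \<eta> x * partial_deriv j g x)"
      using arg_cong[OF partial_deriv_mult[OF smooth_differentiable[OF \<eta>] smooth_differentiable[OF g]], of "partial_derivs is"]
      by simp
    also have "\<dots> = (\<lambda>x. partial_derivs is (\<lambda>x. partial_deriv j \<eta> x * g x) x + partial_derivs is (\<lambda>x. \<eta> x * partial_deriv j g x) x)"
      by (intro partial_derivs_add smooth_mult smooth_partial_deriv g \<eta>)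
    finally show "\<bar>partial_derivs (is @ [j]) (\<lambda>x. \<eta> x * g x) x\<bar> \<le> (B1 + B2) * b"
      using B1(2)[OF g b1] B2(2)[OF smooth_partial_deriv[OF g] b2]
      by (simp add: distrib_right)
  qed
qed

lemma smooth_derivs_bounded_on_cball:
  assumes "smooth (g :: real ^ 's::finite \<Rightarrow> real)"
  shows "\<exists>b\<ge>0. \<forall>is x. length is \<le> n \<longrightarrow> x \<in> cball 0 R \<longrightarrow> \<bar>partial_derivs is g x\<bar> \<le> b"
proof -
  have "\<exists>b\<ge>0. \<forall>x\<in>cball 0 R. \<bar>partial_derivs is g x\<bar> \<le> b" for "is"
  proof -
    have "compact (partial_derivs is g ` cball 0 R)"
      using assms by (intro compact_continuous_image smooth_continuous smooth_partial_derivs) auto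
    then obtain b where "0 < b" "\<And>x. x \<in> cball 0 R \<Longrightarrow> \<bar>partial_derivs is g x\<bar> \<le> b"
      using compact_imp_bounded bounded_pos by (metis image_eqI real_norm_def)
    then show ?thesis by (intro exI[of _ b]) auto
  qed
  then obtain b where b: "\<And>is. 0 \<le> b is" "\<And>is x. x \<in> cball 0 R \<Longrightarrow> \<bar>partial_derivs is g x\<bar> \<le> b is"
    by metis
  let ?S = "\<Sum>is | length is \<le> n. b is"
  have "\<bar>partial_derivs is g x\<bar> \<le> ?S" if "length is \<le> n" "x \<in> cball 0 R" for "is" x
  proof -
    have "b is \<le> ?S" using that(1) by (intro member_le_sum b(1) finite_multi_indices) auto
    with b(2)[OF that(2), of "is"] show ?thesis by linarith
  qed
  moreover have "0 \<le> ?S" by (intro sum_nonneg b(1))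
  ultimately show ?thesis by blast
qed

lemma (in expansive_matrix) test_fun_branch:
  assumes "test_fun f"
  shows "test_fun (\<lambda>y. f (branch M k y))"
proof (rule test_funI)
  show "smooth (\<lambda>y. f (branch M k y))"
    unfolding branch_affine by (intro smooth_affine test_fun_smooth assms)
  show "bounded ((\<lambda>x. real_mat M *v x - real_vec k) ` fun_support f)"
    using assms by (intro compact_imp_bounded compact_continuous_image continuous_intros
        matrix_vector_mult_linear_continuous_on) (auto simp: test_fun_def)
  show "y \<in> (\<lambda>x. real_mat M *v x - real_vec k) ` fun_support f" if "f (branch M k y) \<noteq> 0" for y
  proof (rule image_eqI[of _ _ "branch M k y"])
    show "y = real_mat M *v branch M k y - real_vec k" using branch_eq_iff by blast
    show "branch M k y \<in> fun_support f" using that by (rule in_fun_support)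
  qed
qed

text \<open>
  The difference of two solutions of the refinement equation with the same integral. The ball \<open>cball 0 R0\<close>
  contains the support, and \<open>u_one\<close> says that the integral is 0.
\<close>
locale null_refinable = expansive_matrix M for M :: "int ^ 's::finite ^ 's" +
  fixes u :: "'s functional" and S :: "(int ^ 's) set" and w :: "int ^ 's \<Rightarrow> real" and R0 :: real
  assumes u_dist: "distribution u"
    and u_support: "\<And>f. test_fun f \<Longrightarrow> fun_support f \<inter> cball 0 R0 = {} \<Longrightarrow> u f = 0"
    and finite_S: "finite S" and sum_w: "(\<Sum>k\<in>S. w k) = 1"
    and refine: "\<And>f. test_fun f \<Longrightarrow> u f = (\<Sum>k\<in>S. w k * u (\<lambda>y. f (branch M k y)))"
    and u_one: "\<And>f. test_fun f \<Longrightarrow> (\<And>x. x \<in> cball 0 R0 \<Longrightarrow> f x = 1) \<Longrightarrow> u f = 0"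
begin

lemma u_linear: "test_fun f \<Longrightarrow> test_fun g \<Longrightarrow> u (\<lambda>x. a * f x + b * g x) = a * u f + b * u g"
  using u_dist unfolding distribution_def by blast

lemma u_cong_near:
  assumes f: "test_fun f" and g: "test_fun g" and eq: "\<And>x. x \<in> cball 0 (R0 + 1) \<Longrightarrow> f x = g x"
  shows "u f = u g"
proof -
  let ?d = "\<lambda>x. 1 * f x + (- 1) * g x"
  have d: "test_fun ?d" using f g by (rule test_fun_linear_comb)
  have "fun_support ?d \<subseteq> - ball 0 (R0 + 1)"
    using eq by (intro fun_support_subset_closed) (auto simp: less_imp_le)
  moreover have "cball 0 R0 \<subseteq> (ball 0 (R0 + 1) :: (real ^ 's) set)" by auto
  ultimately have "u ?d = 0" using d by (intro u_support) auto
  then show ?thesis using u_linear[OF f g, of 1 "- 1"] by simp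
qed

text \<open>
  On the ball of radius \<open>R1\<close> the cutoff is 1. The radius is chosen such that the images of the
  neighbourhood \<open>cball 0 (R0 + 1)\<close> of the support under the branches still lie in the ball.
\<close>
definition "R1 = (SOME R. R0 + 1 \<le> R \<and> (\<forall>k\<in>S. \<forall>y\<in>cball 0 (R0 + 1). branch M k y \<in> cball 0 R))"

lemma R1: "R0 + 1 \<le> R1" "k \<in> S \<Longrightarrow> y \<in> cball 0 (R0 + 1) \<Longrightarrow> branch M k y \<in> cball 0 R1"
proof -
  have "bounded (\<Union>k\<in>S. branch M k ` cball 0 (R0 + 1))"
    using finite_S by (intro bounded_UN compact_imp_bounded ballI compact_continuous_image continuous_on_branch) auto
  then obtain R where "\<And>x. x \<in> (\<Union>k\<in>S. branch M k ` cball 0 (R0 + 1)) \<Longrightarrow> norm x \<le> R"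
    unfolding bounded_iff by blast
  then have "R0 + 1 \<le> max R (R0 + 1) \<and> (\<forall>k\<in>S. \<forall>y\<in>cball 0 (R0 + 1). branch M k y \<in> cball 0 (max R (R0 + 1)))"
    by fastforce
  then have "R0 + 1 \<le> R1 \<and> (\<forall>k\<in>S. \<forall>y\<in>cball 0 (R0 + 1). branch M k y \<in> cball 0 R1)"
    unfolding R1_def by (rule someI)
  then show "R0 + 1 \<le> R1" "k \<in> S \<Longrightarrow> y \<in> cball 0 (R0 + 1) \<Longrightarrow> branch M k y \<in> cball 0 R1" by auto
qed

definition cut :: "real ^ 's \<Rightarrow> real" where
  "cut = (SOME \<eta>. test_fun \<eta> \<and> (\<forall>x\<in>cball 0 R1. \<eta> x = 1))"

lemma cut: "test_fun cut" "x \<in> cball 0 R1 \<Longrightarrow> cut x = 1"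
proof -
  have "\<exists>\<eta> :: real ^ 's \<Rightarrow> real. test_fun \<eta> \<and> (\<forall>x\<in>cball 0 R1. \<eta> x = 1)"
    using cutoff_exists[of R1] by metis
  from someI_ex[OF this] show "test_fun cut" "x \<in> cball 0 R1 \<Longrightarrow> cut x = 1"
    unfolding cut_def by auto
qed

text \<open>
  The extension of \<open>u\<close> to all smooth functions, in particular to polynomials.
\<close>
definition ext :: "(real ^ 's \<Rightarrow> real) \<Rightarrow> real" where
  "ext g = u (\<lambda>x. cut x * g x)"

lemma ext_test_fun: "test_fun f \<Longrightarrow> ext f = u f"
  unfolding ext_def using R1(1) by (intro u_cong_near test_fun_mult cut test_fun_smooth) (auto simp: cut(2))

lemma ext_linear: "smooth f \<Longrightarrow> smooth g \<Longrightarrow> ext (\<lambda>x. a * f x + b * g x) = a * ext f + b * ext g"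
  unfolding ext_def using u_linear[OF test_fun_mult[OF cut(1)] test_fun_mult[OF cut(1)], of f g a b]
  by (simp add: algebra_simps)

lemma ext_diff: "smooth f \<Longrightarrow> smooth g \<Longrightarrow> ext (\<lambda>x. f x - g x) = ext f - ext g"
  using ext_linear[of f g 1 "- 1"] by simp

lemma ext_const: "ext (\<lambda>x. a) = 0"
proof -
  have "ext (\<lambda>x. 1) = u cut" by (simp add: ext_def)
  also have "u cut = 0" using R1(1) by (intro u_one cut) auto
  finally show ?thesis using ext_linear[of "\<lambda>x. 1" "\<lambda>x. 1" a 0] by simp
qed

text \<open>
  Near the support of \<open>u\<close> both cutoffs, the original one and the one composed with the branch, are equal
  to 1.
\<close>
lemma ext_refine:
  assumes g: "smooth g"
  shows "ext g = (\<Sum>k\<in>S. w k * ext (\<lambda>y. g (branch M k y)))"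
proof -
  have "ext g = (\<Sum>k\<in>S. w k * u (\<lambda>y. cut (branch M k y) * g (branch M k y)))"
    unfolding ext_def using refine[OF test_fun_mult[OF cut(1) g]] .
  also have "\<dots> = (\<Sum>k\<in>S. w k * u (\<lambda>y. cut y * g (branch M k y)))"
  proof (rule sum.cong[OF refl])
    fix k assume k: "k \<in> S"
    have "u (\<lambda>y. cut (branch M k y) * g (branch M k y)) = u (\<lambda>y. cut y * g (branch M k y))"
    proof (rule u_cong_near)
      show "test_fun (\<lambda>y. cut (branch M k y) * g (branch M k y))"
        using test_fun_branch[OF test_fun_mult[OF cut(1) g]] .
      show "test_fun (\<lambda>y. cut y * g (branch M k y))"
        unfolding branch_affine by (intro test_fun_mult cut smooth_affine g)
      fix y :: "real ^ 's" assume y: "y \<in> cball 0 (R0 + 1)"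
      then have "y \<in> cball 0 R1" using R1(1) by auto
      then show "cut (branch M k y) * g (branch M k y) = cut y * g (branch M k y)"
        using cut(2) R1(2)[OF k y] by simp
    qed
    then show "w k * u (\<lambda>y. cut (branch M k y) * g (branch M k y)) = w k * u (\<lambda>y. cut y * g (branch M k y))"
      by simp
  qed
  finally show ?thesis by (simp add: ext_def)
qed

text \<open>
  The continuity estimate of \<open>u\<close> for the support of the cutoff, combined with the Leibniz bound.
\<close>
lemma ext_bound:
  "\<exists>B n R. 0 \<le> B \<and> 0 \<le> R \<and> (\<forall>g b. smooth g \<and> (\<forall>is x. length is \<le> n \<longrightarrow> x \<in> cball 0 R \<longrightarrow> \<bar>partial_derivs is g x\<bar> \<le> b)
    \<longrightarrow> \<bar>ext g\<bar> \<le> B * b)"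
proof -
  let ?C = "fun_support cut"
  have C: "compact ?C" using cut(1) by (simp add: test_fun_def)
  obtain R where R: "0 < R" "?C \<subseteq> cball 0 R"
    using compact_imp_bounded[OF C] by (auto simp: bounded_pos subset_iff)
  obtain B n where B: "\<And>f b. test_fun f \<Longrightarrow> fun_support f \<subseteq> ?C \<Longrightarrow>
      (\<And>is x. length is \<le> n \<Longrightarrow> \<bar>partial_derivs is f x\<bar> \<le> b) \<Longrightarrow> \<bar>u f\<bar> \<le> B * b"
    using u_dist C unfolding distribution_def by metis
  obtain L where L: "\<And>is. 0 \<le> L is" "\<And>is g b x. smooth g \<Longrightarrow> (\<And>js. length js \<le> length is \<Longrightarrow> \<bar>partial_derivs js g x\<bar> \<le> b)
    \<Longrightarrow> \<bar>partial_derivs is (\<lambda>x. cut x * g x) x\<bar> \<le> L is * b"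
    using leibniz_bound[OF cut(1)] by metis
  let ?L = "\<Sum>is | length is \<le> n. L is"
  have "\<bar>ext g\<bar> \<le> (\<bar>B\<bar> * ?L) * b"
    if g: "smooth g" and b: "\<And>is x. length is \<le> n \<Longrightarrow> x \<in> cball 0 R \<Longrightarrow> \<bar>partial_derivs is g x\<bar> \<le> b" for g b
  proof -
    have b0: "0 \<le> b" using order_trans[OF abs_ge_zero b[of "[]" 0]] R by simp
    have sub: "fun_support (\<lambda>x. cut x * g x) \<subseteq> ?C"
      unfolding fun_support_def by (intro closure_mono) auto
    have "\<bar>u (\<lambda>x. cut x * g x)\<bar> \<le> B * (?L * b)"
    proof (rule B[OF test_fun_mult[OF cut(1) g] sub])
      fix js :: "'s list" and x assume js: "length js \<le> n"
      have Ljs: "L js \<le> ?L" using js by (intro member_le_sum L(1) finite_multi_indices) auto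
      show "\<bar>partial_derivs js (\<lambda>x. cut x * g x) x\<bar> \<le> ?L * b"
      proof (cases "x \<in> cball 0 R")
        case True
        then have "\<bar>partial_derivs js (\<lambda>x. cut x * g x) x\<bar> \<le> L js * b"
          using js by (intro L(2) g b) auto
        also have "\<dots> \<le> ?L * b" by (intro mult_right_mono Ljs b0)
        finally show ?thesis .
      next
        case False
        then have "x \<notin> fun_support (\<lambda>x. cut x * g x)" using R(2) sub by blast
        then have "partial_derivs js (\<lambda>x. cut x * g x) x = 0" by (rule partial_derivs_outside_support)
        moreover have "0 \<le> ?L * b" by (intro mult_nonneg_nonneg sum_nonneg L(1) b0)
        ultimately show ?thesis by simp
      qed
    qed
    also have "\<dots> \<le> \<bar>B\<bar> * (?L * b)"
      using b0 sum_nonneg[of "{is. length is \<le> n}" L] L(1) by (intro mult_right_mono) auto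
    finally show ?thesis by (simp add: ext_def mult.assoc)
  qed
  moreover have "0 \<le> \<bar>B\<bar> * ?L" using L(1) by (simp add: sum_nonneg)
  ultimately show ?thesis using R(1) by (intro exI[of _ "\<bar>B\<bar> * ?L"] exI[of _ n] exI[of _ R]) auto
qed

abbreviation "Am n \<equiv> matrix (apow n)"

lemma Am_mult: "Am n *v y = apow n y"
  using matrix_vector_mul(2)[OF apow_linear] by metis

lemma Am_entry: "\<bar>Am n $ i $ j\<bar> \<le> C\<^sub>M * r\<^sub>M ^ n"
proof -
  have "Am n $ i $ j = (Am n *v axis j 1) $ i"
    by (simp add: matrix_vector_mult_def axis_def if_distrib if_distribR sum.delta' cong: if_cong)
  also have "\<bar>\<dots>\<bar> \<le> norm (apow n (axis j 1 :: real ^ 's))" unfolding Am_mult by (rule component_le_norm_cart)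
  also have "\<dots> \<le> C\<^sub>M * r\<^sub>M ^ n * 1" by (rule apow_bound) simp
  finally show ?thesis by simp
qed

text \<open>
  The polynomials of degree less than \<open>n\<close>, described without coefficients so that affine substitutions
  and Taylor polynomials are easy to handle.
\<close>
definition flat :: "nat \<Rightarrow> (real ^ 's \<Rightarrow> real) \<Rightarrow> bool" where
  "flat n q \<longleftrightarrow> smooth q \<and> (\<forall>is x. length is = n \<longrightarrow> partial_derivs is q x = 0)"

lemma flat_affine: "flat n q \<Longrightarrow> flat n (\<lambda>y. q (B *v y + t))"
  unfolding flat_def
proof (intro conjI allI impI)
  assume *: "smooth q \<and> (\<forall>is x. length is = n \<longrightarrow> partial_derivs is q x = 0)"
  then show "smooth (\<lambda>y. q (B *v y + t))" using smooth_affine by blast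
  fix js :: "'s list" and x assume "length js = n"
  then have "\<bar>partial_derivs js (\<lambda>y. q (B *v y + t)) x\<bar> \<le> (real CARD('s) * (\<Sum>i\<in>UNIV. \<Sum>j\<in>UNIV. \<bar>B $ i $ j\<bar>)) ^ length js * 0"
  proof (intro partial_derivs_affine_bound)
    fix i j
    have "\<bar>B $ i $ j\<bar> \<le> (\<Sum>j\<in>UNIV. \<bar>B $ i $ j\<bar>)" by (intro member_le_sum) auto
    also have "\<dots> \<le> (\<Sum>i\<in>UNIV. \<Sum>j\<in>UNIV. \<bar>B $ i $ j\<bar>)"
      by (rule member_le_sum[where f = "\<lambda>i. \<Sum>j\<in>UNIV. \<bar>B $ i $ j\<bar>"]) (auto intro: sum_nonneg)
    finally show "\<bar>B $ i $ j\<bar> \<le> (\<Sum>i\<in>UNIV. \<Sum>j\<in>UNIV. \<bar>B $ i $ j\<bar>)" .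
  qed (use * in auto)
  then show "partial_derivs js (\<lambda>y. q (B *v y + t)) x = 0" by simp
qed

text \<open>
  \<open>q (A y + t)\<close> and \<open>q (A y)\<close> have the same leading part, so their difference is a polynomial of lower
  degree, which is annihilated by hypothesis. Since the weights add up to 1, refining amounts to the
  substitution of \<open>A\<close>.
\<close>
lemma ext_flat_dilate: "flat (Suc n) q \<Longrightarrow> (\<And>d. flat n d \<Longrightarrow> ext d = 0) \<Longrightarrow> ext q = ext (\<lambda>y. q (apow k y))"
proof (induction k)
  case 0
  then show ?case by simp
next
  case (Suc k)
  let ?q = "\<lambda>y. q (apow k y)"
  have q: "flat (Suc n) ?q"
    using flat_affine[OF Suc.prems(1), of "Am k" 0] by (simp add: Am_mult)
  then have sq: "smooth ?q" by (simp add: flat_def)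
  have const: "partial_derivs js ?q x = partial_derivs js ?q y" if "length js = n" for js x y
    using q that by (intro constant_if_partials_vanish smooth_partial_derivs sq)
      (metis flat_def foldr.simps(2) length_Cons o_apply)
  have "ext (\<lambda>y. ?q (branch M j y)) = ext (\<lambda>y. ?q (A *v y))" for j
  proof -
    have s: "smooth (\<lambda>y. ?q (branch M j y))" "smooth (\<lambda>y. ?q (A *v y))"
      using smooth_affine[OF sq, of A] smooth_affine[OF sq, of A 0] by (auto simp: branch_affine)
    have "flat n (\<lambda>y. ?q (branch M j y) - ?q (A *v y))"
      unfolding flat_def
    proof (intro conjI allI impI smooth_diff s)
      fix js :: "'s list" and x assume "length js = n"
      then have "partial_derivs js (\<lambda>y. ?q (A *v y + A *v real_vec j)) x = partial_derivs js (\<lambda>y. ?q (A *v y + 0)) x"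
        by (intro partial_derivs_affine_const sq const) auto
      then show "partial_derivs js (\<lambda>y. ?q (branch M j y) - ?q (A *v y)) x = 0"
        using fun_cong[OF partial_derivs_diff[OF s, of js], of x] by (simp add: branch_affine)
    qed
    from Suc.prems(2)[OF this] show ?thesis by (simp add: ext_diff[OF s])
  qed
  then have "ext ?q = (\<Sum>j\<in>S. w j * ext (\<lambda>y. ?q (A *v y)))"
    by (subst ext_refine[OF sq]) simp
  also have "\<dots> = ext (\<lambda>y. ?q (A *v y))" by (simp add: sum_distrib_right[symmetric] sum_w)
  finally show ?case using Suc by (simp add: funpow_swap1)
qed

text \<open>
  By the preceding lemma \<open>ext q = ext (q \<circ> A\<^sup>k)\<close> for all \<open>k\<close>. As \<open>k\<close> grows, \<open>q \<circ> A\<^sup>k\<close> converges to the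
  constant \<open>q 0\<close> together with its derivatives on the ball of radius \<open>R\<close>, and constants are annihilated.
\<close>
lemma ext_flat: "flat n q \<Longrightarrow> ext q = 0"
proof (induction n arbitrary: q)
  case 0
  then have "q x = 0" for x unfolding flat_def by (metis foldr.simps(1) id_apply list.size(3))
  then have "q = (\<lambda>x. 0)" by blast
  then show ?case using ext_const[of 0] by simp
next
  case (Suc n)
  have sq: "smooth q" using Suc.prems by (simp add: flat_def)
  obtain B l R where B: "0 \<le> B" "0 \<le> R"
    "\<And>g b. smooth g \<Longrightarrow> (\<And>is x. length is \<le> l \<Longrightarrow> x \<in> cball 0 R \<Longrightarrow> \<bar>partial_derivs is g x\<bar> \<le> b)
    \<Longrightarrow> \<bar>ext g\<bar> \<le> B * b"
    using ext_bound by metis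
  obtain b where b: "0 \<le> b" "\<And>is x. length is \<le> Suc l \<Longrightarrow> x \<in> cball 0 (C\<^sub>M * R) \<Longrightarrow> \<bar>partial_derivs is q x\<bar> \<le> b"
    using smooth_derivs_bounded_on_cball[OF sq, of "Suc l" "C\<^sub>M * R"] by metis
  let ?s = "real CARD('s)"
  let ?\<delta> = "\<lambda>k. ?s * (C\<^sub>M * r\<^sub>M ^ k)"
  have rpow: "0 \<le> r\<^sub>M ^ k" "r\<^sub>M ^ k \<le> 1" for k using contraction(2,3) by (auto simp: power_le_one)
  have \<delta>0: "0 \<le> ?\<delta> k" for k using contraction(1) rpow by simp
  have bound: "\<bar>ext q\<bar> \<le> B * (?\<delta> k * (1 + R) * b)" if \<delta>: "?\<delta> k \<le> 1" for k
  proof -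
    let ?g = "\<lambda>y. q (Am k *v y + 0)"
    have sg: "smooth ?g" by (rule smooth_affine[OF sq])
    have dom: "apow k x \<in> cball 0 (C\<^sub>M * r\<^sub>M ^ k * R)" if "x \<in> cball 0 R" for x
      using apow_bound[of x R k] that by simp
    have "C\<^sub>M * r\<^sub>M ^ k * R \<le> C\<^sub>M * R"
      using rpow[of k] contraction(1) B(2) by (intro mult_right_mono) (auto simp: mult_left_le)
    then have sub: "cball 0 (C\<^sub>M * r\<^sub>M ^ k * R) \<subseteq> (cball 0 (C\<^sub>M * R) :: (real ^ 's) set)" by (rule subset_cball)
    have "\<bar>ext (\<lambda>y. ?g y - q 0)\<bar> \<le> B * (?\<delta> k * (1 + R) * b)"
    proof (rule B(3))
      show "smooth (\<lambda>y. ?g y - q 0)" by (intro smooth_diff sg smooth_const)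
      fix js :: "'s list" and x :: "real ^ 's" assume js: "length js \<le> l" and x: "x \<in> cball 0 R"
      have le: "?\<delta> k * (1 + R) * b = ?\<delta> k * b + ?\<delta> k * R * b" by (simp add: algebra_simps)
      have nn: "0 \<le> ?\<delta> k * b" "0 \<le> ?\<delta> k * R * b" using \<delta>0[of k] b(1) B(2) by (simp_all only: mult_nonneg_nonneg)
      show "\<bar>partial_derivs js (\<lambda>y. ?g y - q 0) x\<bar> \<le> ?\<delta> k * (1 + R) * b"
      proof (cases "js = []")
        case True
        have "\<bar>q (apow k x) - q 0\<bar> \<le> ?s * (C\<^sub>M * r\<^sub>M ^ k * R) * b"
        proof (rule mean_value_bound[OF smooth_differentiable[OF sq] _ dom[OF x]])
          show "\<bar>partial_deriv i q y\<bar> \<le> b" if "y \<in> cball 0 (C\<^sub>M * r\<^sub>M ^ k * R)" for i y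
            using b(2)[of "[i]" y] that sub by auto
        qed
        also have "\<dots> = ?\<delta> k * R * b" by simp
        finally show ?thesis using nn unfolding le True by (simp add: Am_mult)
      next
        case False
        then obtain i js' where js': "js = i # js'" by (cases js) auto
        have "partial_derivs js (\<lambda>y. ?g y - q 0) x = partial_derivs js ?g x"
          by (subst partial_derivs_diff[OF sg smooth_const]) (simp add: partial_derivs_const False)
        also have "\<bar>\<dots>\<bar> \<le> ?\<delta> k ^ length js * b"
        proof (rule partial_derivs_affine_bound[OF sq Am_entry])
          fix ks :: "'s list" assume "length ks = length js"
          then show "\<bar>partial_derivs ks q (Am k *v x + 0)\<bar> \<le> b"
            using js dom[OF x] sub by (intro b(2)) (auto simp: Am_mult)
        qed
        also have "\<dots> \<le> ?\<delta> k * b"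
        proof (rule mult_right_mono[OF _ b(1)])
          have "?\<delta> k * ?\<delta> k ^ length js' \<le> ?\<delta> k * 1"
            using \<delta>0[of k] \<delta> by (intro mult_left_mono power_le_one)
          then show "?\<delta> k ^ length js \<le> ?\<delta> k" by (simp add: js')
        qed
        finally show ?thesis unfolding le using nn by linarith
      qed
    qed
    moreover have "ext (\<lambda>y. ?g y - q 0) = ext q"
      using ext_diff[OF sg smooth_const, of "q 0"] ext_flat_dilate[OF Suc.prems Suc.IH, of k]
      by (simp add: ext_const Am_mult)
    ultimately show ?thesis by simp
  qed
  have lim\<delta>: "?\<delta> \<longlonglongrightarrow> ?s * (C\<^sub>M * 0)"
    using contraction by (intro tendsto_intros LIMSEQ_realpow_zero) auto
  then have "\<forall>\<^sub>F k in sequentially. ?\<delta> k < 1" by (rule order_tendstoD) simp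
  then have "\<forall>\<^sub>F k in sequentially. \<bar>ext q\<bar> \<le> B * (?\<delta> k * (1 + R) * b)"
    by eventually_elim (simp add: bound)
  moreover have "(\<lambda>k. B * (?\<delta> k * (1 + R) * b)) \<longlonglongrightarrow> B * (?s * (C\<^sub>M * 0) * (1 + R) * b)"
    by (intro tendsto_intros lim\<delta>)
  ultimately have "\<bar>ext q\<bar> \<le> B * (?s * (C\<^sub>M * 0) * (1 + R) * b)"
    by (intro tendsto_lowerbound[of _ _ sequentially]) auto
  then show ?case by simp
qed

text \<open>
  \<open>k\<close> refinements express \<open>ext g\<close> through translates of \<open>g \<circ> A\<^sup>k\<close>. Every step costs the sum of the absolute
  values of the weights, which may exceed 1.
\<close>
lemma ext_iterate:
  assumes "smooth g" "\<And>t. \<bar>ext (\<lambda>y. g (apow k y + t))\<bar> \<le> b"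
  shows "\<bar>ext g\<bar> \<le> (\<Sum>j\<in>S. \<bar>w j\<bar>) ^ k * b"
  using assms(2)
proof (induction k arbitrary: b)
  case 0
  from 0[of 0] show ?case by simp
next
  case (Suc k)
  have "\<bar>ext (\<lambda>y. g (apow k y + t))\<bar> \<le> (\<Sum>j\<in>S. \<bar>w j\<bar>) * b" for t
  proof -
    let ?h = "\<lambda>y. g (apow k y + t)"
    have "smooth ?h" using smooth_affine[OF assms(1), of "Am k" t] by (simp add: Am_mult)
    then have "\<bar>ext ?h\<bar> \<le> (\<Sum>j\<in>S. \<bar>w j * ext (\<lambda>y. ?h (branch M j y))\<bar>)"
      by (subst ext_refine) (auto intro: sum_abs)
    also have "\<dots> \<le> (\<Sum>j\<in>S. \<bar>w j\<bar> * b)"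
    proof (intro sum_mono, unfold abs_mult, rule mult_left_mono)
      fix j
      have "?h (branch M j y) = g (apow (Suc k) y + (apow k (A *v real_vec j) + t))" for y
        using linear_add[OF apow_linear, of k "A *v y" "A *v real_vec j"]
        by (simp add: branch_affine funpow_swap1 add.assoc)
      then show "\<bar>ext (\<lambda>y. ?h (branch M j y))\<bar> \<le> b" using Suc.prems by simp
    qed simp
    finally show ?thesis by (simp add: sum_distrib_right)
  qed
  from Suc.IH[OF this] show ?case by (simp add: mult_ac)
qed

text \<open>
  Replacing \<open>f (A\<^sup>k y + t)\<close> by its Taylor remainder of order \<open>L\<close> does not change \<open>ext\<close>, and the remainder is
  of size \<open>(r\<^sup>k)\<^bsup>L+1\<^esup>\<close>. For \<open>L\<close> with \<open>\<Sum>|w| * r\<^bsup>L+1\<^esup> < 1\<close> this outweighs the loss in the \<open>k\<close> refinements.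
\<close>
theorem vanishes: "test_fun f \<Longrightarrow> u f = 0"
proof -
  assume f: "test_fun f"
  then have sf: "smooth f" by (rule test_fun_smooth)
  let ?s = "real CARD('s)" and ?W = "\<Sum>j\<in>S. \<bar>w j\<bar>"
  have W0: "0 \<le> ?W" by (simp add: sum_nonneg)
  obtain B n R where B: "0 \<le> B" "0 \<le> R"
    "\<And>g b. smooth g \<Longrightarrow> (\<And>is x. length is \<le> n \<Longrightarrow> x \<in> cball 0 R \<Longrightarrow> \<bar>partial_derivs is g x\<bar> \<le> b)
    \<Longrightarrow> \<bar>ext g\<bar> \<le> B * b"
    using ext_bound by metis
  have "(\<lambda>L. ?W * r\<^sub>M ^ L) \<longlonglongrightarrow> ?W * 0"
    using contraction by (intro tendsto_intros LIMSEQ_realpow_zero) auto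
  then have "\<forall>\<^sub>F L in sequentially. ?W * r\<^sub>M ^ L < 1" by (rule order_tendstoD) simp
  then obtain L0 where L0: "\<And>L. L0 \<le> L \<Longrightarrow> ?W * r\<^sub>M ^ L < 1" by (auto simp: eventually_sequentially)
  \<comment> \<open>\<open>L \<ge> n\<close> ensures that the remainder estimate covers all derivatives that enter the continuity bound.\<close>
  define L where "L = max n L0"
  have L: "n \<le> L" "?W * r\<^sub>M ^ Suc L < 1" using L0[of "Suc L"] by (auto simp: L_def)
  obtain bf where bf: "\<And>is. 0 \<le> bf is" "\<And>is x. \<bar>partial_derivs is f x\<bar> \<le> bf is"
    using test_fun_derivs_bounded[OF f] by metis
  define b where "b = (\<Sum>is | length is \<le> Suc L. bf is)"
  have b: "\<bar>partial_derivs js f x\<bar> \<le> b" if "length js = Suc L" for js x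
  proof -
    have "bf js \<le> b" unfolding b_def using that by (intro member_le_sum bf(1) finite_multi_indices) auto
    with bf(2)[of js x] show ?thesis by linarith
  qed
  have b0: "0 \<le> b" unfolding b_def by (intro sum_nonneg bf(1))
  define E where "E = B * (max 1 (?s * R) ^ Suc L * ((?s * C\<^sub>M) ^ Suc L * b))"
  have "\<bar>ext (\<lambda>y. f (apow k y + t))\<bar> \<le> E * (r\<^sub>M ^ Suc L) ^ k" for k t
  proof -
    let ?g = "\<lambda>y. f (Am k *v y + t)"
    let ?b = "(?s * (C\<^sub>M * r\<^sub>M ^ k)) ^ Suc L * b"
    have sg: "smooth ?g" by (rule smooth_affine[OF sf])
    have gb: "\<bar>partial_derivs js ?g y\<bar> \<le> ?b" if "length js = Suc L" for js y
      using partial_derivs_affine_bound[OF sf Am_entry, of js k y t b] that b by simp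
    have b'0: "0 \<le> ?b" using b0 contraction(1,2) by (intro mult_nonneg_nonneg zero_le_power) auto
    let ?r = "\<lambda>y. ?g y - taylor_poly L ?g y"
    have "\<bar>ext ?r\<bar> \<le> B * (max 1 (?s * R) ^ Suc L * ?b)"
    proof (rule B(3))
      show "smooth ?r" by (intro smooth_diff sg smooth_taylor_poly)
      fix js :: "'s list" and x :: "real ^ 's" assume js: "length js \<le> n" and x: "x \<in> cball 0 R"
      have "\<bar>partial_derivs js ?r x\<bar> \<le> (?s * R) ^ (Suc L - length js) * ?b"
        using js L(1) by (intro taylor_remainder_bound sg B(2) gb x) auto
      also have "\<dots> \<le> max 1 (?s * R) ^ Suc L * ?b"
      proof (rule mult_right_mono[OF _ b'0])
        have "(?s * R) ^ (Suc L - length js) \<le> max 1 (?s * R) ^ (Suc L - length js)"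
          using B(2) by (intro power_mono) auto
        also have "\<dots> \<le> max 1 (?s * R) ^ Suc L" by (intro power_increasing) auto
        finally show "(?s * R) ^ (Suc L - length js) \<le> max 1 (?s * R) ^ Suc L" .
      qed
      finally show "\<bar>partial_derivs js ?r x\<bar> \<le> max 1 (?s * R) ^ Suc L * ?b" .
    qed
    moreover have "flat (Suc L) (taylor_poly L ?g)"
      unfolding flat_def by (auto simp: smooth_taylor_poly partial_derivs_taylor_poly[OF sg])
    then have "ext ?r = ext ?g" by (simp add: ext_diff[OF sg smooth_taylor_poly] ext_flat)
    moreover have "B * (max 1 (?s * R) ^ Suc L * ?b) = E * (r\<^sub>M ^ Suc L) ^ k"
    proof -
      have "(r\<^sub>M ^ k) ^ Suc L = (r\<^sub>M ^ Suc L) ^ k"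
        using power_mult[of r\<^sub>M k "Suc L"] power_mult[of r\<^sub>M "Suc L" k] by (simp only: mult.commute)
      then have "(?s * (C\<^sub>M * r\<^sub>M ^ k)) ^ Suc L = (?s * C\<^sub>M) ^ Suc L * (r\<^sub>M ^ Suc L) ^ k"
        using power_mult_distrib[of "?s * C\<^sub>M" "r\<^sub>M ^ k" "Suc L"] by (simp only: mult.assoc)
      then show ?thesis unfolding E_def by (simp only: mult_ac)
    qed
    ultimately show ?thesis by (simp add: Am_mult)
  qed
  from ext_iterate[OF sf this] have bound: "\<bar>ext f\<bar> \<le> ?W ^ k * (E * (r\<^sub>M ^ Suc L) ^ k)" for k .
  have "?W ^ k * (E * (r\<^sub>M ^ Suc L) ^ k) = E * (?W * r\<^sub>M ^ Suc L) ^ k" for k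
    by (simp only: power_mult_distrib mult_ac)
  with bound have bound: "\<bar>ext f\<bar> \<le> E * (?W * r\<^sub>M ^ Suc L) ^ k" for k by metis
  have "(\<lambda>k. E * (?W * r\<^sub>M ^ Suc L) ^ k) \<longlonglongrightarrow> E * 0"
    using L(2) W0 contraction(2) by (intro tendsto_intros LIMSEQ_realpow_zero) auto
  then have "\<bar>ext f\<bar> \<le> E * 0"
    by (rule tendsto_lowerbound) (use bound in auto)
  then show ?thesis using ext_test_fun[OF f] by simp
qed

end

section \<open>The p-radius\<close>

text \<open>
  Fekete's lemma in multiplicative form. For \<open>t\<close> above the infimum choose \<open>k\<close> with \<open>b k \<le> t\<^sup>k\<close> and divide
  \<open>n = k q + r\<close>; then \<open>b n\<close> is at most a constant times \<open>t\<^sup>n\<close>.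
\<close>
theorem submultiplicative_root_limit:
  fixes b :: "nat \<Rightarrow> real"
  assumes nonneg: "\<And>k. 0 \<le> b k" and sub: "\<And>j k. b (j + k) \<le> b j * b k"
  shows "\<exists>L\<ge>0. (\<lambda>k. b k powr (1 / real k)) \<longlonglongrightarrow> L \<and> (\<forall>k\<ge>1. L \<le> b k powr (1 / real k))"
proof -
  define L where "L = (INF k\<in>{1..}. b k powr (1 / real k))"
  have bdd: "bdd_below ((\<lambda>k. b k powr (1 / real k)) ` {1..})" by (rule bdd_belowI2[of _ 0]) simp
  have L0: "0 \<le> L" unfolding L_def by (rule cINF_greatest) auto
  have Lle: "L \<le> b k powr (1 / real k)" if "1 \<le> k" for k
    unfolding L_def using that by (intro cINF_lower bdd) auto
  have upper: "\<forall>\<^sub>F n in sequentially. b n powr (1 / real n) < u" if u: "L < u" for u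
  proof -
    obtain t where t: "L < t" "t < u" using dense[OF u] by blast
    then have t0: "0 < t" using L0 by linarith
    obtain k where k: "1 \<le> k" "b k powr (1 / real k) < t"
      using t(1) unfolding L_def by (subst (asm) cINF_less_iff[OF _ bdd]) auto
    have bk: "b k \<le> t ^ k"
    proof (cases "b k = 0")
      case False
      then have "b k = (b k powr (1 / real k)) powr real k"
        using nonneg[of k] k(1) by (simp add: powr_powr)
      also have "\<dots> \<le> t powr real k" using k(2) by (intro powr_mono2) auto
      finally show ?thesis using t0 by (simp add: powr_realpow)
    qed (use t0 in simp)
    \<comment> \<open>The summand 1 keeps \<open>K\<close> positive if all \<open>b r\<close> vanish.\<close>
    define K where "K = (\<Sum>r<k. b r / t ^ r) + 1"
    have K: "0 < K" unfolding K_def using nonneg t0 by (intro add_nonneg_pos sum_nonneg) auto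
    \<comment> \<open>The value \<open>b 0\<close> may exceed 1, so the estimate can fail for \<open>q = 0\<close>.\<close>
    have mult: "b (k * q) \<le> t ^ (k * q) \<or> q = 0" for q
    proof (induction q)
      case (Suc q)
      show ?case
      proof (cases "q = 0")
        case True
        then show ?thesis using bk by simp
      next
        case False
        have "b (k * Suc q) \<le> b k * b (k * q)" using sub[of k "k * q"] by simp
        also have "\<dots> \<le> t ^ k * t ^ (k * q)" using bk Suc False nonneg t0 by (intro mult_mono) auto
        finally show ?thesis by (simp add: power_add)
      qed
    qed simp
    have "b n \<le> t ^ n * K" if "k \<le> n" for n
    proof -
      define q r where "q = n div k" and "r = n mod k"
      have n: "n = k * q + r" and r: "r < k" using k(1) by (auto simp: q_def r_def)
      have q: "q \<noteq> 0" using that k(1) by (auto simp: q_def div_eq_0_iff)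
      have "b n \<le> b (k * q) * b r" unfolding n by (rule sub)
      also have "\<dots> \<le> t ^ (k * q) * b r" using mult[of q] q nonneg by (intro mult_right_mono) auto
      also have "\<dots> = t ^ n * (b r / t ^ r)" unfolding n using t0 by (simp add: power_add)
      also have "\<dots> \<le> t ^ n * K"
      proof (rule mult_left_mono)
        have "b r / t ^ r \<le> (\<Sum>r<k. b r / t ^ r)"
          using r nonneg t0 by (intro member_le_sum) auto
        then show "b r / t ^ r \<le> K" unfolding K_def by simp
      qed (use t0 in simp)
      finally show ?thesis .
    qed
    then have le: "b n powr (1 / real n) \<le> t * K powr (1 / real n)" if "k \<le> n" for n
    proof -
      have "b n powr (1 / real n) \<le> (t ^ n * K) powr (1 / real n)"
        using that nonneg \<open>\<And>n. k \<le> n \<Longrightarrow> b n \<le> t ^ n * K\<close> by (intro powr_mono2) auto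
      also have "\<dots> = t * K powr (1 / real n)"
        using t0 K k(1) that by (simp add: powr_mult powr_powr flip: powr_realpow)
      finally show ?thesis .
    qed
    have "(\<lambda>n. t * K powr (1 / real n)) \<longlonglongrightarrow> t * K powr 0"
      using K by (intro tendsto_intros lim_1_over_n) auto
    then have "\<forall>\<^sub>F n in sequentially. t * K powr (1 / real n) < u"
      using t K by (intro order_tendstoD(2)) auto
    with eventually_ge_at_top[of k] show ?thesis
      by eventually_elim (use le in \<open>blast intro: le_less_trans\<close>)
  qed
  have "(\<lambda>k. b k powr (1 / real k)) \<longlonglongrightarrow> L"
  proof (rule order_tendstoI)
    fix l assume "l < L"
    show "\<forall>\<^sub>F k in sequentially. l < b k powr (1 / real k)"
      using eventually_ge_at_top[of 1] by eventually_elim (use \<open>l < L\<close> Lle in \<open>blast intro: less_le_trans\<close>)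
  qed (rule upper)
  with L0 Lle show ?thesis by blast
qed

text \<open>
  A crude form of the inequality between power means: the sum is at most \<open>card I\<close> times its largest term.
\<close>
lemma sum_powr_le:
  assumes "finite I" "\<And>i. i \<in> I \<Longrightarrow> 0 \<le> t i" "0 \<le> p"
  shows "(\<Sum>i\<in>I. t i) powr p \<le> real (card I) powr p * (\<Sum>i\<in>I. t i powr p)"
proof (cases "I = {}")
  case False
  define mx where "mx = Max (t ` I)"
  have "mx \<in> t ` I" unfolding mx_def using assms(1) False by (intro Max_in) auto
  then obtain j where j: "j \<in> I" "mx = t j" by blast
  have "(\<Sum>i\<in>I. t i) \<le> real (card I) * mx"
    using assms(1) by (intro sum_bounded_above) (simp add: mx_def)
  then have "(\<Sum>i\<in>I. t i) powr p \<le> (real (card I) * mx) powr p"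
    using assms by (intro powr_mono2 sum_nonneg) auto
  also have "\<dots> = real (card I) powr p * t j powr p" using j assms(2) by (simp add: powr_mult)
  also have "\<dots> \<le> real (card I) powr p * (\<Sum>i\<in>I. t i powr p)"
    using j(1) assms(1) by (intro mult_left_mono member_le_sum) auto
  finally show ?thesis .
qed simp

lemma onorm_on_bdd:
  "bounded_linear f \<Longrightarrow> bdd_above ((\<lambda>w. norm (f w)) ` {w \<in> U. norm w \<le> 1})"
proof (rule bdd_aboveI2)
  fix w assume f: "bounded_linear f" and w: "w \<in> {w \<in> U. norm w \<le> 1}"
  have "norm (f w) \<le> onorm f * norm w" by (rule onorm[OF f])
  also have "\<dots> \<le> onorm f * 1" using w onorm_pos_le[OF f] by (intro mult_left_mono) auto
  finally show "norm (f w) \<le> onorm f" by simp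
qed

lemma onorm_on_bound:
  assumes f: "bounded_linear f" and U: "subspace U" and w: "w \<in> U"
  shows "norm (f w) \<le> onorm_on U f * norm w"
proof (cases "w = 0")
  case True
  then show ?thesis using linear_0[OF bounded_linear.linear[OF f]] by simp
next
  case False
  let ?w = "(1 / norm w) *\<^sub>R w"
  have "norm (f ?w) \<le> onorm_on U f"
    unfolding onorm_on_def using False w U
    by (intro cSUP_upper onorm_on_bdd f) (auto simp: subspace_scale)
  then show ?thesis using False linear_scale[OF bounded_linear.linear[OF f]]
    by (simp add: divide_le_eq mult.commute)
qed

lemma onorm_on_le:
  assumes "0 \<in> U" "\<And>w. w \<in> U \<Longrightarrow> norm w \<le> 1 \<Longrightarrow> norm (f w) \<le> c"
  shows "onorm_on U f \<le> c"
  unfolding onorm_on_def using assms by (intro cSUP_least) auto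

lemma onorm_on_nonneg:
  assumes "bounded_linear f" "0 \<in> U"
  shows "0 \<le> onorm_on U f"
proof -
  have "norm (f 0) \<le> onorm_on U f"
    unfolding onorm_on_def using assms by (intro cSUP_upper onorm_on_bdd) auto
  then show ?thesis using norm_ge_zero order_trans by blast
qed

lemma matrix_product_bounded_linear:
  fixes T :: "'d \<Rightarrow> real ^ 'n::finite ^ 'n"
  shows "bounded_linear (foldr (\<lambda>d w. T d *v w) ds)"
proof (induction ds)
  case Nil
  then show ?case by (simp add: bounded_linear_ident id_def)
next
  case (Cons d ds)
  from bounded_linear_compose[OF matrix_vector_mul_bounded_linear this, of "T d"]
  show ?case by simp
qed

lemma difference_space_invariant: "invariant_subspace D T (difference_space D T z)"
  unfolding difference_space_def
proof (rule hull_in)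
  show "invariant_subspace D T (\<Inter>\<S>)" if "Ball \<S> (invariant_subspace D T)" for \<S>
    using that unfolding invariant_subspace_def by (auto intro: subspace_Inter)
qed

lemma null_if_dominated:
  fixes f b :: "nat \<Rightarrow> real"
  assumes "\<And>k. 0 \<le> f k" "\<And>k. f k \<le> b k" "b \<longlonglongrightarrow> 0"
  shows "f \<longlonglongrightarrow> 0"
  by (rule tendsto_sandwich[OF _ _ tendsto_const assms(3)]) (auto simp: assms(1,2))

lemma powr_add_le:
  assumes "0 \<le> (a :: real)" "0 \<le> b" "0 \<le> p"
  shows "(a + b) powr p \<le> 2 powr p * (a powr p + b powr p)"
proof -
  have "(a + b) powr p \<le> (2 * max a b) powr p" using assms by (intro powr_mono2) auto
  also have "\<dots> = 2 powr p * max a b powr p" using assms by (simp add: powr_mult)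
  also have "\<dots> \<le> 2 powr p * (a powr p + b powr p)" by (intro mult_left_mono) (auto simp: max_def)
  finally show ?thesis .
qed

locale matrix_family =
  fixes D :: "'d set" and T :: "'d \<Rightarrow> real ^ 'n::finite ^ 'n" and U :: "(real ^ 'n) set" and p :: real
  assumes finite_D: "finite D" and D_nonempty: "D \<noteq> {}" and invariant: "invariant_subspace D T U"
    and p: "1 \<le> p"
begin

abbreviation "prodT ds w \<equiv> foldr (\<lambda>d w. T d *v w) ds w"

abbreviation "m \<equiv> real (card D)"

lemma m_pos: "0 < m" using finite_D D_nonempty by (simp add: card_gt_0_iff)

lemma U_subspace: "subspace U"
  using invariant by (simp add: invariant_subspace_def)

lemma prodT_U: "w \<in> U \<Longrightarrow> set ds \<subseteq> D \<Longrightarrow> prodT ds w \<in> U"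
  using invariant by (induction ds) (auto simp: invariant_subspace_def)

lemma foldr_comp: "foldr (\<circ>) (map (\<lambda>d w. T d *v w) ds) id = prodT ds"
  by (induction ds) auto

definition vec_mean :: "real ^ 'n \<Rightarrow> nat \<Rightarrow> real" where
  "vec_mean w k = (\<Sum>ds\<in>words D k. norm (prodT ds w) powr p) / m ^ k"

definition op_mean :: "nat \<Rightarrow> real" where
  "op_mean k = (\<Sum>ds\<in>words D k. onorm_on U (prodT ds) powr p) / m ^ k"

lemma p_radius_eq: "p_radius p D (\<lambda>d w. T d *v w) U = lim (\<lambda>k. op_mean k powr (1 / (p * real k)))"
  unfolding p_radius_def op_mean_def words_def foldr_comp ..

lemma op_mean_nonneg: "0 \<le> op_mean k"
  unfolding op_mean_def by (intro divide_nonneg_nonneg sum_nonneg) auto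

lemma U_0: "0 \<in> U" using U_subspace by (rule subspace_0)

lemma op_mean_submult: "op_mean (j + k) \<le> op_mean j * op_mean k"
proof -
  have "(\<Sum>ds\<in>words D (j + k). onorm_on U (prodT ds) powr p)
      = (\<Sum>ds\<in>words D j. \<Sum>es\<in>words D k. onorm_on U (prodT (ds @ es)) powr p)"
    by (rule sum_words_append)
  also have "\<dots> \<le> (\<Sum>ds\<in>words D j. \<Sum>es\<in>words D k. onorm_on U (prodT ds) powr p * onorm_on U (prodT es) powr p)"
  proof (intro sum_mono)
    fix ds es assume es: "es \<in> words D k"
    have "onorm_on U (prodT (ds @ es)) \<le> onorm_on U (prodT ds) * onorm_on U (prodT es)"
    proof (rule onorm_on_le[OF U_0])
      fix w assume w: "w \<in> U" "norm w \<le> 1"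
      have "norm (prodT ds (prodT es w)) \<le> onorm_on U (prodT ds) * norm (prodT es w)"
        using w es by (intro onorm_on_bound matrix_product_bounded_linear U_subspace prodT_U) (auto simp: words_def)
      also have "norm (prodT es w) \<le> onorm_on U (prodT es) * norm w"
        using w by (intro onorm_on_bound matrix_product_bounded_linear U_subspace) auto
      also have "\<dots> \<le> onorm_on U (prodT es) * 1"
        using w by (intro mult_left_mono onorm_on_nonneg matrix_product_bounded_linear U_0) auto
      finally show "norm (prodT (ds @ es) w) \<le> onorm_on U (prodT ds) * onorm_on U (prodT es)"
        by (simp add: mult_left_mono onorm_on_nonneg[OF matrix_product_bounded_linear U_0])
    qed
    then have "onorm_on U (prodT (ds @ es)) powr p \<le> (onorm_on U (prodT ds) * onorm_on U (prodT es)) powr p"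
      using p by (intro powr_mono2 onorm_on_nonneg matrix_product_bounded_linear U_0) auto
    then show "onorm_on U (prodT (ds @ es)) powr p \<le> onorm_on U (prodT ds) powr p * onorm_on U (prodT es) powr p"
      by (simp add: powr_mult onorm_on_nonneg[OF matrix_product_bounded_linear U_0])
  qed
  finally show ?thesis
    unfolding op_mean_def using m_pos
    by (simp add: sum_product[symmetric] power_add divide_right_mono)
qed

text \<open>
  The limit in the definition exists and is the infimum of the sequence. So one value below 1 suffices
  for a \<open>p\<close>-radius below 1.
\<close>
lemma p_radius_limit:
  "(\<lambda>k. op_mean k powr (1 / (p * real k))) \<longlonglongrightarrow> p_radius p D (\<lambda>d w. T d *v w) U"
  "1 \<le> k \<Longrightarrow> p_radius p D (\<lambda>d w. T d *v w) U \<le> op_mean k powr (1 / (p * real k))"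
proof -
  have "\<exists>L\<ge>0. (\<lambda>k. (op_mean k powr (1 / p)) powr (1 / real k)) \<longlonglongrightarrow> L
      \<and> (\<forall>k\<ge>1. L \<le> (op_mean k powr (1 / p)) powr (1 / real k))"
  proof (rule submultiplicative_root_limit)
    fix j k
    have "op_mean (j + k) powr (1 / p) \<le> (op_mean j * op_mean k) powr (1 / p)"
      using p by (intro powr_mono2 op_mean_submult op_mean_nonneg) auto
    then show "op_mean (j + k) powr (1 / p) \<le> op_mean j powr (1 / p) * op_mean k powr (1 / p)"
      by (simp add: powr_mult op_mean_nonneg)
  qed simp
  then obtain L where L: "(\<lambda>k. op_mean k powr (1 / (p * real k))) \<longlonglongrightarrow> L"
    "\<And>k. k \<ge> 1 \<Longrightarrow> L \<le> op_mean k powr (1 / (p * real k))"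
    by (auto simp: powr_powr)
  have "p_radius p D (\<lambda>d w. T d *v w) U = L" unfolding p_radius_eq using L(1) by (rule limI)
  with L show "(\<lambda>k. op_mean k powr (1 / (p * real k))) \<longlonglongrightarrow> p_radius p D (\<lambda>d w. T d *v w) U"
    "1 \<le> k \<Longrightarrow> p_radius p D (\<lambda>d w. T d *v w) U \<le> op_mean k powr (1 / (p * real k))" by auto
qed

lemma op_mean_geometric:
  assumes "p_radius p D (\<lambda>d w. T d *v w) U < 1"
  shows "\<exists>C r. 0 \<le> C \<and> 0 < r \<and> r < 1 \<and> (\<forall>k. op_mean k \<le> C * r ^ k)"
proof -
  obtain t where t: "max (p_radius p D (\<lambda>d w. T d *v w) U) 0 < t" "t < 1"
    using dense[of "max (p_radius p D (\<lambda>d w. T d *v w) U) 0" 1] assms by auto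
  have "\<forall>\<^sub>F k in sequentially. op_mean k powr (1 / (p * real k)) < t"
    using p_radius_limit(1) t by (intro order_tendstoD(2)) auto
  then obtain K where K: "\<And>k. K \<le> k \<Longrightarrow> op_mean k powr (1 / (p * real k)) < t"
    by (auto simp: eventually_sequentially)
  define r where "r = t powr p"
  have r: "0 < r" "r < 1" using t p powr_less_mono2[of p t 1] by (auto simp: r_def)
  define C where "C = (\<Sum>k\<le>K. op_mean k / r ^ k) + 1"
  have S0: "0 \<le> (\<Sum>k\<le>K. op_mean k / r ^ k)" using op_mean_nonneg r by (intro sum_nonneg) auto
  have "op_mean k \<le> C * r ^ k" for k
  proof (cases "k \<le> K")
    case True
    then have "op_mean k / r ^ k \<le> (\<Sum>k\<le>K. op_mean k / r ^ k)"
      using op_mean_nonneg r by (intro member_le_sum) auto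
    then have "op_mean k / r ^ k \<le> C" by (simp add: C_def)
    then show ?thesis using r by (simp add: field_simps)
  next
    case False
    have "op_mean k \<le> r ^ k"
    proof (cases "op_mean k = 0")
      case nz: False
      have "op_mean k = (op_mean k powr (1 / (p * real k))) powr (p * real k)"
        using nz False p op_mean_nonneg[of k] by (simp add: powr_powr)
      also have "\<dots> \<le> t powr (p * real k)"
        using K[of k] False p by (intro powr_mono2) auto
      also have "\<dots> = r ^ k" using r(1) by (simp add: r_def powr_powr flip: powr_realpow)
      finally show ?thesis .
    qed (use r in simp)
    also have "\<dots> \<le> C * r ^ k" using S0 r by (simp add: C_def mult_right_mono)
    finally show ?thesis .
  qed
  moreover have "0 \<le> C" using S0 by (simp add: C_def)
  ultimately show ?thesis using r by blast
qed

lemma vec_mean_nonneg: "0 \<le> vec_mean w k"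
  unfolding vec_mean_def by (intro divide_nonneg_nonneg sum_nonneg) auto

lemma vec_mean_le:
  assumes "w \<in> U"
  shows "vec_mean w k \<le> op_mean k * norm w powr p"
proof -
  have "(\<Sum>ds\<in>words D k. norm (prodT ds w) powr p) \<le> (\<Sum>ds\<in>words D k. onorm_on U (prodT ds) powr p * norm w powr p)"
  proof (rule sum_mono)
    fix ds
    have "norm (prodT ds w) powr p \<le> (onorm_on U (prodT ds) * norm w) powr p"
      using p assms by (intro powr_mono2 onorm_on_bound matrix_product_bounded_linear U_subspace) auto
    then show "norm (prodT ds w) powr p \<le> onorm_on U (prodT ds) powr p * norm w powr p"
      by (simp add: powr_mult onorm_on_nonneg[OF matrix_product_bounded_linear U_0])
  qed
  then show ?thesis
    unfolding vec_mean_def op_mean_def using m_pos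
    by (simp add: sum_distrib_right[symmetric] divide_right_mono)
qed

text \<open>
  A word applied to \<open>T e *v w\<close> is a word of length one more applied to \<open>w\<close>, so passing to \<open>T e *v w\<close>
  costs at most the factor \<open>m\<close>.
\<close>
lemma vanishing_means_invariant: "invariant_subspace D T {w. vec_mean w \<longlonglongrightarrow> 0}"
proof -
  define S where "S = {w. vec_mean w \<longlonglongrightarrow> 0}"
  have "invariant_subspace D T S"
    unfolding invariant_subspace_def subspace_def
  proof (intro conjI ballI allI)
    have lin: "linear (prodT ds)" for ds using matrix_product_bounded_linear bounded_linear.linear by blast
    have "vec_mean 0 = (\<lambda>k. 0)"
      by (rule ext) (simp add: vec_mean_def linear_0[OF lin])
    then show "0 \<in> S" by (simp add: S_def)
    fix v w assume v: "v \<in> S" and w: "w \<in> S"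
    have "vec_mean (v + w) k \<le> 2 powr p * (vec_mean v k + vec_mean w k)" for k
    proof -
      have "(\<Sum>ds\<in>words D k. norm (prodT ds (v + w)) powr p)
          \<le> (\<Sum>ds\<in>words D k. 2 powr p * (norm (prodT ds v) powr p + norm (prodT ds w) powr p))"
      proof (rule sum_mono)
        fix ds
        have "norm (prodT ds (v + w)) powr p \<le> (norm (prodT ds v) + norm (prodT ds w)) powr p"
          unfolding linear_add[OF lin] using p by (intro powr_mono2 norm_triangle_ineq) auto
        also have "\<dots> \<le> 2 powr p * (norm (prodT ds v) powr p + norm (prodT ds w) powr p)"
          using p by (intro powr_add_le) auto
        finally show "norm (prodT ds (v + w)) powr p \<le> 2 powr p * (norm (prodT ds v) powr p + norm (prodT ds w) powr p)" .
      qed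
      then have "vec_mean (v + w) k \<le> (\<Sum>ds\<in>words D k. 2 powr p * (norm (prodT ds v) powr p + norm (prodT ds w) powr p)) / m ^ k"
        unfolding vec_mean_def by (intro divide_right_mono) auto
      also have "\<dots> = 2 powr p * (vec_mean v k + vec_mean w k)"
        unfolding vec_mean_def sum_distrib_left[symmetric] sum.distrib
        by (simp only: add_divide_distrib[symmetric] times_divide_eq_right)
      finally show ?thesis .
    qed
    moreover have "(\<lambda>k. 2 powr p * (vec_mean v k + vec_mean w k)) \<longlonglongrightarrow> 2 powr p * (0 + 0)"
      using v w unfolding S_def by (intro tendsto_intros) auto
    then have "(\<lambda>k. 2 powr p * (vec_mean v k + vec_mean w k)) \<longlonglongrightarrow> 0" by simp
    ultimately have "vec_mean (v + w) \<longlonglongrightarrow> 0"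
      by (rule null_if_dominated[OF vec_mean_nonneg])
    then show "v + w \<in> S" by (simp add: S_def)
  next
    fix a :: real and w assume w: "w \<in> S"
    have lin: "linear (prodT ds)" for ds using matrix_product_bounded_linear bounded_linear.linear by blast
    have "vec_mean (a *\<^sub>R w) = (\<lambda>k. \<bar>a\<bar> powr p * vec_mean w k)"
      by (rule ext) (simp add: vec_mean_def linear_scale[OF lin] powr_mult sum_distrib_left)
    moreover have "(\<lambda>k. \<bar>a\<bar> powr p * vec_mean w k) \<longlonglongrightarrow> \<bar>a\<bar> powr p * 0"
      using w unfolding S_def by (intro tendsto_intros) auto
    ultimately show "a *\<^sub>R w \<in> S" by (simp add: S_def)
  next
    fix e w assume e: "e \<in> D" and w: "w \<in> S"
    have "vec_mean (T e *v w) k \<le> m * vec_mean w (Suc k)" for k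
    proof -
      have "(\<Sum>ds\<in>words D k. norm (prodT ds (T e *v w)) powr p)
          \<le> (\<Sum>ds\<in>words D k. \<Sum>d\<in>D. norm (prodT (ds @ [d]) w) powr p)"
      proof (rule sum_mono)
        fix ds
        show "norm (prodT ds (T e *v w)) powr p \<le> (\<Sum>d\<in>D. norm (prodT (ds @ [d]) w) powr p)"
          using member_le_sum[of e D "\<lambda>d. norm (prodT (ds @ [d]) w) powr p"] e finite_D by simp
      qed
      also have "\<dots> = (\<Sum>ds\<in>words D (Suc k). norm (prodT ds w) powr p)" by (rule sum_words_snoc[symmetric])
      finally have "vec_mean (T e *v w) k \<le> (\<Sum>ds\<in>words D (Suc k). norm (prodT ds w) powr p) / m ^ k"
        unfolding vec_mean_def by (intro divide_right_mono) auto
      also have "\<dots> = m * vec_mean w (Suc k)" unfolding vec_mean_def using m_pos by simp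
      finally show ?thesis .
    qed
    moreover have "(\<lambda>k. m * vec_mean w (Suc k)) \<longlonglongrightarrow> m * 0"
      using w unfolding S_def by (intro tendsto_intros LIMSEQ_Suc) auto
    then have "(\<lambda>k. m * vec_mean w (Suc k)) \<longlonglongrightarrow> 0" by simp
    ultimately have "vec_mean (T e *v w) \<longlonglongrightarrow> 0"
      by (rule null_if_dominated[OF vec_mean_nonneg])
    then show "T e *v w \<in> S" by (simp add: S_def)
  qed
  then show ?thesis by (simp add: S_def)
qed

text \<open>
  On an orthonormal basis of \<open>U\<close> the operator norm is at most the sum of the norms of the images of the
  basis vectors. Thus the means of the operator norms tend to 0 along with those of the single vectors.
\<close>
lemma p_radius_less_1:
  assumes "\<And>w. w \<in> U \<Longrightarrow> vec_mean w \<longlonglongrightarrow> 0"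
  shows "p_radius p D (\<lambda>d w. T d *v w) U < 1"
proof -
  obtain B where B: "B \<subseteq> U" "pairwise orthogonal B" "\<And>x. x \<in> B \<Longrightarrow> norm x = 1" "independent B" "span B = U"
    using orthonormal_basis_subspace[OF U_subspace] by metis
  have finB: "finite B" using B(4) independent_imp_finite by blast
  have le: "op_mean k \<le> real (card B) powr p * (\<Sum>b\<in>B. vec_mean b k)" for k
  proof -
    have "onorm_on U (prodT ds) powr p \<le> real (card B) powr p * (\<Sum>b\<in>B. norm (prodT ds b) powr p)" for ds
    proof -
      have "onorm_on U (prodT ds) \<le> (\<Sum>b\<in>B. norm (prodT ds b))"
      proof (rule onorm_on_le[OF U_0])
        fix w assume w: "w \<in> U" "norm w \<le> 1"
        have lin: "linear (prodT ds)" using matrix_product_bounded_linear bounded_linear.linear by blast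
        have "w = (\<Sum>b\<in>B. (w \<bullet> b) *\<^sub>R b)"
          using orthonormal_basis_expand[OF B(2,3) _ finB, of w] w(1) B(5) by simp
        then have "prodT ds w = prodT ds (\<Sum>b\<in>B. (w \<bullet> b) *\<^sub>R b)" by simp
        also have "\<dots> = (\<Sum>b\<in>B. (w \<bullet> b) *\<^sub>R prodT ds b)"
          by (simp add: linear_sum[OF lin] linear_scale[OF lin])
        finally have "norm (prodT ds w) \<le> (\<Sum>b\<in>B. norm ((w \<bullet> b) *\<^sub>R prodT ds b))" by (metis norm_sum)
        also have "\<dots> \<le> (\<Sum>b\<in>B. norm (prodT ds b))"
        proof (rule sum_mono)
          fix b assume "b \<in> B"
          then have "\<bar>w \<bullet> b\<bar> \<le> 1" using Cauchy_Schwarz_ineq2[of w b] B(3) w(2) by simp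
          then show "norm ((w \<bullet> b) *\<^sub>R prodT ds b) \<le> norm (prodT ds b)"
            by (simp add: mult_left_le_one_le)
        qed
        finally show "norm (prodT ds w) \<le> (\<Sum>b\<in>B. norm (prodT ds b))" .
      qed
      then have "onorm_on U (prodT ds) powr p \<le> (\<Sum>b\<in>B. norm (prodT ds b)) powr p"
        using p by (intro powr_mono2 onorm_on_nonneg matrix_product_bounded_linear U_0) auto
      also have "\<dots> \<le> real (card B) powr p * (\<Sum>b\<in>B. norm (prodT ds b) powr p)"
        using p finB by (intro sum_powr_le) auto
      finally show ?thesis .
    qed
    then have "(\<Sum>ds\<in>words D k. onorm_on U (prodT ds) powr p)
        \<le> (\<Sum>ds\<in>words D k. real (card B) powr p * (\<Sum>b\<in>B. norm (prodT ds b) powr p))"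
      by (intro sum_mono)
    also have "\<dots> = real (card B) powr p * (\<Sum>b\<in>B. \<Sum>ds\<in>words D k. norm (prodT ds b) powr p)"
      by (simp add: sum_distrib_left[symmetric] sum.swap[of _ B])
    finally have "op_mean k \<le> real (card B) powr p * (\<Sum>b\<in>B. \<Sum>ds\<in>words D k. norm (prodT ds b) powr p) / m ^ k"
      unfolding op_mean_def using m_pos by (intro divide_right_mono) auto
    then show ?thesis by (simp add: vec_mean_def sum_divide_distrib[symmetric])
  qed
  have "(\<lambda>k. real (card B) powr p * (\<Sum>b\<in>B. vec_mean b k)) \<longlonglongrightarrow> real (card B) powr p * (\<Sum>b\<in>B. 0)"
    using assms B(1) by (intro tendsto_intros) auto
  then have "\<forall>\<^sub>F k in sequentially. real (card B) powr p * (\<Sum>b\<in>B. vec_mean b k) < 1"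
    by (intro order_tendstoD(2)) auto
  with eventually_ge_at_top[of 1] have "\<forall>\<^sub>F k in sequentially. 1 \<le> k \<and> op_mean k < 1"
    by eventually_elim (use le in \<open>auto intro: le_less_trans\<close>)
  then obtain k where k: "1 \<le> k" "op_mean k < 1" using eventually_happens by force
  have "p_radius p D (\<lambda>d w. T d *v w) U \<le> op_mean k powr (1 / (p * real k))" by (rule p_radius_limit(2)[OF k(1)])
  also have "\<dots> < 1"
    using k p powr_less_mono2[of "1 / (p * real k)" "op_mean k" 1] op_mean_nonneg[of k] by simp
  finally show ?thesis .
qed

end

section \<open>The index set of the transition matrices\<close>

lemma int_matrix_neg: "(M :: int ^ 's::finite ^ 's) *v (- l) = - (M *v l)"
  by (simp add: matrix_vector_mult_def vec_eq_iff sum_negf)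

lemma not_AE_False: "\<not> (AE x :: real ^ 's::finite in lborel. False)"
  by (simp add: AE_iff_null null_sets_def)

locale refinement_mask = lattice_tile M D for M :: "int ^ 's::finite ^ 's" and D +
  fixes c :: "int ^ 's \<Rightarrow> real" and \<omega> :: "'n::finite \<Rightarrow> int ^ 's"
  assumes finite_mask: "finite {k. c k \<noteq> 0}"
    and sum_rule: "\<And>d. d \<in> D \<Longrightarrow> (\<Sum>k | c (M *v k - d) \<noteq> 0. c (M *v k - d)) = 1"
    and inj_\<omega>: "inj \<omega>"
    and cover: "minimal_cover (range \<omega>) (digit_expansions M {k. c k \<noteq> 0}) (digit_expansions M D)"
begin

abbreviation "\<Gamma> \<equiv> {k. c k \<noteq> 0}"
abbreviation "K \<equiv> digit_expansions M \<Gamma>"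
abbreviation "T \<equiv> transition_matrix M c \<omega>"

lemma T_entry: "T d $ a $ b = c (M *v \<omega> a - \<omega> b + d)"
  by (simp add: transition_matrix_def)

lemma M_injective: "M *v k = M *v l \<Longrightarrow> k = l"
proof -
  assume "M *v k = M *v l"
  then have "A *v (real_mat M *v real_vec k) = A *v (real_mat M *v real_vec l)"
    by (simp only: real_vec_mult[symmetric])
  then have "real_vec k = real_vec l" by simp
  then show ?thesis by (rule injD[OF inj_real_vec])
qed

text \<open>
  The sum rule for the digit \<open>d\<close> can only hold if the mask is nonzero somewhere on the residue class of
  \<open>- d\<close>.
\<close>
lemma mask_residues: "\<exists>j\<in>\<Gamma>. \<exists>l. k - j = M *v l"
proof -
  obtain d l where d: "d \<in> D" "- k = d + M *v l" using residueE by blast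
  have "{k. c (M *v k - d) \<noteq> 0} \<noteq> {}"
  proof
    assume "{k. c (M *v k - d) \<noteq> 0} = {}"
    with sum_rule[OF d(1)] show False by (simp only: sum.empty)
  qed
  then obtain k' where k': "c (M *v k' - d) \<noteq> 0" by blast
  have "k - (M *v k' - d) = M *v (- l - k')"
  proof -
    have "k = - (d + M *v l)" using d(2) by (metis minus_minus)
    then show ?thesis by (simp add: matrix_vector_mult_diff_distrib int_matrix_neg)
  qed
  with k' show ?thesis by blast
qed

text \<open>
  The classes \<open>M k - d\<close> with \<open>d \<in> D\<close> partition the lattice.
\<close>
lemma sum_mask: "(\<Sum>k\<in>\<Gamma>. c k) = m"
proof -
  let ?S = "\<lambda>d. {k. c (M *v k - d) \<noteq> 0}"
  let ?f = "\<lambda>(d, k). M *v k - d"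
  have fin: "finite (?S d)" for d
  proof -
    have "?S d = (\<lambda>k. M *v k - d) -` \<Gamma>" by auto
    moreover have "inj (\<lambda>k. M *v k - d)" by (rule injI) (simp add: M_injective)
    ultimately show ?thesis using finite_mask by (simp only: finite_vimageI)
  qed
  have inj: "inj_on ?f (Sigma D ?S)"
  proof (rule inj_onI, clarify)
    fix d k d' k' assume "d \<in> D" "d' \<in> D" and eq: "M *v k - d = M *v k' - d'"
    have "d' - d = M *v (k' - k)"
      using eq by (simp add: matrix_vector_mult_diff_distrib algebra_simps)
    then have "d' = d" using digit_unique \<open>d \<in> D\<close> \<open>d' \<in> D\<close> by blast
    with eq have "M *v k = M *v k'" by simp
    then show "d = d' \<and> k = k'" using M_injective \<open>d' = d\<close> by blast
  qed
  have "?f ` Sigma D ?S = \<Gamma>"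
  proof (intro equalityI subsetI)
    fix k assume k: "k \<in> \<Gamma>"
    obtain d l where d: "d \<in> D" "- k = d + M *v l" using residueE by blast
    have "k = M *v (- l) - d"
    proof -
      have "k = - (d + M *v l)" using d(2) by (metis minus_minus)
      then show ?thesis by (simp add: int_matrix_neg)
    qed
    with k d(1) show "k \<in> ?f ` Sigma D ?S" by (intro image_eqI[of _ _ "(d, - l)"]) auto
  qed auto
  then have "(\<Sum>k\<in>\<Gamma>. c k) = (\<Sum>x\<in>Sigma D ?S. c (?f x))"
    using sum.reindex[OF inj, of c] by simp
  also have "\<dots> = (\<Sum>d\<in>D. \<Sum>k\<in>?S d. c (M *v k - d))"
    by (subst sum.Sigma) (auto simp: finite_D fin case_prod_unfold)
  also have "\<dots> = (\<Sum>d\<in>D. 1)" by (intro sum.cong refl sum_rule)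
  finally show ?thesis by simp
qed

lemma K_not_null: "\<not> (AE x in lborel. x \<notin> K)"
proof
  assume "AE x in lborel. x \<notin> K"
  then have "AE x in lborel. \<forall>l :: int ^ 's. x + - real_vec l \<notin> K"
    unfolding AE_all_countable by (intro allI AE_translate)
  then have "AE x :: real ^ 's in lborel. False"
  proof eventually_elim
    case (elim x)
    then show ?case using expansions_cover[OF finite_mask mask_residues, of x] by simp
  qed
  then show False using not_AE_False by blast
qed

lemma K_word:
  assumes "x \<in> K"
  shows "\<exists>js y. set js \<subseteq> \<Gamma> \<and> length js = n \<and> y \<in> K \<and> x = branches js y"
proof (induction n)
  case 0
  then show ?case using assms by (intro exI[of _ "[]"] exI[of _ x]) simp
next
  case (Suc n)
  then obtain js y where js: "set js \<subseteq> \<Gamma>" "length js = n" "y \<in> K" "x = branches js y" by blast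
  obtain k where k: "k \<in> \<Gamma>" "real_mat M *v y - real_vec k \<in> K" using expansions_backward[OF js(3)] by blast
  have "x = branches (js @ [k]) (real_mat M *v y - real_vec k)"
    using js(4) by (simp add: branch_inverse)
  with js k show ?case by (intro exI[of _ "js @ [k]"] exI[of _ "real_mat M *v y - real_vec k"]) simp
qed

lemma branches_mem_K: "y \<in> K \<Longrightarrow> set js \<subseteq> \<Gamma> \<Longrightarrow> branches js y \<in> K"
  by (induction js) (auto intro: branch_expansions)

text \<open>
  Every neighbourhood of \<open>x\<close> contains a contracted copy of \<open>K\<close>, and \<open>K\<close> is not a null set because its
  lattice translates cover the space.
\<close>
lemma K_locally_not_null:
  assumes x: "x \<in> K" and e: "0 < e"
  shows "\<not> (AE y in lborel. y \<notin> K \<inter> ball x e)"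
proof
  assume *: "AE y in lborel. y \<notin> K \<inter> ball x e"
  obtain B where B: "\<And>y. y \<in> K \<Longrightarrow> norm y \<le> B"
    using bounded_expansions[OF finite_mask] unfolding bounded_iff by blast
  have "(\<lambda>n. C\<^sub>M * r\<^sub>M ^ n * (2 * B)) \<longlonglongrightarrow> C\<^sub>M * 0 * (2 * B)"
    using contraction by (intro tendsto_intros LIMSEQ_realpow_zero) auto
  then have "\<forall>\<^sub>F n in sequentially. C\<^sub>M * r\<^sub>M ^ n * (2 * B) < e"
    using e by (intro order_tendstoD(2)) auto
  then obtain n where n: "C\<^sub>M * r\<^sub>M ^ n * (2 * B) < e" using eventually_happens by force
  obtain js y where js: "set js \<subseteq> \<Gamma>" "length js = n" "y \<in> K" "x = branches js y" using K_word[OF x] by blast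
  have "branches js y' \<in> K \<inter> ball x e" if y': "y' \<in> K" for y'
  proof -
    have "norm (y - y') \<le> 2 * B" using norm_triangle_ineq4[of y y'] B[OF js(3)] B[OF y'] by linarith
    then have "dist x (branches js y') \<le> C\<^sub>M * r\<^sub>M ^ n * (2 * B)"
      unfolding js(4) dist_norm branches_diff js(2) by (rule apow_bound)
    with n branches_mem_K[OF y' js(1)] show ?thesis by simp
  qed
  moreover have "AE y' in lborel. branches js y' \<notin> K \<inter> ball x e" by (rule AE_branches[OF *])
  ultimately have "AE y' in lborel. y' \<notin> K" by (auto elim!: eventually_mono)
  then show False using K_not_null by blast
qed

abbreviation "\<Omega> \<equiv> range \<omega>"

lemma K_subset: "K \<subseteq> shifted_by \<Omega> G"
  using cover by (simp add: minimal_cover_def)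

lemma shifted_by_iff: "x \<in> shifted_by S G \<longleftrightarrow> (\<exists>k\<in>S. x - real_vec k \<in> G)"
proof
  assume "\<exists>k\<in>S. x - real_vec k \<in> G"
  then obtain k where k: "k \<in> S" "x - real_vec k \<in> G" by blast
  then have "x = real_vec k + (x - real_vec k) \<and> k \<in> S \<and> x - real_vec k \<in> G" by simp
  then show "x \<in> shifted_by S G" unfolding shifted_by_def by blast
next
  assume "x \<in> shifted_by S G"
  then obtain k y where k: "k \<in> S" "y \<in> G" "x = real_vec k + y" unfolding shifted_by_def by blast
  then have "x - real_vec k \<in> G" by simp
  with k(1) show "\<exists>k\<in>S. x - real_vec k \<in> G" by blast
qed

lemma AE_unique_tile: "AE y in lborel. y \<in> G \<longrightarrow> (\<forall>l k. y + real_vec l - real_vec k \<in> G \<longrightarrow> k = l)"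
  using tiling
proof eventually_elim
  case (elim y)
  show ?case
  proof (intro impI allI)
    fix l k assume y: "y \<in> G" "y + real_vec l - real_vec k \<in> G"
    then have "y - real_vec 0 \<in> G" "y - real_vec (k - l) \<in> G" by (simp_all add: real_vec_simps algebra_simps)
    with elim have "k - l = 0" by blast
    then show "k = l" by simp
  qed
qed

text \<open>
  Minimality yields a point \<open>x\<close> of \<open>K\<close> outside the compact union of the other tiles. Near \<open>x\<close> the set \<open>K\<close> is
  covered by the tile of \<open>l\<close> alone, and it has positive measure there.
\<close>
lemma tile_meets_K_if_index:
  assumes l: "l \<in> \<Omega>"
  shows "\<not> (AE y in lborel. \<not> (y \<in> G \<and> y + real_vec l \<in> K))"
proof
  assume null: "AE y in lborel. \<not> (y \<in> G \<and> y + real_vec l \<in> K)"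
  have "\<not> K \<subseteq> shifted_by (\<Omega> - {l}) G"
    using cover l unfolding minimal_cover_def by blast
  then obtain x where x: "x \<in> K" "x \<notin> shifted_by (\<Omega> - {l}) G" by blast
  have "shifted_by (\<Omega> - {l}) G = (\<Union>k\<in>\<Omega> - {l}. (\<lambda>x. real_vec k + x) ` G)"
    unfolding shifted_by_def by auto
  then have "closed (shifted_by (\<Omega> - {l}) G)"
    by (simp only:) (intro closed_UN ballI compact_imp_closed compact_translation compact_G finite_Diff finite_imageI finite_UNIV finite)
  then obtain e where e: "0 < e" "ball x e \<subseteq> - shifted_by (\<Omega> - {l}) G"
    using x(2) open_contains_ball[of "- shifted_by (\<Omega> - {l}) G"] by auto
  have "AE y in lborel. \<not> (y + - real_vec l \<in> G \<and> y + - real_vec l + real_vec l \<in> K)"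
    by (rule AE_translate[OF null])
  then have "AE y in lborel. y \<notin> K \<inter> ball x e"
  proof eventually_elim
    case (elim y)
    show ?case
    proof
      assume y: "y \<in> K \<inter> ball x e"
      then obtain k where "k \<in> \<Omega>" "y - real_vec k \<in> G" using K_subset shifted_by_iff by blast
      moreover have "y \<notin> shifted_by (\<Omega> - {l}) G" using y e(2) by blast
      ultimately have "y - real_vec l \<in> G" using shifted_by_iff by (metis DiffI singletonD)
      with elim y show False by simp
    qed
  qed
  then show False using K_locally_not_null[OF x(1) e(1)] by blast
qed

text \<open>
  Almost every point of \<open>l + G\<close> lies in no other tile, while \<open>K\<close> is covered by the tiles with index in \<open>\<Omega>\<close>.
\<close>
lemma index_if_tile_meets_K:
  assumes "\<not> (AE y in lborel. \<not> (y \<in> G \<and> y + real_vec l \<in> K))"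
  shows "l \<in> \<Omega>"
proof (rule ccontr)
  assume l: "l \<notin> \<Omega>"
  have "AE y in lborel. \<not> (y \<in> G \<and> y + real_vec l \<in> K)"
    using AE_unique_tile
  proof eventually_elim
    case (elim y)
    show ?case
    proof
      assume y: "y \<in> G \<and> y + real_vec l \<in> K"
      then obtain k where "k \<in> \<Omega>" "y + real_vec l - real_vec k \<in> G" using K_subset shifted_by_iff by blast
      with elim y l show False by blast
    qed
  qed
  with assms show False by blast
qed

text \<open>
  If \<open>l + G\<close> meets \<open>K\<close> in positive measure, then so does \<open>k + G\<close> for every \<open>k\<close> with
  \<open>c (M k - l + d) \<noteq> 0\<close>, because the branch of this nonzero entry maps \<open>K\<close> into itself. Hence no
  nonzero entry of the mask is cut off when the refinement equation is restricted to \<open>\<Omega>\<close>.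
\<close>
lemma index_closed:
  assumes l: "l \<in> \<Omega>" and d: "d \<in> D" and nz: "c (M *v k - l + d) \<noteq> 0"
  shows "k \<in> \<Omega>"
proof (rule index_if_tile_meets_K, rule notI)
  assume "AE y in lborel. \<not> (y \<in> G \<and> y + real_vec k \<in> K)"
  from AE_branch[OF this, of d]
  have "AE y in lborel. \<not> (y \<in> G \<and> y + real_vec l \<in> K)"
  proof eventually_elim
    case (elim y)
    show ?case
    proof
      assume y: "y \<in> G \<and> y + real_vec l \<in> K"
      have "branch M d y + real_vec k = branch M (M *v k - l + d) (y + real_vec l)"
        unfolding branch_add_lattice by (simp add: branch_def real_vec_simps algebra_simps)
      also have "\<dots> \<in> K" using y nz by (intro branch_expansions) auto
      finally show False using elim branch_expansions[of y D d] y d by blast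
    qed
  qed
  then show False using tile_meets_K_if_index[OF l] by blast
qed

end

section \<open>Refinement equations on the tile\<close>

context refinement_mask
begin

definition samples :: "(real ^ 's \<Rightarrow> real) \<Rightarrow> real ^ 's \<Rightarrow> real ^ 'n" where
  "samples f y = (\<chi> a. f (y + real_vec (\<omega> a)))"

definition refinement :: "(real ^ 's \<Rightarrow> real) \<Rightarrow> real ^ 's \<Rightarrow> real" where
  "refinement f x = (\<Sum>k\<in>\<Gamma>. c k * f (real_mat M *v x - real_vec k))"

definition vanishes_off_\<Omega> :: "(real ^ 's \<Rightarrow> real) \<Rightarrow> bool" where
  "vanishes_off_\<Omega> f \<longleftrightarrow> (AE y in lborel. y \<in> G \<longrightarrow> (\<forall>l. l \<notin> \<Omega> \<longrightarrow> f (y + real_vec l) = 0))"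

text \<open>
  Turns the sum over the mask of the refinement equation into a row of a transition matrix.
\<close>
lemma mask_convolution:
  assumes g: "\<And>l. l \<notin> \<Omega> \<Longrightarrow> g l = 0"
  shows "(\<Sum>k\<in>\<Gamma>. c k * g (e - k)) = (\<Sum>b\<in>UNIV. c (e - \<omega> b) * g (\<omega> b) :: real)"
proof -
  let ?W = "\<Omega> \<union> (\<lambda>k. e - k) ` \<Gamma>"
  have fin: "finite ?W" using finite_mask by simp
  have "(\<Sum>b\<in>UNIV. c (e - \<omega> b) * g (\<omega> b)) = (\<Sum>l\<in>\<Omega>. c (e - l) * g l)"
    by (simp add: sum.reindex[OF inj_\<omega>])
  also have "\<dots> = (\<Sum>l\<in>?W. c (e - l) * g l)"
    by (rule sum.mono_neutral_left[OF fin]) (auto simp: g)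
  also have "\<dots> = (\<Sum>l\<in>(\<lambda>k. e - k) ` \<Gamma>. c (e - l) * g l)"
  proof (rule sum.mono_neutral_right[OF fin])
    show "\<forall>l\<in>?W - (\<lambda>k. e - k) ` \<Gamma>. c (e - l) * g l = 0"
    proof
      fix l assume l: "l \<in> ?W - (\<lambda>k. e - k) ` \<Gamma>"
      have "e - l \<notin> \<Gamma>"
      proof
        assume "e - l \<in> \<Gamma>"
        then have "e - (e - l) \<in> (\<lambda>k. e - k) ` \<Gamma>" by (rule imageI)
        with l show False by simp
      qed
      then show "c (e - l) * g l = 0" by simp
    qed
  qed simp
  also have "\<dots> = (\<Sum>k\<in>\<Gamma>. c k * g (e - k))"
    by (subst sum.reindex) (auto simp: inj_on_def)
  finally show ?thesis by simp
qed

lemma dilate_branch: "real_mat M *v (branch M d y + real_vec l) - real_vec k = y + real_vec (M *v l + d - k)"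
  by (simp add: branch_def matrix_vector_right_distrib real_vec_simps real_vec_mult)

text \<open>
  On the piece of \<open>G\<close> with first digit \<open>d\<close>, the refinement equation relates the values on all lattice
  translates at once. The formula holds for every \<open>l\<close>; the \<open>l\<close> in \<open>\<Omega>\<close> give the transition matrices, the
  others show that no values off \<open>\<Omega>\<close> arise.
\<close>
lemma refinement_on_branch:
  assumes f: "vanishes_off_\<Omega> f" and eq: "AE x in lborel. g x = refinement f x"
  shows "AE y in lborel. y \<in> G \<longrightarrow> (\<forall>l. g (branch M d y + real_vec l) =
    (\<Sum>b\<in>UNIV. c (M *v l + d - \<omega> b) * f (y + real_vec (\<omega> b))))"
proof -
  have "AE x in lborel. \<forall>l :: int ^ 's. g (x + real_vec l) = refinement f (x + real_vec l)"
    unfolding AE_all_countable by (intro allI AE_translate[OF eq])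
  from AE_branch[OF this, of d] f[unfolded vanishes_off_\<Omega>_def] show ?thesis
  proof eventually_elim
    case (elim y)
    show ?case
    proof (intro impI allI)
      fix l assume y: "y \<in> G"
      have "g (branch M d y + real_vec l) = (\<Sum>k\<in>\<Gamma>. c k * f (y + real_vec (M *v l + d - k)))"
        using elim(1) by (simp only: refinement_def dilate_branch)
      also have "\<dots> = (\<Sum>b\<in>UNIV. c (M *v l + d - \<omega> b) * f (y + real_vec (\<omega> b)))"
        using elim(2) y by (intro mask_convolution[where g = "\<lambda>l. f (y + real_vec l)"]) blast
      finally show "g (branch M d y + real_vec l) = (\<Sum>b\<in>UNIV. c (M *v l + d - \<omega> b) * f (y + real_vec (\<omega> b)))" .
    qed
  qed
qed

lemma samples_branch:
  assumes "vanishes_off_\<Omega> f" "AE x in lborel. g x = refinement f x"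
  shows "AE y in lborel. y \<in> G \<longrightarrow> samples g (branch M d y) = T d *v samples f y"
  using refinement_on_branch[OF assms, of d]
proof eventually_elim
  case (elim y)
  then show ?case
    by (auto simp: samples_def vec_eq_iff matrix_vector_mult_def T_entry algebra_simps)
qed

text \<open>
  The pieces of the tile cover it, and the branches map null sets to null sets.
\<close>
lemma AE_G_from_branches:
  assumes "\<And>d. d \<in> D \<Longrightarrow> AE y in lborel. y \<in> G \<longrightarrow> P (branch M d y)"
  shows "AE x in lborel. x \<in> G \<longrightarrow> P x"
proof -
  have "AE x in lborel. \<forall>d\<in>D. real_mat M *v x - real_vec d \<in> G \<longrightarrow> P x"
  proof (rule AE_finite_allI[OF finite_D])
    fix d assume "d \<in> D"
    from AE_dilate[OF assms[OF this], of d]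
    show "AE x in lborel. real_mat M *v x - real_vec d \<in> G \<longrightarrow> P x" by (simp add: branch_inverse)
  qed
  then show ?thesis
  proof eventually_elim
    case (elim x)
    then show ?case using G_iff[of x] by blast
  qed
qed

lemma vanishes_off_\<Omega>_refinement:
  assumes f: "vanishes_off_\<Omega> f" and eq: "AE x in lborel. g x = refinement f x"
  shows "vanishes_off_\<Omega> g"
  unfolding vanishes_off_\<Omega>_def
proof (rule AE_G_from_branches)
  fix d assume d: "d \<in> D"
  show "AE y in lborel. y \<in> G \<longrightarrow> (\<forall>l. l \<notin> \<Omega> \<longrightarrow> g (branch M d y + real_vec l) = 0)"
    using refinement_on_branch[OF f eq, of d]
  proof eventually_elim
    case (elim y)
    show ?case
    proof (intro impI allI)
      fix l assume y: "y \<in> G" and l: "l \<notin> \<Omega>"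
      have "c (M *v l + d - \<omega> b) = 0" for b
        using index_closed[of "\<omega> b" d l] d l by (auto simp: algebra_simps)
      then show "g (branch M d y + real_vec l) = 0" using elim y by simp
    qed
  qed
qed

lemma samples_measurable [measurable]:
  "f \<in> borel_measurable borel \<Longrightarrow> (\<lambda>y. samples f y $ a) \<in> borel_measurable borel"
  unfolding samples_def by simp

text \<open>
  Cut the space into the translates of \<open>G\<close>; only those with index in \<open>\<Omega>\<close> contribute.
\<close>
lemma nn_integral_samples:
  assumes f: "vanishes_off_\<Omega> f" and h: "h 0 = 0" and [measurable]: "f \<in> borel_measurable borel" "h \<in> borel_measurable borel"
  shows "(\<integral>\<^sup>+x. h (f x) \<partial>lborel) = (\<Sum>a\<in>UNIV. \<integral>\<^sup>+y\<in>G. h (samples f y $ a) \<partial>lborel)"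
proof -
  let ?I = "\<lambda>l. \<integral>\<^sup>+y\<in>G. h (f (y + real_vec l)) \<partial>lborel"
  have 0: "?I l = 0" if "l \<notin> \<Omega>" for l
  proof -
    have "AE y in lborel. h (f (y + real_vec l)) * indicator G y = 0"
      using f[unfolded vanishes_off_\<Omega>_def] by eventually_elim (use that h in \<open>auto simp: indicator_def\<close>)
    then show ?thesis by (subst nn_integral_0_iff_AE) auto
  qed
  have "(\<integral>\<^sup>+x. h (f x) \<partial>lborel) = (\<integral>\<^sup>+l. ?I l \<partial>count_space UNIV)"
    by (rule nn_integral_lattice) measurable
  also have "\<dots> = (\<integral>\<^sup>+l. ?I l * indicator \<Omega> l \<partial>count_space UNIV)"
    by (rule nn_integral_cong) (simp add: 0 split: split_indicator)
  also have "\<dots> = (\<Sum>l\<in>\<Omega>. ?I l)"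
    by (simp add: nn_integral_count_space_indicator[symmetric] nn_integral_count_space_finite)
  also have "\<dots> = (\<Sum>a\<in>UNIV. \<integral>\<^sup>+y\<in>G. h (samples f y $ a) \<partial>lborel)"
    by (simp add: sum.reindex[OF inj_\<omega>] samples_def)
  finally show ?thesis .
qed

text \<open>
  The radius depends on \<open>\<Omega>\<close> and \<open>G\<close> only, and so is the same for all steps of the cascade.
\<close>
lemma vanishes_outside_ball:
  "\<exists>R. \<forall>f. vanishes_off_\<Omega> f \<longrightarrow> (AE x in lborel. x \<notin> cball 0 R \<longrightarrow> f x = 0)"
proof -
  obtain B where B: "\<And>y. y \<in> G \<Longrightarrow> norm y \<le> B"
    using compact_imp_bounded[OF compact_G] unfolding bounded_iff by blast
  let ?R = "B + (\<Sum>a\<in>UNIV. norm (real_vec (\<omega> a)))"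
  have "AE x in lborel. x \<notin> cball 0 ?R \<longrightarrow> f x = 0" if "vanishes_off_\<Omega> f" for f
  proof -
    have "AE x in lborel. \<forall>k :: int ^ 's. x + - real_vec k \<in> G \<longrightarrow> (\<forall>l. l \<notin> \<Omega> \<longrightarrow> f (x + - real_vec k + real_vec l) = 0)"
      using that unfolding vanishes_off_\<Omega>_def AE_all_countable by (intro allI AE_translate)
    then show ?thesis
    proof eventually_elim
      case (elim x)
      show ?case
      proof (rule impI, rule ccontr)
        assume x: "x \<notin> cball 0 ?R" "f x \<noteq> 0"
        obtain k where k: "x - real_vec k \<in> G" using G_cover by blast
        then have "k \<in> \<Omega>" using elim[rule_format, of k k] x(2) by auto
        then obtain a where a: "k = \<omega> a" by blast
        have "norm x \<le> norm (x - real_vec k) + norm (real_vec k)"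
          using norm_triangle_ineq[of "x - real_vec k" "real_vec k"] by simp
        also have "norm (real_vec k) \<le> (\<Sum>a\<in>UNIV. norm (real_vec (\<omega> a)))"
          unfolding a by (rule member_le_sum) auto
        finally show False using B[OF k] x(1) by simp
      qed
    qed
  qed
  then show ?thesis by blast
qed

section \<open>The cascade algorithm\<close>

text \<open>
  The iteration starts with the function that has the constant vector of samples \<open>z\<close> on the tile.
\<close>
fun cascade :: "real ^ 'n \<Rightarrow> nat \<Rightarrow> real ^ 's \<Rightarrow> real" where
  "cascade z 0 = (\<lambda>x. \<Sum>a\<in>UNIV. z $ a * indicator G (x - real_vec (\<omega> a)))"
| "cascade z (Suc n) = refinement (cascade z n)"

definition cascade_step :: "real ^ 'n \<Rightarrow> nat \<Rightarrow> real ^ 's \<Rightarrow> real" where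
  "cascade_step z n x = cascade z (Suc n) x - cascade z n x"

lemma refinement_measurable [measurable]:
  "f \<in> borel_measurable borel \<Longrightarrow> refinement f \<in> borel_measurable borel"
  unfolding refinement_def
  by (intro borel_measurable_sum borel_measurable_times borel_measurable_const
      measurable_compose[OF dilate_measurable]) auto

lemma cascade_measurable [measurable]: "cascade z n \<in> borel_measurable borel"
proof (induction n)
  case 0
  show ?case unfolding cascade.simps by measurable
qed (simp add: refinement_measurable)

lemma cascade_step_measurable [measurable]: "cascade_step z n \<in> borel_measurable borel"
  unfolding cascade_step_def by measurable

lemma cascade_step_Suc: "cascade_step z (Suc n) = refinement (cascade_step z n)"
  by (rule ext) (simp add: cascade_step_def refinement_def sum_subtractf right_diff_distrib)

lemma cascade_0_samples:
  "AE y in lborel. y \<in> G \<longrightarrow> samples (cascade z 0) y = z \<and> (\<forall>l. l \<notin> \<Omega> \<longrightarrow> cascade z 0 (y + real_vec l) = 0)"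
  using AE_unique_tile
proof eventually_elim
  case (elim y)
  show ?case
  proof
    assume y: "y \<in> G"
    have ind: "indicator G (y + real_vec l - real_vec (\<omega> a)) = (if \<omega> a = l then 1 else 0 :: real)" for l a
      using elim y by (auto simp: indicator_def)
    have eq: "cascade z 0 (y + real_vec l) = (\<Sum>a\<in>UNIV. if \<omega> a = l then z $ a else 0)" for l
      unfolding cascade.simps ind by (intro sum.cong refl) simp
    have "cascade z 0 (y + real_vec (\<omega> b)) = z $ b" for b
      unfolding eq by (simp add: inj_eq[OF inj_\<omega>])
    moreover have "cascade z 0 (y + real_vec l) = 0" if "l \<notin> \<Omega>" for l
      unfolding eq using that by (intro sum.neutral) auto
    ultimately show "samples (cascade z 0) y = z \<and> (\<forall>l. l \<notin> \<Omega> \<longrightarrow> cascade z 0 (y + real_vec l) = 0)"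
      by (simp add: samples_def vec_eq_iff del: cascade.simps)
  qed
qed

lemma cascade_vanishes_off_\<Omega>: "vanishes_off_\<Omega> (cascade z n)"
proof (induction n)
  case 0
  show ?case unfolding vanishes_off_\<Omega>_def using cascade_0_samples by eventually_elim blast
next
  case (Suc n)
  then show ?case by (rule vanishes_off_\<Omega>_refinement) simp
qed

lemma vanishes_off_\<Omega>_diff:
  assumes "vanishes_off_\<Omega> f" "vanishes_off_\<Omega> g"
  shows "vanishes_off_\<Omega> (\<lambda>x. f x - g x)"
  unfolding vanishes_off_\<Omega>_def using assms[unfolded vanishes_off_\<Omega>_def] by eventually_elim simp

lemma cascade_step_vanishes_off_\<Omega>: "vanishes_off_\<Omega> (cascade_step z n)"
  unfolding cascade_step_def[abs_def] by (intro vanishes_off_\<Omega>_diff cascade_vanishes_off_\<Omega>)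

abbreviation "prodT ds w \<equiv> foldr (\<lambda>d w. T d *v w) ds w"

text \<open>
  The starting function has samples \<open>z\<close> and its refinement has samples \<open>T d *v z\<close> on the piece of \<open>d\<close>. The
  increments satisfy the refinement recursion themselves, and every further refinement prepends a
  digit and applies its matrix.
\<close>
lemma cascade_step_samples:
  assumes d: "d \<in> D"
  shows "ds \<in> words D n \<Longrightarrow>
    AE y in lborel. y \<in> G \<longrightarrow> samples (cascade_step z n) (branches (ds @ [d]) y) = prodT ds (T d *v z - z)"
proof (induction n arbitrary: ds)
  case 0
  have 1: "AE y in lborel. y \<in> G \<longrightarrow> samples (cascade z (Suc 0)) (branch M d y) = T d *v samples (cascade z 0) y"
    by (intro samples_branch cascade_vanishes_off_\<Omega>) simp
  have 2: "AE y in lborel. branch M d y \<in> G \<longrightarrow> samples (cascade z 0) (branch M d y) = z"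
    using AE_branch[OF cascade_0_samples] by eventually_elim blast
  show ?case
    using 1 2 cascade_0_samples[of z]
  proof eventually_elim
    case (elim y)
    show ?case
    proof
      assume y: "y \<in> G"
      then have "branch M d y \<in> G" using d by (rule branch_expansions)
      with elim y have "samples (cascade z (Suc 0)) (branch M d y) = T d *v z" "samples (cascade z 0) (branch M d y) = z"
        by auto
      then have "samples (cascade_step z 0) (branch M d y) = T d *v z - z"
        by (simp add: samples_def cascade_step_def vec_eq_iff del: cascade.simps)
      then show "samples (cascade_step z 0) (branches (ds @ [d]) y) = prodT ds (T d *v z - z)"
        using 0 by (simp add: words_0)
    qed
  qed
next
  case (Suc n)
  then obtain e es where ds: "ds = e # es" "e \<in> D" "es \<in> words D n" by (auto simp: words_def length_Suc_conv)
  have "AE y in lborel. y \<in> G \<longrightarrow> samples (cascade_step z (Suc n)) (branch M e y) = T e *v samples (cascade_step z n) y"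
    unfolding cascade_step_Suc by (intro samples_branch cascade_step_vanishes_off_\<Omega>) simp
  then have "AE y in lborel. branches (es @ [d]) y \<in> G \<longrightarrow>
      samples (cascade_step z (Suc n)) (branch M e (branches (es @ [d]) y))
        = T e *v samples (cascade_step z n) (branches (es @ [d]) y)"
    by (rule AE_branches)
  with Suc.IH[OF ds(3)] show ?case
  proof eventually_elim
    case (elim y)
    show ?case
    proof
      assume y: "y \<in> G"
      then have "branches (es @ [d]) y \<in> G" using ds(3) d by (intro branches_G) (auto simp: words_def)
      with elim y show "samples (cascade_step z (Suc n)) (branches (ds @ [d]) y) = prodT ds (T d *v z - z)"
        by (simp add: ds(1))
    qed
  qed
qed

text \<open>
  The increment is constant on the cells of level \<open>n + 1\<close>, so its \<open>L\<^sub>p\<close> norm is a mean over words.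
\<close>
lemma cascade_step_norm:
  assumes p: "1 \<le> p"
  shows "(\<integral>\<^sup>+x. ennreal (\<bar>cascade_step z n x\<bar> powr p) \<partial>lborel)
    \<le> ennreal (real CARD('n) / m * (\<Sum>d\<in>D. (\<Sum>ds\<in>words D n. norm (prodT ds (T d *v z - z)) powr p) / m ^ n))"
proof -
  let ?h = "\<lambda>t :: real. ennreal (\<bar>t\<bar> powr p)"
  let ?N = "\<lambda>ds d. norm (prodT ds (T d *v z - z)) powr p"
  have comp: "(\<integral>\<^sup>+y\<in>G. ?h (samples (cascade_step z n) y $ a) \<partial>lborel)
      \<le> ennreal (1 / m * (\<Sum>d\<in>D. (\<Sum>ds\<in>words D n. ?N ds d) / m ^ n))" for a
  proof -
    have "(\<integral>\<^sup>+y\<in>G. ?h (samples (cascade_step z n) y $ a) \<partial>lborel)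
        = ennreal (1 / m ^ Suc n) * (\<Sum>ds\<in>words D n. \<Sum>d\<in>D. \<integral>\<^sup>+y\<in>G. ?h (samples (cascade_step z n) (branches (ds @ [d]) y) $ a) \<partial>lborel)"
      using nn_integral_G_words[of "\<lambda>y. ?h (samples (cascade_step z n) y $ a)" "Suc n"]
      unfolding sum_words_snoc by simp
    also have "\<dots> \<le> ennreal (1 / m ^ Suc n) * (\<Sum>ds\<in>words D n. \<Sum>d\<in>D. ennreal (?N ds d))"
    proof (intro mult_left_mono sum_mono)
      fix ds d assume ds: "ds \<in> words D n" and d: "d \<in> D"
      have "(\<integral>\<^sup>+y\<in>G. ?h (samples (cascade_step z n) (branches (ds @ [d]) y) $ a) \<partial>lborel)
          \<le> (\<integral>\<^sup>+y. ennreal (?N ds d) * indicator G y \<partial>lborel)"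
      proof (rule nn_integral_mono_AE)
        show "AE y in lborel. ?h (samples (cascade_step z n) (branches (ds @ [d]) y) $ a) * indicator G y
            \<le> ennreal (?N ds d) * indicator G y"
          using cascade_step_samples[OF d ds, of z]
        proof eventually_elim
          case (elim y)
          have "\<bar>prodT ds (T d *v z - z) $ a\<bar> powr p \<le> ?N ds d"
            using p by (intro powr_mono2 component_le_norm_cart) auto
          with elim show ?case by (auto simp: indicator_def intro: ennreal_leI)
        qed
      qed
      also have "\<dots> = ennreal (?N ds d)" using tile by (simp add: nn_integral_cmult)
      finally show "(\<integral>\<^sup>+y\<in>G. ?h (samples (cascade_step z n) (branches (ds @ [d]) y) $ a) \<partial>lborel) \<le> ennreal (?N ds d)" .
    qed simp
    also have "\<dots> = ennreal (1 / m ^ Suc n * (\<Sum>ds\<in>words D n. \<Sum>d\<in>D. ?N ds d))"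
    proof -
      have "(\<Sum>ds\<in>words D n. \<Sum>d\<in>D. ennreal (?N ds d)) = ennreal (\<Sum>ds\<in>words D n. \<Sum>d\<in>D. ?N ds d)"
        by (simp add: sum_ennreal sum_nonneg)
      then show ?thesis using m_pos by (simp only:) (rule ennreal_mult[symmetric], auto intro!: sum_nonneg)
    qed
    also have "1 / m ^ Suc n * (\<Sum>ds\<in>words D n. \<Sum>d\<in>D. ?N ds d) = 1 / m * (\<Sum>d\<in>D. (\<Sum>ds\<in>words D n. ?N ds d) / m ^ n)"
      unfolding sum.swap[of _ D] sum_divide_distrib[symmetric] by simp
    finally show ?thesis .
  qed
  have "(\<integral>\<^sup>+x. ?h (cascade_step z n x) \<partial>lborel)
      \<le> (\<Sum>a\<in>(UNIV :: 'n set). ennreal (1 / m * (\<Sum>d\<in>D. (\<Sum>ds\<in>words D n. ?N ds d) / m ^ n)))"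
  proof -
    have "(\<integral>\<^sup>+x. ?h (cascade_step z n x) \<partial>lborel) = (\<Sum>a\<in>UNIV. \<integral>\<^sup>+y\<in>G. ?h (samples (cascade_step z n) y $ a) \<partial>lborel)"
      using p by (intro nn_integral_samples[OF cascade_step_vanishes_off_\<Omega>]) auto
    then show ?thesis by (simp only:) (rule sum_mono, rule comp)
  qed
  also have "\<dots> = ennreal (real CARD('n) / m * (\<Sum>d\<in>D. (\<Sum>ds\<in>words D n. ?N ds d) / m ^ n))"
    using m_pos by (simp add: ennreal_of_nat_eq_real_of_nat ennreal_mult'[symmetric] mult.assoc)
  finally show ?thesis .
qed

lemma integrable_refinement:
  assumes "integrable lborel f"
  shows "integrable lborel (refinement f)" "(\<integral>x. refinement f x \<partial>lborel) = (\<integral>x. f x \<partial>lborel)"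
proof -
  show "integrable lborel (refinement f)"
    unfolding refinement_def by (intro Bochner_Integration.integrable_sum integrable_mult_right integral_dilate(1) assms)
  have "(\<integral>x. refinement f x \<partial>lborel) = (\<Sum>k\<in>\<Gamma>. c k * ((1 / m) * (\<integral>x. f x \<partial>lborel)))"
    unfolding refinement_def
    by (subst Bochner_Integration.integral_sum)
       (auto intro!: integrable_mult_right integral_dilate(1) assms simp: integral_dilate(2)[OF assms])
  also have "\<dots> = (\<Sum>k\<in>\<Gamma>. c k) * ((1 / m) * (\<integral>x. f x \<partial>lborel))"
    by (rule sum_distrib_right[symmetric])
  also have "\<dots> = (\<integral>x. f x \<partial>lborel)"
    unfolding sum_mask using m_pos by simp
  finally show "(\<integral>x. refinement f x \<partial>lborel) = (\<integral>x. f x \<partial>lborel)" .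
qed

lemma integral_translate_G:
  "integrable lborel (\<lambda>x. indicator G (x - t) :: real)" "(\<integral>x. indicator G (x - t) \<partial>lborel) = (1 :: real)"
proof -
  have eq: "(\<lambda>x. indicator G (x - t) :: real) = indicator ((+) t ` G)"
    by (auto simp: indicator_def fun_eq_iff image_iff algebra_simps intro: bexI[of _ "_ - t"])
  have "emeasure lborel ((+) t ` G) = (\<integral>\<^sup>+x. indicator ((+) t ` G) x \<partial>lborel)"
    using borel_compact[OF compact_translation[OF compact_G]] by simp
  also have "\<dots> = (\<integral>\<^sup>+x. indicator G (x - t) \<partial>lborel)"
    by (intro nn_integral_cong) (auto simp: indicator_def image_iff algebra_simps intro: bexI[of _ "_ - t"])
  also have "\<dots> = (\<integral>\<^sup>+x. indicator G x \<partial>lborel)"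
    using nn_integral_lborel_translate[of "indicator G" "- t"] by simp
  finally have "emeasure lborel ((+) t ` G) = 1" using tile by simp
  then show "integrable lborel (\<lambda>x. indicator G (x - t) :: real)" "(\<integral>x. indicator G (x - t) \<partial>lborel) = (1 :: real)"
    unfolding eq using borel_compact[OF compact_translation[OF compact_G]] by (auto simp: measure_def)
qed

lemma integral_cascade:
  assumes z: "z \<in> sum_one"
  shows "integrable lborel (cascade z n)" "(\<integral>x. cascade z n x \<partial>lborel) = 1"
proof (induction n)
  case 0
  { case 1 show ?case unfolding cascade.simps
      by (intro Bochner_Integration.integrable_sum integrable_mult_right integral_translate_G) }
  { case 2
    have "(\<integral>x. cascade z 0 x \<partial>lborel) = (\<Sum>a\<in>UNIV. \<integral>x. z $ a * indicator G (x - real_vec (\<omega> a)) \<partial>lborel)"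
      unfolding cascade.simps
      by (intro Bochner_Integration.integral_sum integrable_mult_right integral_translate_G)
    also have "\<dots> = (\<Sum>a\<in>UNIV. z $ a * 1)"
      by (simp only: integral_mult_right_zero integral_translate_G)
    finally show ?case using z by (simp add: sum_one_def) }
next
  case (Suc n)
  { case 1 show ?case using Suc(1) by (simp add: integrable_refinement) }
  { case 2 show ?case using Suc by (simp add: integrable_refinement) }
qed

end

lemma le_one_plus_powr: "0 \<le> t \<Longrightarrow> 1 \<le> p \<Longrightarrow> t \<le> 1 + t powr (p :: real)"
proof (cases "t \<le> 1")
  case False
  assume "0 \<le> t" "1 \<le> p"
  then have "t powr 1 \<le> t powr p" using False by (intro powr_mono) auto
  then show ?thesis using False by simp
qed (simp add: add_increasing2)

text \<open>
  The terms are bounded by \<open>h\<^bsup>1/p\<^esup>\<close> times a geometric sequence. In the construction of the limit, \<open>t n\<close> is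
  the \<open>n\<close>-th increment at a point and \<open>h\<close> is an integrable function of that point: the weights \<open>\<rho>\<^sup>n\<close> give
  convergence and an \<open>L\<^sub>p\<close> bound at the same time.
\<close>
lemma geometric_domination:
  fixes p \<rho> h :: real and t :: "nat \<Rightarrow> real"
  assumes p: "1 \<le> p" and \<rho>: "0 < \<rho>" "\<rho> < 1" and h: "0 \<le> h"
    and le: "\<And>n. \<bar>t n\<bar> powr p / \<rho> ^ n \<le> h"
  shows "summable t" "\<bar>\<Sum>i<n. t i\<bar> \<le> h powr (1 / p) / (1 - \<rho> powr (1 / p))"
proof -
  let ?\<theta> = "\<rho> powr (1 / p)"
  have \<theta>: "0 < ?\<theta>" "?\<theta> < 1" using \<rho> p powr_less_mono2[of "1 / p" \<rho> 1] by auto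
  have t: "norm (t n) \<le> h powr (1 / p) * ?\<theta> ^ n" for n
  proof -
    have "\<bar>t n\<bar> = (\<bar>t n\<bar> powr p) powr (1 / p)" using p by (simp add: powr_powr)
    also have "\<dots> \<le> (h * \<rho> ^ n) powr (1 / p)"
      using le[of n] \<rho> p by (intro powr_mono2) (auto simp: field_simps)
    also have "\<dots> = h powr (1 / p) * ?\<theta> ^ n"
      using h \<rho> by (simp add: powr_mult powr_powr mult.commute flip: powr_realpow)
    finally show ?thesis by simp
  qed
  have sm: "summable (\<lambda>n. h powr (1 / p) * ?\<theta> ^ n)" using \<theta> by (intro summable_mult) simp
  then show "summable t" using t by (rule summable_comparison_test'[where N = 0]) 
  have "\<bar>\<Sum>i<n. t i\<bar> \<le> (\<Sum>i<n. h powr (1 / p) * ?\<theta> ^ i)"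
    using t by (intro order_trans[OF sum_abs] sum_mono) simp
  also have "\<dots> \<le> (\<Sum>i. h powr (1 / p) * ?\<theta> ^ i)"
    using sm \<theta> by (intro sum_le_suminf) auto
  also have "\<dots> = h powr (1 / p) / (1 - ?\<theta>)"
    using \<theta> by (simp add: suminf_mult suminf_geometric)
  finally show "\<bar>\<Sum>i<n. t i\<bar> \<le> h powr (1 / p) / (1 - ?\<theta>)" .
qed

context refinement_mask
begin

text \<open>
  With \<open>\<rho> = \<surd>r\<close> the series \<open>\<Sum> |D n|\<^sup>p / \<rho>\<^sup>n\<close> of the increments has a finite integral. Its sum therefore
  dominates the increments almost everywhere in the sense of \<open>geometric_domination\<close>, and the iterates
  converge under one majorant in \<open>L\<^sub>p\<close>. All iterates vanish outside a common ball, on which the majorant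
  is integrable, so the integral 1 is inherited by the limit.
\<close>
theorem cascade_limit:
  assumes p: "1 \<le> p" and z: "z \<in> sum_one" and C: "0 \<le> C" and r: "0 < r" "r < 1"
    and step: "\<And>n. (\<integral>\<^sup>+x. ennreal (\<bar>cascade_step z n x\<bar> powr p) \<partial>lborel) \<le> ennreal (C * r ^ n)"
  shows "\<exists>F R. F \<in> borel_measurable borel \<and> integrable lborel (\<lambda>x. \<bar>F x\<bar> powr p) \<and> integrable lborel F \<and>
    (\<integral>x. F x \<partial>lborel) = 1 \<and> (AE x in lborel. F x = refinement F x) \<and>
    (AE x in lborel. x \<notin> cball 0 R \<longrightarrow> F x = 0)"
proof -
  define \<rho> where "\<rho> = sqrt r"
  have \<rho>: "0 < \<rho>" "\<rho> < 1" "r = \<rho> * \<rho>" using r by (auto simp: \<rho>_def)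
  let ?D = "cascade_step z" and ?\<theta> = "\<rho> powr (1 / p)"
  have \<theta>: "?\<theta> < 1" using \<rho> p powr_less_mono2[of "1 / p" \<rho> 1] by auto
  define H where "H x = (\<Sum>n. ennreal (\<bar>?D n x\<bar> powr p / \<rho> ^ n))" for x
  have H[measurable]: "H \<in> borel_measurable borel" unfolding H_def by measurable
  have "(\<integral>\<^sup>+x. H x \<partial>lborel) = (\<Sum>n. \<integral>\<^sup>+x. ennreal (\<bar>?D n x\<bar> powr p / \<rho> ^ n) \<partial>lborel)"
    unfolding H_def by (rule nn_integral_suminf) measurable
  also have "\<dots> \<le> (\<Sum>n. ennreal (C * \<rho> ^ n))"
  proof (intro suminf_le summableI)
    fix n
    have "(\<integral>\<^sup>+x. ennreal (\<bar>?D n x\<bar> powr p / \<rho> ^ n) \<partial>lborel) = (\<integral>\<^sup>+x. ennreal (1 / \<rho> ^ n) * ennreal (\<bar>?D n x\<bar> powr p) \<partial>lborel)"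
      using \<rho> by (intro nn_integral_cong) (simp add: ennreal_mult'[symmetric])
    also have "\<dots> = ennreal (1 / \<rho> ^ n) * (\<integral>\<^sup>+x. ennreal (\<bar>?D n x\<bar> powr p) \<partial>lborel)"
      by (rule nn_integral_cmult) measurable
    also have "\<dots> \<le> ennreal (1 / \<rho> ^ n) * ennreal (C * r ^ n)" by (intro mult_left_mono step) simp
    also have "\<dots> = ennreal (C * \<rho> ^ n)"
      using \<rho> C by (simp add: ennreal_mult'[symmetric] power_mult_distrib)
    finally show "(\<integral>\<^sup>+x. ennreal (\<bar>?D n x\<bar> powr p / \<rho> ^ n) \<partial>lborel) \<le> ennreal (C * \<rho> ^ n)" .
  qed
  also have "\<dots> = ennreal (\<Sum>n. C * \<rho> ^ n)"
    using C \<rho> by (intro suminf_ennreal2 summable_mult) auto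
  finally have H_fin: "(\<integral>\<^sup>+x. H x \<partial>lborel) < \<infinity>" by (rule le_less_trans) simp
  then have H_AE: "AE x in lborel. H x \<noteq> \<infinity>" by (intro nn_integral_PInf_AE) auto
  define h where "h x = enn2real (H x)" for x
  have h0: "0 \<le> h x" for x by (simp add: h_def)
  have h_int: "integrable lborel h"
  proof (rule integrableI_bounded)
    show "h \<in> borel_measurable lborel" unfolding h_def by measurable
    have "(\<integral>\<^sup>+x. ennreal (norm (h x)) \<partial>lborel) \<le> (\<integral>\<^sup>+x. H x \<partial>lborel)"
      by (intro nn_integral_mono) (simp add: h_def ennreal_enn2real_if)
    with H_fin show "(\<integral>\<^sup>+x. ennreal (norm (h x)) \<partial>lborel) < \<infinity>" by (rule le_less_trans[rotated])
  qed
  define g where "g x = \<bar>cascade z 0 x\<bar> + h x powr (1 / p) / (1 - ?\<theta>)" for x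
  \<comment> \<open>A measurable function everywhere, although the limit exists only almost everywhere.\<close>
  define F where "F x = lim (\<lambda>n. cascade z n x)" for x
  have g0: "0 \<le> g x" for x using \<theta> by (simp add: g_def del: cascade.simps)
  have [measurable]: "F \<in> borel_measurable borel" unfolding F_def by measurable
  have [measurable]: "h \<in> borel_measurable borel" unfolding h_def by measurable
  have [measurable]: "g \<in> borel_measurable borel" unfolding g_def by measurable
  have good: "AE x in lborel. (\<lambda>n. cascade z n x) \<longlonglongrightarrow> F x \<and> (\<forall>n. \<bar>cascade z n x\<bar> \<le> g x)"
    using H_AE
  proof eventually_elim
    case (elim x)
    have le: "\<bar>?D n x\<bar> powr p / \<rho> ^ n \<le> h x" for n
    proof -
      have "sum (\<lambda>n. ennreal (\<bar>?D n x\<bar> powr p / \<rho> ^ n)) {n} \<le> H x"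
        unfolding H_def by (intro sum_le_suminf) auto
      then have "ennreal (\<bar>?D n x\<bar> powr p / \<rho> ^ n) \<le> ennreal (h x)"
        using elim by (simp add: h_def less_top)
      then show ?thesis using h0[of x] by (simp add: ennreal_le_iff)
    qed
    have tele: "cascade z n x = cascade z 0 x + (\<Sum>i<n. ?D i x)" for n
      by (induction n) (simp_all add: cascade_step_def del: cascade.simps)
    have "summable (\<lambda>n. ?D n x)" by (rule geometric_domination(1)[OF p \<rho>(1,2) h0 le])
    then have "(\<lambda>n. cascade z 0 x + (\<Sum>i<n. ?D i x)) \<longlonglongrightarrow> cascade z 0 x + (\<Sum>i. ?D i x)"
      by (intro tendsto_intros summable_LIMSEQ)
    then have lim: "(\<lambda>n. cascade z n x) \<longlonglongrightarrow> cascade z 0 x + (\<Sum>i. ?D i x)"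
      by (simp only: tele[symmetric])
    then have "F x = cascade z 0 x + (\<Sum>i. ?D i x)" unfolding F_def by (rule limI)
    with lim have "(\<lambda>n. cascade z n x) \<longlonglongrightarrow> F x" by (simp only:)
    moreover have "\<bar>cascade z n x\<bar> \<le> g x" for n
      unfolding tele[of n] g_def
      using geometric_domination(2)[OF p \<rho>(1,2) h0 le, of n] abs_triangle_ineq[of "cascade z 0 x" "\<Sum>i<n. ?D i x"]
      by linarith
    ultimately show ?case by blast
  qed
  have gp_int: "integrable lborel (\<lambda>x. g x powr p)"
  proof (rule Bochner_Integration.integrable_bound)
    define Z where "Z = (\<Sum>a\<in>UNIV. \<bar>z $ a\<bar>)"
    \<comment> \<open>The starting function is bounded by \<open>Z\<close>, so its \<open>p\<close>-th power is integrable because it is itself.\<close>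
    let ?w = "\<lambda>x. 2 powr p * (Z powr (p - 1) * \<bar>cascade z 0 x\<bar> + (1 / (1 - ?\<theta>)) powr p * h x)"
    show "integrable lborel ?w"
      by (intro integrable_mult_right Bochner_Integration.integrable_add integrable_abs integral_cascade z h_int)
    show "(\<lambda>x. g x powr p) \<in> borel_measurable lborel" by measurable
    show "AE x in lborel. norm (g x powr p) \<le> norm (?w x)"
    proof (rule AE_I2)
      fix x
      have Z: "\<bar>cascade z 0 x\<bar> \<le> Z"
        unfolding Z_def cascade.simps by (rule order_trans[OF sum_abs], rule sum_mono, simp split: split_indicator)
      have F0: "\<bar>cascade z 0 x\<bar> powr p \<le> Z powr (p - 1) * \<bar>cascade z 0 x\<bar>"
      proof (cases "cascade z 0 x = 0")
        case False
        then have "\<bar>cascade z 0 x\<bar> powr p = \<bar>cascade z 0 x\<bar> powr (p - 1) * \<bar>cascade z 0 x\<bar> powr 1"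
          unfolding powr_add[symmetric] by (simp del: cascade.simps)
        also have "\<dots> \<le> Z powr (p - 1) * \<bar>cascade z 0 x\<bar> powr 1"
          using Z p by (intro mult_right_mono powr_mono2) auto
        finally show ?thesis using False by (simp del: cascade.simps)
      next
        case True
        then show ?thesis by (simp only: abs_zero) simp
      qed
      have "h x powr (1 / p) / (1 - ?\<theta>) = (1 / (1 - ?\<theta>)) * h x powr (1 / p)" by simp
      then have "(h x powr (1 / p) / (1 - ?\<theta>)) powr p = (1 / (1 - ?\<theta>)) powr p * h x"
        using \<theta> p h0[of x] by (simp only: powr_mult powr_powr) (simp add: powr_divide)
      then have "g x powr p \<le> 2 powr p * (\<bar>cascade z 0 x\<bar> powr p + (1 / (1 - ?\<theta>)) powr p * h x)"
        using powr_add_le[of "\<bar>cascade z 0 x\<bar>" "h x powr (1 / p) / (1 - ?\<theta>)" p] p \<theta>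
        by (simp add: g_def del: cascade.simps)
      also have "\<dots> \<le> ?w x" by (intro mult_left_mono add_right_mono F0) simp
      finally show "norm (g x powr p) \<le> norm (?w x)" by (simp del: cascade.simps)
    qed
  qed
  have Fg: "AE x in lborel. \<bar>F x\<bar> \<le> g x"
    using good
  proof eventually_elim
    case (elim x)
    then have "(\<lambda>n. \<bar>cascade z n x\<bar>) \<longlonglongrightarrow> \<bar>F x\<bar>" by (intro tendsto_intros) simp
    then show ?case by (rule LIMSEQ_le_const2) (use elim in blast)
  qed
  have Fp_int: "integrable lborel (\<lambda>x. \<bar>F x\<bar> powr p)"
  proof (rule Bochner_Integration.integrable_bound[OF gp_int])
    show "AE x in lborel. norm (\<bar>F x\<bar> powr p) \<le> norm (g x powr p)"
      using Fg p by (auto elim!: eventually_mono intro: powr_mono2)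
  qed measurable
  obtain R where R: "\<And>n. AE x in lborel. x \<notin> cball 0 R \<longrightarrow> cascade z n x = 0"
    using vanishes_outside_ball cascade_vanishes_off_\<Omega> by metis
  have R_all: "AE x in lborel. \<forall>n. x \<notin> cball 0 R \<longrightarrow> cascade z n x = 0"
    unfolding AE_all_countable using R by blast
  have F_R: "AE x in lborel. x \<notin> cball 0 R \<longrightarrow> F x = 0"
    using R_all
  proof eventually_elim
    case (elim x)
    show ?case
    proof
      assume "x \<notin> cball 0 R"
      with elim have "(\<lambda>n. cascade z n x) = (\<lambda>n. 0)" by blast
      then show "F x = 0" unfolding F_def by (simp only: lim_const)
    qed
  qed
  let ?w = "\<lambda>x. indicator (cball 0 R) x * (1 + g x powr p)"
  have w_int: "integrable lborel ?w"
  proof -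
    have "integrable lborel (\<lambda>x. indicator (cball 0 R) x *\<^sub>R (g x powr p))"
      by (intro integrable_mult_indicator gp_int) auto
    moreover have "integrable lborel (indicator (cball (0 :: real ^ 's) R) :: _ \<Rightarrow> real)"
      by (rule integrable_real_indicator) (auto simp: emeasure_bounded_finite[simplified])
    ultimately have "integrable lborel (\<lambda>x. indicator (cball 0 R) x + indicator (cball 0 R) x *\<^sub>R (g x powr p))"
      by (intro Bochner_Integration.integrable_add)
    then show ?thesis by (simp add: distrib_left)
  qed
  have lim_AE: "AE x in lborel. (\<lambda>n. cascade z n x) \<longlonglongrightarrow> F x"
    using good by eventually_elim blast
  have dom: "AE x in lborel. norm (cascade z n x) \<le> ?w x" for n
    using good R_all
  proof eventually_elim
    case (elim x)
    show ?case
    proof (cases "x \<in> cball 0 R")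
      case True
      have "\<bar>cascade z n x\<bar> \<le> g x" using elim by blast
      also have "\<dots> \<le> 1 + g x powr p" by (rule le_one_plus_powr[OF g0 p])
      finally show ?thesis using True by simp
    next
      case False
      with elim have "cascade z n x = 0" by blast
      then show ?thesis by simp
    qed
  qed
  have F_int: "integrable lborel F"
    by (rule integrable_dominated_convergence[OF _ _ w_int lim_AE dom]) measurable
  have "(\<lambda>n. \<integral>x. cascade z n x \<partial>lborel) \<longlonglongrightarrow> (\<integral>x. F x \<partial>lborel)"
    by (rule integral_dominated_convergence[OF _ _ w_int lim_AE dom]) measurable
  then have F1: "(\<integral>x. F x \<partial>lborel) = 1"
    unfolding integral_cascade(2)[OF z] by (simp only: LIMSEQ_const_iff)
  have "AE x in lborel. \<forall>k\<in>\<Gamma>. (\<lambda>n. cascade z n (real_mat M *v x - real_vec k)) \<longlonglongrightarrow> F (real_mat M *v x - real_vec k)"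
    by (intro AE_finite_allI finite_mask AE_dilate[OF lim_AE])
  with lim_AE have "AE x in lborel. F x = refinement F x"
  proof eventually_elim
    case (elim x)
    have "(\<lambda>n. refinement (cascade z n) x) \<longlonglongrightarrow> refinement F x"
      unfolding refinement_def using elim(2) by (intro tendsto_intros) auto
    moreover have "(\<lambda>n. refinement (cascade z n) x) \<longlonglongrightarrow> F x"
      using LIMSEQ_Suc[OF elim(1)] by (simp only: cascade.simps)
    ultimately show ?case by (intro LIMSEQ_unique)
  qed
  with Fp_int F_int F1 F_R show ?thesis by (intro exI[of _ F] exI[of _ R]) auto
qed

end

section \<open>Integrable solutions represent the refinable distribution\<close>

lemma test_fun_measurable: "test_fun f \<Longrightarrow> f \<in> borel_measurable borel"
  by (intro borel_measurable_continuous_onI smooth_continuous test_fun_smooth)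

lemma integrable_times_test_fun:
  assumes F: "integrable lborel F" and f: "test_fun f"
  shows "integrable lborel (\<lambda>x. F x * f x :: real)"
proof -
  obtain B where B: "\<And>x. \<bar>f x\<bar> \<le> B" using test_fun_derivs_bounded[OF f, of "[]"] by auto
  have [measurable]: "F \<in> borel_measurable borel" "f \<in> borel_measurable borel"
    using F test_fun_measurable[OF f] by auto
  show ?thesis
  proof (rule Bochner_Integration.integrable_bound)
    show "integrable lborel (\<lambda>x. B * \<bar>F x\<bar>)" using F by simp
    show "AE x in lborel. norm (F x * f x) \<le> norm (B * \<bar>F x\<bar>)"
    proof (rule AE_I2)
      fix x
      have "\<bar>f x\<bar> \<le> \<bar>B\<bar>" using B[of x] by linarith
      then show "norm (F x * f x) \<le> norm (B * \<bar>F x\<bar>)"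
        using mult_left_mono[of _ _ "\<bar>F x\<bar>"] by (simp add: abs_mult mult.commute[of _ "\<bar>F x\<bar>"])
    qed
  qed measurable
qed

lemma test_fun_vanishes_outside_ball:
  assumes "test_fun (f :: real ^ 's::finite \<Rightarrow> real)"
  shows "\<exists>R. \<forall>x. f x \<noteq> 0 \<longrightarrow> norm x \<le> R"
proof -
  have "bounded (fun_support f)" using assms by (simp add: test_fun_def compact_imp_bounded)
  then obtain R where "\<forall>x\<in>fun_support f. norm x \<le> R" unfolding bounded_iff by (elim exE)
  then have "\<forall>x. f x \<noteq> 0 \<longrightarrow> norm x \<le> R" using in_fun_support[of f] by blast
  then show ?thesis ..
qed

locale refinable_distribution = refinement_mask M D c \<omega>
  for M :: "int ^ 's::finite ^ 's" and D c and \<omega> :: "'n::finite \<Rightarrow> int ^ 's" +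
  fixes \<phi> :: "'s functional"
  assumes det_M: "\<bar>det (real_mat M)\<bar> = real (card D)"
    and refinable: "refinable_function M c \<phi>"
begin

lemma \<phi>_linear: "test_fun f \<Longrightarrow> test_fun g \<Longrightarrow> \<phi> (\<lambda>x. a * f x + b * g x) = a * \<phi> f + b * \<phi> g"
  using refinable unfolding refinable_function_def distribution_def by blast

lemma \<phi>_diff: "test_fun f \<Longrightarrow> test_fun g \<Longrightarrow> \<phi> (\<lambda>x. f x - g x) = \<phi> f - \<phi> g"
  using \<phi>_linear[of f g 1 "- 1"] by simp

lemma \<phi>_refine: "test_fun f \<Longrightarrow> \<phi> f = (\<Sum>k\<in>\<Gamma>. c k / m * \<phi> (\<lambda>y. f (branch M k y)))"
  using refinable unfolding refinable_function_def dist_pullback_def det_M branch_def by simp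

lemma \<phi>_support:
  obtains R where "\<And>f. test_fun f \<Longrightarrow> fun_support f \<inter> cball 0 R = {} \<Longrightarrow> \<phi> f = 0"
proof -
  obtain C where C: "compact C" "dist_supported_in \<phi> C"
    using refinable unfolding refinable_function_def compactly_supported_def by blast
  obtain R where R: "\<forall>x\<in>C. norm x \<le> R" using compact_imp_bounded[OF C(1)] unfolding bounded_iff by blast
  have "\<phi> f = 0" if f: "test_fun f" "fun_support f \<inter> cball 0 R = {}" for f
  proof -
    have "fun_support f \<inter> C = {}" using f(2) R by auto
    with C(2) f(1) show ?thesis unfolding dist_supported_in_def by blast
  qed
  then show ?thesis by (rule that)
qed

text \<open>
  The radius exceeds the support by 1, which provides the open neighbourhood on which the test function
  is 1.
\<close>
lemma \<phi>_integral:
  obtains R where "\<And>f. test_fun f \<Longrightarrow> (\<And>x. x \<in> cball 0 R \<Longrightarrow> f x = 1) \<Longrightarrow> \<phi> f = 1"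
proof -
  obtain C where C: "compact C" "\<And>f W. test_fun f \<Longrightarrow> open W \<Longrightarrow> C \<subseteq> W \<Longrightarrow> (\<And>x. x \<in> W \<Longrightarrow> f x = 1) \<Longrightarrow> \<phi> f = 1"
    using refinable unfolding refinable_function_def dist_has_integral_def by metis
  obtain R where R: "\<forall>x\<in>C. norm x \<le> R" using compact_imp_bounded[OF C(1)] unfolding bounded_iff by blast
  have "\<phi> f = 1" if f: "test_fun f" "\<And>x. x \<in> cball 0 (R + 1) \<Longrightarrow> f x = 1" for f
  proof (rule C(2)[OF f(1) open_ball[of 0 "R + 1"]])
    show "C \<subseteq> ball 0 (R + 1)" using R by fastforce
    show "f x = 1" if "x \<in> ball 0 (R + 1)" for x using f(2)[of x] that by simp
  qed
  then show ?thesis by (rule that)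
qed

lemma integral_times_branch:
  assumes F: "integrable lborel F" and f: "test_fun f"
  shows "integrable lborel (\<lambda>x. F (real_mat M *v x - real_vec k) * f x)"
    "(\<integral>y. F y * f (branch M k y) \<partial>lborel) = m * (\<integral>x. F (real_mat M *v x - real_vec k) * f x \<partial>lborel)"
proof -
  show "integrable lborel (\<lambda>x. F (real_mat M *v x - real_vec k) * f x)"
    by (rule integrable_times_test_fun[OF integral_dilate(1)[OF F] f])
  obtain B where B: "\<And>x. \<bar>f x\<bar> \<le> B" using test_fun_derivs_bounded[OF f, of "[]"] by auto
  have [measurable]: "F \<in> borel_measurable borel" "f \<in> borel_measurable borel"
    using F test_fun_measurable[OF f] by auto
  have int: "integrable lborel (\<lambda>y. F y * f (branch M k y))"
  proof (rule Bochner_Integration.integrable_bound)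
    show "integrable lborel (\<lambda>x. B * \<bar>F x\<bar>)" using F by simp
    show "AE x in lborel. norm (F x * f (branch M k x)) \<le> norm (B * \<bar>F x\<bar>)"
    proof (rule AE_I2)
      fix x
      have "\<bar>f (branch M k x)\<bar> \<le> \<bar>B\<bar>" using B[of "branch M k x"] by linarith
      then show "norm (F x * f (branch M k x)) \<le> norm (B * \<bar>F x\<bar>)"
        using mult_left_mono[of _ _ "\<bar>F x\<bar>"] by (simp add: abs_mult mult.commute[of _ "\<bar>F x\<bar>"])
    qed
    show "(\<lambda>y. F y * f (branch M k y)) \<in> borel_measurable lborel"
      using measurable_compose[OF branch_measurable \<open>f \<in> borel_measurable borel\<close>] by simp
  qed
  from integral_dilate(2)[OF int, of "real_vec k"] m_pos
  show "(\<integral>y. F y * f (branch M k y) \<partial>lborel) = m * (\<integral>x. F (real_mat M *v x - real_vec k) * f x \<partial>lborel)"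
    by (simp add: branch_inverse)
qed

lemma integral_refinement_test_fun:
  assumes F: "integrable lborel F" and f: "test_fun f"
  shows "(\<integral>x. refinement F x * f x \<partial>lborel) = (\<Sum>k\<in>\<Gamma>. c k / m * (\<integral>y. F y * f (branch M k y) \<partial>lborel))"
proof -
  have "(\<integral>x. refinement F x * f x \<partial>lborel) = (\<integral>x. (\<Sum>k\<in>\<Gamma>. c k * (F (real_mat M *v x - real_vec k) * f x)) \<partial>lborel)"
    by (simp add: refinement_def sum_distrib_right mult.assoc)
  also have "\<dots> = (\<Sum>k\<in>\<Gamma>. c k * (\<integral>x. F (real_mat M *v x - real_vec k) * f x \<partial>lborel))"
    by (subst Bochner_Integration.integral_sum) (auto intro!: integrable_mult_right integral_times_branch(1)[OF F f])
  also have "\<dots> = (\<Sum>k\<in>\<Gamma>. c k / m * (\<integral>y. F y * f (branch M k y) \<partial>lborel))"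
    using m_pos by (intro sum.cong refl) (simp add: integral_times_branch(2)[OF F f])
  finally show ?thesis .
qed

text \<open>
  The difference of the distribution and of the functional given by \<open>F\<close> is compactly supported, satisfies
  the refinement equation and has integral 0, hence vanishes.
\<close>
theorem represented_by_integrable_solution:
  assumes F: "integrable lborel F" and F1: "(\<integral>x. F x \<partial>lborel) = 1"
    and F_refine: "AE x in lborel. F x = refinement F x"
    and F_support: "AE x in lborel. x \<notin> cball 0 R \<longrightarrow> F x = 0" and f: "test_fun f"
  shows "\<phi> f = (\<integral>x. F x * f x \<partial>lborel)"
proof -
  have [measurable]: "F \<in> borel_measurable borel" using F by auto
  obtain R1 where R1: "\<And>f. test_fun f \<Longrightarrow> fun_support f \<inter> cball 0 R1 = {} \<Longrightarrow> \<phi> f = 0" using \<phi>_support by blast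
  obtain R2 where R2: "\<And>f. test_fun f \<Longrightarrow> (\<And>x. x \<in> cball 0 R2 \<Longrightarrow> f x = 1) \<Longrightarrow> \<phi> f = 1" using \<phi>_integral by blast
  define R0 where "R0 = max R (max R1 R2)"
  let ?u = "\<lambda>f. \<phi> f - (\<integral>x. F x * f x \<partial>lborel)"
  have lin: "?u (\<lambda>x. a * f x + b * g x) = a * ?u f + b * ?u g" if fg: "test_fun f" "test_fun g" for f g a b
  proof -
    have "(\<integral>x. F x * (a * f x + b * g x) \<partial>lborel) = (\<integral>x. a * (F x * f x) + b * (F x * g x) \<partial>lborel)"
      by (simp add: algebra_simps)
    also have "\<dots> = a * (\<integral>x. F x * f x \<partial>lborel) + b * (\<integral>x. F x * g x \<partial>lborel)"
      using integrable_times_test_fun[OF F fg(1)] integrable_times_test_fun[OF F fg(2)] by simp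
    finally show ?thesis using \<phi>_linear[OF fg] by (simp add: algebra_simps)
  qed
  interpret null_refinable M ?u \<Gamma> "\<lambda>k. c k / m" R0
  proof
    show "distribution ?u"
      unfolding distribution_def
    proof (intro conjI allI impI)
      fix f g :: "real ^ 's \<Rightarrow> real" and a b assume "test_fun f \<and> test_fun g"
      then show "?u (\<lambda>x. a * f x + b * g x) = a * ?u f + b * ?u g" using lin by blast
    next
      fix C :: "(real ^ 's) set" assume "compact C"
      then obtain B n where B: "\<And>f b. test_fun f \<Longrightarrow> fun_support f \<subseteq> C \<Longrightarrow>
          (\<And>is x. length is \<le> n \<Longrightarrow> \<bar>partial_derivs is f x\<bar> \<le> b) \<Longrightarrow> \<bar>\<phi> f\<bar> \<le> B * b"
        using refinable unfolding refinable_function_def distribution_def by metis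
      let ?I = "\<integral>x. \<bar>F x\<bar> \<partial>lborel"
      show "\<exists>B n. \<forall>f b. test_fun f \<and> fun_support f \<subseteq> C \<and> (\<forall>is x. length is \<le> n \<longrightarrow> \<bar>partial_derivs is f x\<bar> \<le> b)
          \<longrightarrow> \<bar>?u f\<bar> \<le> B * b"
      proof (intro exI[of _ "B + ?I"] exI[of _ n] allI impI, elim conjE)
        fix f :: "real ^ 's \<Rightarrow> real" and b
        assume f: "test_fun f" "fun_support f \<subseteq> C"
          and b: "\<forall>is x. length is \<le> n \<longrightarrow> \<bar>partial_derivs is f x\<bar> \<le> b"
        have "\<bar>f x\<bar> \<le> b" for x using b[rule_format, of "[]" x] by simp
        then have le: "(\<integral>x. \<bar>F x * f x\<bar> \<partial>lborel) \<le> (\<integral>x. \<bar>F x\<bar> * b \<partial>lborel)"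
          using F by (intro integral_mono integrable_abs integrable_times_test_fun[OF F f(1)] integrable_mult_left)
            (auto simp: abs_mult intro!: mult_left_mono)
        have "\<bar>\<integral>x. F x * f x \<partial>lborel\<bar> \<le> (\<integral>x. \<bar>F x * f x\<bar> \<partial>lborel)" by (rule integral_abs_bound)
        also note le
        also have "(\<integral>x. \<bar>F x\<bar> * b \<partial>lborel) = ?I * b" by simp
        finally have "\<bar>\<integral>x. F x * f x \<partial>lborel\<bar> \<le> ?I * b" .
        moreover have "\<bar>\<phi> f\<bar> \<le> B * b" using B f b by blast
        ultimately show "\<bar>?u f\<bar> \<le> (B + ?I) * b" by (simp add: distrib_right)
      qed
    qed
  next
    fix f :: "real ^ 's \<Rightarrow> real" assume f: "test_fun f" "fun_support f \<inter> cball 0 R0 = {}"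
    have "\<phi> f = 0" using f by (intro R1) (auto simp: R0_def)
    moreover have "(\<integral>x. F x * f x \<partial>lborel) = 0"
    proof (rule integral_eq_zero_AE)
      show "AE x in lborel. F x * f x = 0"
        using F_support
      proof eventually_elim
        case (elim x)
        show ?case
        proof (cases "f x = 0")
          case False
          then have "x \<notin> cball 0 R0" using f(2) in_fun_support[of f x] by blast
          then have "x \<notin> cball 0 R" by (auto simp: R0_def)
          then show ?thesis using elim by simp
        qed simp
      qed
    qed
    ultimately show "?u f = 0" by simp
  next
    show "finite \<Gamma>" by (rule finite_mask)
    show "(\<Sum>k\<in>\<Gamma>. c k / m) = 1" using m_pos by (simp add: sum_divide_distrib[symmetric] sum_mask)
  next
    fix f :: "real ^ 's \<Rightarrow> real" assume f: "test_fun f"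
    have "(\<integral>x. F x * f x \<partial>lborel) = (\<integral>x. refinement F x * f x \<partial>lborel)"
      using F_refine test_fun_measurable[OF f] by (intro integral_cong_AE) auto
    then have "(\<integral>x. F x * f x \<partial>lborel) = (\<Sum>k\<in>\<Gamma>. c k / m * (\<integral>y. F y * f (branch M k y) \<partial>lborel))"
      by (simp only: integral_refinement_test_fun[OF F f])
    with \<phi>_refine[OF f] show "?u f = (\<Sum>k\<in>\<Gamma>. c k / m * ?u (\<lambda>y. f (branch M k y)))"
      by (simp only: sum_subtractf[symmetric] right_diff_distrib)
  next
    fix f :: "real ^ 's \<Rightarrow> real" assume f: "test_fun f" "\<And>x. x \<in> cball 0 R0 \<Longrightarrow> f x = 1"
    have "\<phi> f = 1" using f by (intro R2) (auto simp: R0_def)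
    moreover have "(\<integral>x. F x * f x \<partial>lborel) = (\<integral>x. F x \<partial>lborel)"
    proof (rule integral_cong_AE)
      show "AE x in lborel. F x * f x = F x"
        using F_support
      proof eventually_elim
        case (elim x)
        show ?case
        proof (cases "x \<in> cball 0 R0")
          case True
          then show ?thesis by (simp only: f(2) mult_1_right)
        next
          case False
          then have "x \<notin> cball 0 R" by (auto simp: R0_def)
          then show ?thesis using elim by simp
        qed
      qed
    qed (use test_fun_measurable[OF f(1)] in measurable)
    ultimately show "?u f = 0" using F1 by simp
  qed
  from vanishes[OF f] show ?thesis by simp
qed

text \<open>
  The vectors \<open>T d *v z - z\<close> lie in \<open>U z\<close>, where the means of the norms of products decay geometrically. So
  the increments of the cascade algorithm do so in \<open>L\<^sub>p\<close>.
\<close>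
theorem in_Lp_if_p_radius:
  assumes p: "1 \<le> p" and z: "z \<in> sum_one"
    and radius: "p_radius p D (\<lambda>d w. T d *v w) (difference_space D T z) < 1"
  shows "in_Lp \<phi> p"
proof -
  let ?U = "difference_space D T z"
  interpret U: matrix_family D T ?U p
    by unfold_locales (use finite_D D_nonempty difference_space_invariant p in auto)
  obtain C r where C: "0 \<le> C" and r: "0 < r" "r < 1" and geo: "\<And>k. U.op_mean k \<le> C * r ^ k"
    using U.op_mean_geometric[OF radius] by blast
  have wU: "T d *v z - z \<in> ?U" if "d \<in> D" for d
  proof -
    have "T d *v z - z \<in> {T d *v z - z | d. d \<in> D}" using that by blast
    then show ?thesis unfolding difference_space_def by (rule hull_inc)
  qed
  define E where "E = real CARD('n) / m * (\<Sum>d\<in>D. C * norm (T d *v z - z) powr p)"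
  have "(\<integral>\<^sup>+x. ennreal (\<bar>cascade_step z n x\<bar> powr p) \<partial>lborel) \<le> ennreal (E * r ^ n)" for n
  proof -
    have "(\<Sum>d\<in>D. U.vec_mean (T d *v z - z) n) \<le> (\<Sum>d\<in>D. C * r ^ n * norm (T d *v z - z) powr p)"
    proof (rule sum_mono)
      fix d assume "d \<in> D"
      have "U.vec_mean (T d *v z - z) n \<le> U.op_mean n * norm (T d *v z - z) powr p"
        by (rule U.vec_mean_le[OF wU[OF \<open>d \<in> D\<close>]])
      also have "\<dots> \<le> C * r ^ n * norm (T d *v z - z) powr p" by (intro mult_right_mono geo) simp
      finally show "U.vec_mean (T d *v z - z) n \<le> C * r ^ n * norm (T d *v z - z) powr p" .
    qed
    also have "\<dots> = (\<Sum>d\<in>D. C * norm (T d *v z - z) powr p) * r ^ n"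
      unfolding sum_distrib_right by (intro sum.cong refl) (simp add: mult_ac)
    finally have "real CARD('n) / m * (\<Sum>d\<in>D. U.vec_mean (T d *v z - z) n) \<le> E * r ^ n"
      unfolding E_def mult.assoc using m_pos by (intro mult_left_mono) auto
    from order_trans[OF cascade_step_norm[OF p, of z n] ennreal_leI[OF this[unfolded U.vec_mean_def]]]
    show ?thesis .
  qed
  moreover have "0 \<le> E" unfolding E_def using C m_pos by (intro mult_nonneg_nonneg sum_nonneg) auto
  ultimately obtain F R where F: "F \<in> borel_measurable borel" "integrable lborel (\<lambda>x. \<bar>F x\<bar> powr p)"
    "integrable lborel F" "(\<integral>x. F x \<partial>lborel) = 1" "AE x in lborel. F x = refinement F x"
    "AE x in lborel. x \<notin> cball 0 R \<longrightarrow> F x = 0"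
    using cascade_limit[OF p z _ r, of E] by blast
  show ?thesis
    unfolding in_Lp_def
  proof (intro exI[of _ F] conjI allI impI)
    show "F \<in> borel_measurable lebesgue" using F(1) by (intro measurable_completion) simp
    show "integrable lebesgue (\<lambda>x. \<bar>F x\<bar> powr p)"
      using F(1,2) by (subst integrable_completion) auto
    fix f :: "real ^ 's \<Rightarrow> real" assume f: "test_fun f"
    have "integral\<^sup>L lebesgue (\<lambda>x. F x * f x) = integral\<^sup>L lborel (\<lambda>x. F x * f x)"
      using F(1) test_fun_measurable[OF f] by (intro integral_completion) auto
    then show "\<phi> f = integral\<^sup>L lebesgue (\<lambda>x. F x * f x)"
      using represented_by_integrable_solution[OF F(3-6) f] by simp
  qed
qed

end

section \<open>Approximation and Jensen's inequality\<close>

text \<open>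
  The convexity of \<open>t \<mapsto> t\<^sup>p\<close> in the form in which it is integrated in Jensen's inequality. The point \<open>t = 0\<close>
  is included, where the power need not be differentiable.
\<close>
lemma powr_above_tangent:
  assumes p: "1 \<le> (p::real)" and s: "0 < s" and t: "0 \<le> t"
  shows "s powr p + p * s powr (p - 1) * (t - s) \<le> t powr p"
proof (cases "t = 0")
  case True
  have "s powr p = s powr (p - 1) * s" using s powr_add[of s "p - 1" 1] by simp
  then have "s powr p + p * s powr (p - 1) * (0 - s) = (1 - p) * s powr p" by (simp add: algebra_simps)
  also have "\<dots> \<le> 0" using p by (intro mult_nonpos_nonneg) auto
  finally show ?thesis using True p by simp
next
  case False
  then have t: "0 < t" using t by simp
  have der: "((\<lambda>x. x powr p) has_real_derivative p * x powr (p - 1)) (at x)" if "0 < x" for x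
    using that by (auto intro!: derivative_eq_intros)
  consider "s < t" | "t < s" | "s = t" by linarith
  then show ?thesis
  proof cases
    case 1
    then obtain x where x: "s < x" "x < t" "t powr p - s powr p = (t - s) * (p * x powr (p - 1))"
      using MVT2[of s t "\<lambda>x. x powr p" "\<lambda>x. p * x powr (p - 1)"] der s by force
    have "s powr (p - 1) \<le> x powr (p - 1)" using x s p by (intro powr_mono2) auto
    then have "(t - s) * (p * s powr (p - 1)) \<le> (t - s) * (p * x powr (p - 1))"
      using 1 p by (intro mult_left_mono) auto
    with x(3) show ?thesis by (simp add: mult_ac)
  next
    case 2
    then obtain x where x: "t < x" "x < s" "s powr p - t powr p = (s - t) * (p * x powr (p - 1))"
      using MVT2[of t s "\<lambda>x. x powr p" "\<lambda>x. p * x powr (p - 1)"] der t by force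
    have "x powr (p - 1) \<le> s powr (p - 1)" using x t p by (intro powr_mono2) auto
    then have "(s - t) * (p * x powr (p - 1)) \<le> (s - t) * (p * s powr (p - 1))"
      using 2 p by (intro mult_left_mono) auto
    with x(3) show ?thesis by (simp add: algebra_simps)
  qed simp
qed

lemma abs_powr_triple:
  assumes p: "1 \<le> (p::real)"
  shows "\<bar>a + b + c\<bar> powr p \<le> 4 powr p * (\<bar>a\<bar> powr p + \<bar>b\<bar> powr p + \<bar>c\<bar> powr p)"
proof -
  have "\<bar>a + b + c\<bar> powr p \<le> ((\<bar>a\<bar> + \<bar>b\<bar>) + \<bar>c\<bar>) powr p"
    using p by (intro powr_mono2) auto
  also have "\<dots> \<le> 2 powr p * ((\<bar>a\<bar> + \<bar>b\<bar>) powr p + \<bar>c\<bar> powr p)" using p by (intro powr_add_le) auto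
  also have "\<dots> \<le> 2 powr p * (2 powr p * (\<bar>a\<bar> powr p + \<bar>b\<bar> powr p) + 2 powr p * \<bar>c\<bar> powr p)"
  proof (intro mult_left_mono add_mono)
    show "(\<bar>a\<bar> + \<bar>b\<bar>) powr p \<le> 2 powr p * (\<bar>a\<bar> powr p + \<bar>b\<bar> powr p)" using p by (intro powr_add_le) auto
    have "1 \<le> 2 powr p" using p by (intro ge_one_powr_ge_zero) auto
    then show "\<bar>c\<bar> powr p \<le> 2 powr p * \<bar>c\<bar> powr p" using mult_right_mono[of 1 "2 powr p" "\<bar>c\<bar> powr p"] by simp
  qed simp
  also have "\<dots> = 4 powr p * (\<bar>a\<bar> powr p + \<bar>b\<bar> powr p + \<bar>c\<bar> powr p)"
  proof -
    have "(2 * 2) powr p = 2 powr p * (2 :: real) powr p" by (rule powr_mult)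
    then show ?thesis by (simp add: algebra_simps)
  qed
  finally show ?thesis .
qed

context lattice_tile
begin

text \<open>
  Integrate the tangent inequality at the absolute value \<open>s\<close> of the mean, using that the tile has measure 1.
\<close>
lemma jensen_on_tile:
  assumes p: "1 \<le> p" and u: "integrable lborel (\<lambda>y. indicator G y * u y)" and [measurable]: "u \<in> borel_measurable borel"
  shows "ennreal (\<bar>\<integral>y. indicator G y * u y \<partial>lborel\<bar> powr p) \<le> (\<integral>\<^sup>+y\<in>G. ennreal (\<bar>u y\<bar> powr p) \<partial>lborel)"
proof (cases "(\<integral>y. indicator G y * u y \<partial>lborel) = 0 \<or> (\<integral>\<^sup>+y\<in>G. ennreal (\<bar>u y\<bar> powr p) \<partial>lborel) = \<infinity>")
  case True
  then show ?thesis using p by auto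
next
  case False
  define s where "s = \<bar>\<integral>y. indicator G y * u y \<partial>lborel\<bar>"
  have s: "0 < s" using False by (simp add: s_def)
  have eq: "(\<integral>\<^sup>+y\<in>G. ennreal (\<bar>u y\<bar> powr p) \<partial>lborel) = (\<integral>\<^sup>+y. ennreal (indicator G y * \<bar>u y\<bar> powr p) \<partial>lborel)"
    by (intro nn_integral_cong) (simp split: split_indicator)
  have up: "integrable lborel (\<lambda>y. indicator G y * \<bar>u y\<bar> powr p)"
    using False unfolding eq by (intro integrableI_nonneg) (auto simp: less_top)
  have abs_int: "integrable lborel (\<lambda>y. indicator G y * \<bar>u y\<bar>)"
    using integrable_abs[OF u] by (simp add: abs_mult)
  have G_int: "integrable lborel (indicator G :: _ \<Rightarrow> real)"
    using tile by (intro integrable_real_indicator) auto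
  have G1: "(\<integral>y. indicator G y \<partial>lborel) = (1 :: real)" using tile by (simp add: measure_def)
  have s_le: "s \<le> (\<integral>y. indicator G y * \<bar>u y\<bar> \<partial>lborel)"
    unfolding s_def using integral_abs_bound[of lborel "\<lambda>y. indicator G y * u y"] by (simp add: abs_mult)
  let ?c = "p * s powr (p - 1)"
  have "s powr p \<le> s powr p + ?c * ((\<integral>y. indicator G y * \<bar>u y\<bar> \<partial>lborel) - s)"
    using s_le p by simp
  also have "\<dots> = (\<integral>y. (s powr p - ?c * s) * indicator G y + ?c * (indicator G y * \<bar>u y\<bar>) \<partial>lborel)"
  proof -
    have "(\<integral>y. (s powr p - ?c * s) * indicator G y + ?c * (indicator G y * \<bar>u y\<bar>) \<partial>lborel)
        = (s powr p - ?c * s) * 1 + ?c * (\<integral>y. indicator G y * \<bar>u y\<bar> \<partial>lborel)"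
      unfolding G1[symmetric] integral_mult_right_zero[symmetric]
      by (intro Bochner_Integration.integral_add integrable_mult_right G_int abs_int)
    then show ?thesis by (simp add: algebra_simps)
  qed
  also have "\<dots> \<le> (\<integral>y. indicator G y * \<bar>u y\<bar> powr p \<partial>lborel)"
  proof (rule integral_mono[OF _ up])
    show "integrable lborel (\<lambda>y. (s powr p - ?c * s) * indicator G y + ?c * (indicator G y * \<bar>u y\<bar>))"
      by (intro Bochner_Integration.integrable_add integrable_mult_right G_int abs_int)
    show "(s powr p - ?c * s) * indicator G y + ?c * (indicator G y * \<bar>u y\<bar>) \<le> indicator G y * \<bar>u y\<bar> powr p" for y
      using powr_above_tangent[OF p s abs_ge_zero[of "u y"]] by (simp add: algebra_simps split: split_indicator)
  qed
  finally have "s powr p \<le> (\<integral>y. indicator G y * \<bar>u y\<bar> powr p \<partial>lborel)" .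
  then show ?thesis unfolding eq s_def[symmetric]
    by (subst nn_integral_eq_integral[OF up]) (auto intro: ennreal_leI)
qed

text \<open>
  Clipping reduces the claim to a bounded function. That one is almost everywhere a limit of continuous
  functions, which may be clipped at the same bound, and dominated convergence applies twice.
\<close>
lemma tile_approximation:
  assumes p: "1 \<le> p" and h[measurable]: "h \<in> borel_measurable borel"
    and hp: "integrable lborel (\<lambda>y. indicator G y * \<bar>h y\<bar> powr p)" and e: "0 < e"
  shows "\<exists>g. continuous_on UNIV g \<and> (\<integral>\<^sup>+y\<in>G. ennreal (\<bar>h y - g y\<bar> powr p) \<partial>lborel) \<le> ennreal e"
proof -
  define clip where "clip b t = max (- b) (min b t)" for b t :: real
  have [measurable]: "clip b \<in> borel_measurable borel" for b unfolding clip_def by measurable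
  have cont_clip: "continuous_on S (clip b)" for b S unfolding clip_def by (intro continuous_intros)
  let ?e = "e / (2 * 2 powr p)"
  have e': "0 < ?e" using e by simp
  have "(\<lambda>n. \<integral>y. indicator G y * \<bar>h y - clip (real n) (h y)\<bar> powr p \<partial>lborel) \<longlonglongrightarrow> (\<integral>y. (0 :: real) \<partial>(lborel :: (real ^ 's) measure))"
  proof (rule integral_dominated_convergence[OF _ _ hp])
    show "AE y in lborel. (\<lambda>n. indicator G y * \<bar>h y - clip (real n) (h y)\<bar> powr p) \<longlonglongrightarrow> 0"
    proof (rule AE_I2)
      fix y
      obtain N :: nat where N: "\<bar>h y\<bar> \<le> real N" using real_arch_simple by blast
      have "\<forall>\<^sub>F n in sequentially. indicator G y * \<bar>h y - clip (real n) (h y)\<bar> powr p = 0"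
        using eventually_ge_at_top[of N]
      proof eventually_elim
        case (elim n)
        then have "\<bar>h y\<bar> \<le> real n" using N by linarith
        then show ?case by (auto simp: clip_def max_def min_def)
      qed
      then show "(\<lambda>n. indicator G y * \<bar>h y - clip (real n) (h y)\<bar> powr p) \<longlonglongrightarrow> 0"
        by (rule tendsto_eventually)
    qed
    show "AE y in lborel. norm (indicator G y * \<bar>h y - clip (real n) (h y)\<bar> powr p) \<le> indicator G y * \<bar>h y\<bar> powr p" for n
    proof (rule AE_I2)
      fix y
      have "\<bar>h y - clip (real n) (h y)\<bar> \<le> \<bar>h y\<bar>" by (auto simp: clip_def max_def min_def)
      then have "\<bar>h y - clip (real n) (h y)\<bar> powr p \<le> \<bar>h y\<bar> powr p" using p by (intro powr_mono2) auto
      then show "norm (indicator G y * \<bar>h y - clip (real n) (h y)\<bar> powr p) \<le> indicator G y * \<bar>h y\<bar> powr p"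
        by (simp split: split_indicator)
    qed
  qed measurable
  then have "\<forall>\<^sub>F n in sequentially. (\<integral>y. indicator G y * \<bar>h y - clip (real n) (h y)\<bar> powr p \<partial>lborel) < ?e"
    using e' by (intro order_tendstoD(2)) auto
  then obtain n where n: "(\<integral>y. indicator G y * \<bar>h y - clip (real n) (h y)\<bar> powr p \<partial>lborel) < ?e"
    using eventually_happens by force
  define b where "b = real n"
  define f where "f y = clip b (h y)" for y
  have f_b: "\<bar>f y\<bar> \<le> b" for y by (auto simp: f_def clip_def b_def max_def min_def)
  have [measurable]: "f \<in> borel_measurable borel" unfolding f_def by measurable
  have "f \<in> borel_measurable lebesgue" by (intro measurable_completion) simp
  then have "f measurable_on UNIV" by (intro lebesgue_measurable_imp_measurable_on) (auto simp: lebesgue_on_UNIV_eq)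
  then obtain N g where N: "negligible N" and g: "\<And>j. continuous_on UNIV (g j)"
    "\<And>y. y \<notin> N \<Longrightarrow> (\<lambda>j. g j y) \<longlonglongrightarrow> f y"
    unfolding measurable_on_def by auto
  have "AE y in lebesgue. y \<notin> N" using N by (intro AE_not_in) (simp add: negligible_iff_null_sets)
  then have AE_N: "AE y in lborel. y \<notin> N" by (simp add: AE_completion_iff)
  let ?g = "\<lambda>j y. clip b (g j y)"
  have cg: "continuous_on UNIV (?g j)" for j
    by (rule continuous_on_compose2[OF cont_clip g(1)]) auto
  have [measurable]: "?g j \<in> borel_measurable borel" for j using cg by (rule borel_measurable_continuous_onI)
  have g_b: "\<bar>?g j y\<bar> \<le> b" for j y by (auto simp: clip_def b_def max_def min_def)
  have "(\<lambda>j. \<integral>y. indicator G y * \<bar>f y - ?g j y\<bar> powr p \<partial>lborel) \<longlonglongrightarrow> (\<integral>y. (0 :: real) \<partial>(lborel :: (real ^ 's) measure))"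
  proof (rule integral_dominated_convergence[where w = "\<lambda>y. (2 * b) powr p * indicator G y"])
    show "integrable lborel (\<lambda>y. (2 * b) powr p * indicator G y)"
      using tile by (intro integrable_mult_right integrable_real_indicator) auto
    show "AE y in lborel. (\<lambda>j. indicator G y * \<bar>f y - ?g j y\<bar> powr p) \<longlonglongrightarrow> 0"
      using AE_N
    proof eventually_elim
      case (elim y)
      have "isCont (clip b) (f y)" using cont_clip[of UNIV b] by (simp add: continuous_on_eq_continuous_at)
      then have "(\<lambda>j. ?g j y) \<longlonglongrightarrow> clip b (f y)" by (rule isCont_tendsto_compose[OF _ g(2)[OF elim]])
      moreover have "clip b (f y) = f y" using f_b[of y] by (auto simp: clip_def max_def min_def)
      ultimately have "(\<lambda>j. ?g j y) \<longlonglongrightarrow> f y" by (simp only:)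
      then have "(\<lambda>j. \<bar>f y - ?g j y\<bar>) \<longlonglongrightarrow> \<bar>f y - f y\<bar>" by (intro tendsto_intros)
      then have "(\<lambda>j. \<bar>f y - ?g j y\<bar>) \<longlonglongrightarrow> 0" by simp
      then have "(\<lambda>j. \<bar>f y - ?g j y\<bar> powr p) \<longlonglongrightarrow> 0 powr p" using p by (intro tendsto_powr' tendsto_const) auto
      then show ?case using p tendsto_mult_right_zero[of "\<lambda>j. \<bar>f y - ?g j y\<bar> powr p" sequentially "indicator G y"] by simp
    qed
    show "AE y in lborel. norm (indicator G y * \<bar>f y - ?g j y\<bar> powr p) \<le> (2 * b) powr p * indicator G y" for j
    proof (rule AE_I2)
      fix y
      have "\<bar>f y - ?g j y\<bar> \<le> 2 * b" using f_b[of y] g_b[of j y] by linarith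
      then have "\<bar>f y - ?g j y\<bar> powr p \<le> (2 * b) powr p" using p by (intro powr_mono2) auto
      then show "norm (indicator G y * \<bar>f y - ?g j y\<bar> powr p) \<le> (2 * b) powr p * indicator G y"
        by (simp split: split_indicator)
    qed
  qed measurable
  then have "\<forall>\<^sub>F j in sequentially. (\<integral>y. indicator G y * \<bar>f y - ?g j y\<bar> powr p \<partial>lborel) < ?e"
    using e' by (intro order_tendstoD(2)) auto
  then obtain j where j: "(\<integral>y. indicator G y * \<bar>f y - ?g j y\<bar> powr p \<partial>lborel) < ?e"
    using eventually_happens by force
  have int1: "integrable lborel (\<lambda>y. indicator G y * \<bar>h y - f y\<bar> powr p)"
  proof (rule Bochner_Integration.integrable_bound[OF hp])
    show "AE y in lborel. norm (indicator G y * \<bar>h y - f y\<bar> powr p) \<le> norm (indicator G y * \<bar>h y\<bar> powr p)"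
    proof (rule AE_I2)
      fix y
      have "\<bar>h y - f y\<bar> \<le> \<bar>h y\<bar>" by (auto simp: f_def clip_def b_def max_def min_def)
      then have "\<bar>h y - f y\<bar> powr p \<le> \<bar>h y\<bar> powr p" using p by (intro powr_mono2) auto
      then show "norm (indicator G y * \<bar>h y - f y\<bar> powr p) \<le> norm (indicator G y * \<bar>h y\<bar> powr p)"
        by (simp split: split_indicator)
    qed
  qed measurable
  have int2: "integrable lborel (\<lambda>y. indicator G y * \<bar>f y - ?g j y\<bar> powr p)"
  proof (rule Bochner_Integration.integrable_bound)
    show "integrable lborel (\<lambda>y. (2 * b) powr p * indicator G y)"
      using tile by (intro integrable_mult_right integrable_real_indicator) auto
    show "AE y in lborel. norm (indicator G y * \<bar>f y - ?g j y\<bar> powr p) \<le> norm ((2 * b) powr p * indicator G y)"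
    proof (rule AE_I2)
      fix y
      have "\<bar>f y - ?g j y\<bar> \<le> 2 * b" using f_b[of y] g_b[of j y] by linarith
      then have "\<bar>f y - ?g j y\<bar> powr p \<le> (2 * b) powr p" using p by (intro powr_mono2) auto
      then show "norm (indicator G y * \<bar>f y - ?g j y\<bar> powr p) \<le> norm ((2 * b) powr p * indicator G y)"
        by (simp split: split_indicator)
    qed
  qed measurable
  let ?w = "\<lambda>y. 2 powr p * (indicator G y * \<bar>h y - f y\<bar> powr p + indicator G y * \<bar>f y - ?g j y\<bar> powr p)"
  have "(\<integral>\<^sup>+y\<in>G. ennreal (\<bar>h y - ?g j y\<bar> powr p) \<partial>lborel) \<le> (\<integral>\<^sup>+y. ennreal (?w y) \<partial>lborel)"
  proof (intro nn_integral_mono)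
    fix y
    have "\<bar>h y - ?g j y\<bar> powr p \<le> (\<bar>h y - f y\<bar> + \<bar>f y - ?g j y\<bar>) powr p" using p by (intro powr_mono2) auto
    also have "\<dots> \<le> 2 powr p * (\<bar>h y - f y\<bar> powr p + \<bar>f y - ?g j y\<bar> powr p)" using p by (intro powr_add_le) auto
    finally show "ennreal (\<bar>h y - ?g j y\<bar> powr p) * indicator G y \<le> ennreal (?w y)"
      by (simp add: ennreal_leI split: split_indicator)
  qed
  also have "\<dots> = ennreal (\<integral>y. ?w y \<partial>lborel)"
    by (intro nn_integral_eq_integral integrable_mult_right Bochner_Integration.integrable_add int1 int2 AE_I2)
      (auto split: split_indicator)
  also have "\<dots> \<le> ennreal e"
  proof (rule ennreal_leI)
    have "(\<integral>y. ?w y \<partial>lborel) = 2 powr p * ((\<integral>y. indicator G y * \<bar>h y - f y\<bar> powr p \<partial>lborel) + (\<integral>y. indicator G y * \<bar>f y - ?g j y\<bar> powr p \<partial>lborel))"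
      using int1 int2 by simp
    also have "\<dots> \<le> 2 powr p * (?e + ?e)"
      using n j by (intro mult_left_mono add_mono) (auto simp: f_def b_def)
    also have "\<dots> = e" by simp
    finally show "(\<integral>y. ?w y \<partial>lborel) \<le> e" .
  qed
  finally show ?thesis using cg by blast
qed

text \<open>
  The mean over all cells of level \<open>k\<close> of the \<open>p\<close>-th power deviation between \<open>h\<close> on the cell and \<open>h\<close> on the
  subcell with last digit \<open>d\<close>, both parametrised by \<open>G\<close>. By Jensen's inequality it controls the
  differences of the averages of \<open>h\<close> over cells of consecutive levels.
\<close>
definition oscillation :: "real \<Rightarrow> int ^ 's \<Rightarrow> (real ^ 's \<Rightarrow> real) \<Rightarrow> nat \<Rightarrow> ennreal" where
  "oscillation p d h k = ennreal (1 / m ^ k) *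
     (\<Sum>ds\<in>words D k. \<integral>\<^sup>+y\<in>G. ennreal (\<bar>h (branches (ds @ [d]) y) - h (branches ds y)\<bar> powr p) \<partial>lborel)"

text \<open>
  The cells shrink uniformly, so uniform continuity on the tile makes every single summand small.
\<close>
lemma oscillation_continuous:
  assumes p: "1 \<le> p" and d: "d \<in> D" and g: "continuous_on UNIV g" and e: "0 < e"
  shows "\<forall>\<^sub>F k in sequentially. oscillation p d g k \<le> ennreal e"
proof -
  define e1 where "e1 = e powr (1 / p)"
  have e1: "0 < e1" "e1 powr p = e" using e p by (auto simp: e1_def powr_powr)
  obtain \<delta> where \<delta>: "0 < \<delta>" "\<And>x y. x \<in> G \<Longrightarrow> y \<in> G \<Longrightarrow> dist y x < \<delta> \<Longrightarrow> dist (g y) (g x) < e1"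
    using compact_uniformly_continuous[OF continuous_on_subset[OF g subset_UNIV] compact_G] e1(1)
    unfolding uniformly_continuous_on_def by metis
  obtain B where B: "\<And>y. y \<in> G \<Longrightarrow> norm y \<le> B"
    using compact_imp_bounded[OF compact_G] unfolding bounded_iff by blast
  have "(\<lambda>k. C\<^sub>M * r\<^sub>M ^ k * (2 * B)) \<longlonglongrightarrow> C\<^sub>M * 0 * (2 * B)"
    using contraction by (intro tendsto_intros LIMSEQ_realpow_zero) auto
  then have "\<forall>\<^sub>F k in sequentially. C\<^sub>M * r\<^sub>M ^ k * (2 * B) < \<delta>"
    using \<delta>(1) by (intro order_tendstoD(2)) auto
  then show ?thesis
  proof eventually_elim
    case (elim k)
    have "(\<integral>\<^sup>+y\<in>G. ennreal (\<bar>g (branches (ds @ [d]) y) - g (branches ds y)\<bar> powr p) \<partial>lborel) \<le> ennreal e"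
      if ds: "ds \<in> words D k" for ds
    proof -
      have "(\<integral>\<^sup>+y\<in>G. ennreal (\<bar>g (branches (ds @ [d]) y) - g (branches ds y)\<bar> powr p) \<partial>lborel)
          \<le> (\<integral>\<^sup>+y. ennreal e * indicator G y \<partial>lborel)"
      proof (intro nn_integral_mono)
        fix y
        show "ennreal (\<bar>g (branches (ds @ [d]) y) - g (branches ds y)\<bar> powr p) * indicator G y \<le> ennreal e * indicator G y"
        proof (cases "y \<in> G")
          case True
          have bd: "branch M d y \<in> G" using True d by (rule branch_expansions)
          have "norm (branch M d y - y) \<le> 2 * B"
            using norm_triangle_ineq4[of "branch M d y" y] B[OF True] B[OF bd] by linarith
          then have "dist (branches ds (branch M d y)) (branches ds y) \<le> C\<^sub>M * r\<^sub>M ^ k * (2 * B)"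
            unfolding dist_norm branches_diff using ds by (auto simp: words_def intro: apow_bound)
          with elim have "dist (g (branches ds (branch M d y))) (g (branches ds y)) < e1"
            using ds True bd by (intro \<delta>(2) branches_G) (auto simp: words_def)
          then have "\<bar>g (branches (ds @ [d]) y) - g (branches ds y)\<bar> powr p \<le> e1 powr p"
            using p by (intro powr_mono2) (auto simp: dist_real_def)
          then show ?thesis unfolding e1(2) using True by (simp add: ennreal_leI)
        qed simp
      qed
      also have "\<dots> = ennreal e" using tile by (simp add: nn_integral_cmult)
      finally show ?thesis .
    qed
    then have "oscillation p d g k \<le> ennreal (1 / m ^ k) * (\<Sum>ds\<in>words D k. ennreal e)"
      unfolding oscillation_def by (intro mult_left_mono sum_mono) auto
    also have "\<dots> = ennreal (1 / m ^ k) * (ennreal (m ^ k) * ennreal e)"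
    proof -
      have "card (words D k) = card D ^ k" unfolding words_def by (rule card_lists_length_eq[OF finite_D])
      then show ?thesis by (simp add: ennreal_of_nat_eq_real_of_nat)
    qed
    also have "\<dots> = ennreal e" using m_pos e by (simp add: ennreal_mult[symmetric])
    finally show ?case .
  qed
qed

text \<open>
  Replacing \<open>h\<close> by \<open>g\<close> costs the deviation of \<open>h\<close> from \<open>g\<close> over all cells of level \<open>k\<close>, and over those cells
  of level \<open>k + 1\<close> that have last digit \<open>d\<close>. The first sum is the deviation over \<open>G\<close>, the second is at most
  \<open>m\<close> times that.
\<close>
lemma oscillation_le:
  assumes p: "1 \<le> p" and d: "d \<in> D" and [measurable]: "h \<in> borel_measurable borel" "g \<in> borel_measurable borel"
  shows "oscillation p d h k \<le> ennreal (4 powr p) *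
    (ennreal (m + 1) * (\<integral>\<^sup>+y\<in>G. ennreal (\<bar>h y - g y\<bar> powr p) \<partial>lborel) + oscillation p d g k)"
proof -
  let ?e = "\<lambda>y. ennreal (\<bar>h y - g y\<bar> powr p)"
  let ?I = "\<integral>\<^sup>+y\<in>G. ?e y \<partial>lborel"
  let ?X = "\<lambda>ds. \<integral>\<^sup>+y\<in>G. ?e (branches (ds @ [d]) y) \<partial>lborel" and ?Y = "\<lambda>ds. \<integral>\<^sup>+y\<in>G. ?e (branches ds y) \<partial>lborel"
  let ?Z = "\<lambda>ds. \<integral>\<^sup>+y\<in>G. ennreal (\<bar>g (branches (ds @ [d]) y) - g (branches ds y)\<bar> powr p) \<partial>lborel"
  have "(\<integral>\<^sup>+y\<in>G. ennreal (\<bar>h (branches (ds @ [d]) y) - h (branches ds y)\<bar> powr p) \<partial>lborel)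
      \<le> ennreal (4 powr p) * (?X ds + ?Y ds + ?Z ds)" for ds
  proof -
    have "(\<integral>\<^sup>+y\<in>G. ennreal (\<bar>h (branches (ds @ [d]) y) - h (branches ds y)\<bar> powr p) \<partial>lborel)
      \<le> (\<integral>\<^sup>+y. ennreal (4 powr p) * (?e (branches (ds @ [d]) y) * indicator G y + ?e (branches ds y) * indicator G y
         + ennreal (\<bar>g (branches (ds @ [d]) y) - g (branches ds y)\<bar> powr p) * indicator G y) \<partial>lborel)"
    proof (intro nn_integral_mono)
      fix y
      let ?x = "branches (ds @ [d]) y" and ?y = "branches ds y"
      have "\<bar>h ?x - h ?y\<bar> powr p \<le> 4 powr p * (\<bar>h ?x - g ?x\<bar> powr p + \<bar>h ?y - g ?y\<bar> powr p + \<bar>g ?x - g ?y\<bar> powr p)"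
        using abs_powr_triple[OF p, of "h ?x - g ?x" "- (h ?y - g ?y)" "g ?x - g ?y"] by (simp only: abs_minus_cancel) simp
      then have "ennreal (\<bar>h ?x - h ?y\<bar> powr p)
          \<le> ennreal (4 powr p) * (?e ?x + ?e ?y + ennreal (\<bar>g ?x - g ?y\<bar> powr p))"
        by (simp add: ennreal_mult'[symmetric] ennreal_plus[symmetric] ennreal_leI del: ennreal_plus)
      then show "ennreal (\<bar>h ?x - h ?y\<bar> powr p) * indicator G y \<le> ennreal (4 powr p) * (?e ?x * indicator G y + ?e ?y * indicator G y
         + ennreal (\<bar>g ?x - g ?y\<bar> powr p) * indicator G y)"
        by (simp split: split_indicator)
    qed
    also have "\<dots> = ennreal (4 powr p) * (?X ds + ?Y ds + ?Z ds)"
      by (subst nn_integral_cmult, measurable, subst nn_integral_add, measurable, subst nn_integral_add, measurable)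
    finally show ?thesis .
  qed
  then have "oscillation p d h k \<le> ennreal (1 / m ^ k) * (\<Sum>ds\<in>words D k. ennreal (4 powr p) * (?X ds + ?Y ds + ?Z ds))"
    unfolding oscillation_def by (intro mult_left_mono sum_mono) auto
  also have "\<dots> = ennreal (4 powr p) * (ennreal (1 / m ^ k) * (\<Sum>ds\<in>words D k. ?X ds) +
      ennreal (1 / m ^ k) * (\<Sum>ds\<in>words D k. ?Y ds) + oscillation p d g k)"
    unfolding oscillation_def by (simp add: sum.distrib distrib_left sum_distrib_left[symmetric] mult.left_commute)
  also have "ennreal (1 / m ^ k) * (\<Sum>ds\<in>words D k. ?Y ds) = ?I"
    by (rule nn_integral_G_words[symmetric]) measurable
  also have "ennreal (1 / m ^ k) * (\<Sum>ds\<in>words D k. ?X ds) \<le> ennreal m * ?I"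
  proof -
    have "(\<Sum>ds\<in>words D k. ?X ds) \<le> (\<Sum>ds\<in>words D k. \<Sum>d\<in>D. \<integral>\<^sup>+y\<in>G. ?e (branches (ds @ [d]) y) \<partial>lborel)"
    proof (rule sum_mono)
      fix ds
      show "?X ds \<le> (\<Sum>d\<in>D. \<integral>\<^sup>+y\<in>G. ?e (branches (ds @ [d]) y) \<partial>lborel)"
        using d finite_D by (intro member_le_sum[of d D "\<lambda>d. \<integral>\<^sup>+y\<in>G. ?e (branches (ds @ [d]) y) \<partial>lborel"]) auto
    qed
    also have "\<dots> = (\<Sum>ds\<in>words D (Suc k). ?Y ds)" by (rule sum_words_snoc[symmetric])
    finally have le: "ennreal (1 / m ^ k) * (\<Sum>ds\<in>words D k. ?X ds) \<le> ennreal (1 / m ^ k) * (\<Sum>ds\<in>words D (Suc k). ?Y ds)"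
      by (rule mult_left_mono) simp
    have "ennreal (1 / m ^ k) = ennreal m * ennreal (1 / m ^ Suc k)"
      using m_pos by (simp add: ennreal_mult'[symmetric])
    then have "ennreal (1 / m ^ k) * (\<Sum>ds\<in>words D (Suc k). ?Y ds) = ennreal m * (ennreal (1 / m ^ Suc k) * (\<Sum>ds\<in>words D (Suc k). ?Y ds))"
      by (simp only: mult.assoc)
    also have "ennreal (1 / m ^ Suc k) * (\<Sum>ds\<in>words D (Suc k). ?Y ds) = ?I"
      by (rule nn_integral_G_words[symmetric]) measurable
    finally show ?thesis using le by (simp only:)
  qed
  also have "ennreal m * ?I + ?I = ennreal (m + 1) * ?I"
    using m_pos by (simp add: distrib_right)
  finally show ?thesis by (simp add: mult_left_mono)
qed

lemma oscillation_tendsto_0: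
  assumes p: "1 \<le> p" and d: "d \<in> D" and h[measurable]: "h \<in> borel_measurable borel"
    and hp: "integrable lborel (\<lambda>y. indicator G y * \<bar>h y\<bar> powr p)" and e: "0 < e"
  shows "\<forall>\<^sub>F k in sequentially. oscillation p d h k \<le> ennreal e"
proof -
  define e1 where "e1 = e / (4 powr p * (m + 2))"
  have e1: "0 < e1" using e m_pos by (simp add: e1_def)
  obtain g where g: "continuous_on UNIV g" "(\<integral>\<^sup>+y\<in>G. ennreal (\<bar>h y - g y\<bar> powr p) \<partial>lborel) \<le> ennreal e1"
    using tile_approximation[OF p h hp e1] by blast
  have [measurable]: "g \<in> borel_measurable borel" using g(1) by (rule borel_measurable_continuous_onI)
  show ?thesis
    using oscillation_continuous[OF p d g(1) e1]
  proof eventually_elim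
    case (elim k)
    have "oscillation p d h k \<le> ennreal (4 powr p) * (ennreal (m + 1) * (\<integral>\<^sup>+y\<in>G. ennreal (\<bar>h y - g y\<bar> powr p) \<partial>lborel) + oscillation p d g k)"
      by (rule oscillation_le[OF p d]) measurable
    also have "\<dots> \<le> ennreal (4 powr p) * (ennreal (m + 1) * ennreal e1 + ennreal e1)"
      by (intro mult_left_mono add_mono g(2) elim) auto
    also have "\<dots> = ennreal (4 powr p * ((m + 1) * e1 + e1))"
      using m_pos e1 by (simp add: ennreal_mult[symmetric] ennreal_plus[symmetric] del: ennreal_plus)
    also have "4 powr p * ((m + 1) * e1 + e1) = e"
    proof -
      have "4 powr p * ((m + 1) * e1 + e1) = (4 powr p * (m + 2)) * e1" by (simp add: algebra_simps)
      also have "\<dots> = e" using m_pos by (simp add: e1_def)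
      finally show ?thesis .
    qed
    finally show ?case .
  qed
qed

end

section \<open>Integrability of the refinable distribution bounds the p-radius\<close>

lemma cball_sets [measurable]: "cball (a :: real ^ 's::finite) r \<in> sets borel"
  by simp

lemma integrable_on_ball:
  fixes F :: "real ^ 's::finite \<Rightarrow> real"
  assumes p: "1 \<le> p" and [measurable]: "F \<in> borel_measurable borel"
    and Fp: "integrable lborel (\<lambda>x. \<bar>F x\<bar> powr p)"
  shows "integrable lborel (\<lambda>x. indicator (cball 0 R) x * F x)"
proof (rule Bochner_Integration.integrable_bound)
  have "integrable lborel (indicator (cball (0 :: real ^ 's) R) :: _ \<Rightarrow> real)"
    by (rule integrable_real_indicator) (auto simp: emeasure_bounded_finite[simplified])
  then show "integrable lborel (\<lambda>x. indicator (cball 0 R) x + \<bar>F x\<bar> powr p)"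
    using Fp by (rule Bochner_Integration.integrable_add)
  show "AE x in lborel. norm (indicator (cball 0 R) x * F x) \<le> norm (indicator (cball 0 R) x + \<bar>F x\<bar> powr p)"
    using le_one_plus_powr[OF abs_ge_zero p] by (intro AE_I2) (simp add: abs_mult split: split_indicator)
qed (auto intro!: borel_measurable_times borel_measurable_indicator)

context refinable_distribution
begin

lemma borel_density:
  assumes p: "1 \<le> p" and Lp: "in_Lp \<phi> p"
  obtains F where "F \<in> borel_measurable borel" "integrable lborel (\<lambda>x. \<bar>F x\<bar> powr p)"
    "\<And>f. test_fun f \<Longrightarrow> \<phi> f = (\<integral>x. F x * f x \<partial>lborel)"
proof -
  obtain F0 where F0[measurable]: "F0 \<in> borel_measurable lebesgue" and F0p: "integrable lebesgue (\<lambda>x. \<bar>F0 x\<bar> powr p)"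
    and F0f: "\<And>f. test_fun f \<Longrightarrow> \<phi> f = integral\<^sup>L lebesgue (\<lambda>x. F0 x * f x)"
    using Lp unfolding in_Lp_def by blast
  obtain F where F: "F \<in> borel_measurable lborel" and ae: "AE x in lborel. F0 x = F x"
    using completion_ex_borel_measurable_real[OF F0] by blast
  have Fb[measurable]: "F \<in> borel_measurable borel" using F by simp
  have Fl[measurable]: "F \<in> borel_measurable lebesgue" by (intro measurable_completion F)
  have ae': "AE x in lebesgue. F0 x = F x" by (rule AE_completion[OF ae])
  show ?thesis
  proof
    show "F \<in> borel_measurable borel" by (rule Fb)
    have "integrable lebesgue (\<lambda>x. \<bar>F x\<bar> powr p)"
      using F0p by (subst integrable_cong_AE[where g = "\<lambda>x. \<bar>F0 x\<bar> powr p"]) (use ae' in auto)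
    then show "integrable lborel (\<lambda>x. \<bar>F x\<bar> powr p)"
      by (subst (asm) integrable_completion) auto
    fix f :: "real ^ 's \<Rightarrow> real" assume f: "test_fun f"
    have [measurable]: "f \<in> borel_measurable borel" by (rule test_fun_measurable[OF f])
    have [measurable]: "f \<in> borel_measurable lebesgue" by (intro measurable_completion) simp
    have "integral\<^sup>L lebesgue (\<lambda>x. F0 x * f x) = integral\<^sup>L lebesgue (\<lambda>x. F x * f x)"
      by (rule integral_cong_AE) (use ae' in auto)
    also have "\<dots> = (\<integral>x. F x * f x \<partial>lborel)" by (intro integral_completion) auto
    finally show "\<phi> f = (\<integral>x. F x * f x \<partial>lborel)" by (simp only: F0f[OF f])
  qed
qed

text \<open>
  If \<open>\<eta>\<close> is 1 near the support of the distribution, then \<open>F (1 - \<eta>)\<close> integrates to 0 against all test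
  functions and is zero by the fundamental lemma.
\<close>
lemma density_support:
  assumes p: "1 \<le> p" and F[measurable]: "F \<in> borel_measurable borel"
    and Fp: "integrable lborel (\<lambda>x. \<bar>F x\<bar> powr p)"
    and rep: "\<And>f. test_fun f \<Longrightarrow> \<phi> f = (\<integral>x. F x * f x \<partial>lborel)"
  obtains R where "integrable lborel F" "AE x in lborel. x \<notin> cball 0 R \<longrightarrow> F x = 0"
proof -
  obtain R0 where R0: "\<And>f. test_fun f \<Longrightarrow> fun_support f \<inter> cball 0 R0 = {} \<Longrightarrow> \<phi> f = 0" using \<phi>_support by blast
  obtain \<eta> :: "real ^ 's \<Rightarrow> real" where \<eta>: "test_fun \<eta>" "\<And>x. x \<in> cball 0 (R0 + 1) \<Longrightarrow> \<eta> x = 1"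
    "\<And>x. 0 \<le> \<eta> x" "\<And>x. \<eta> x \<le> 1"
    using cutoff_exists[of "R0 + 1"] by metis
  have [measurable]: "\<eta> \<in> borel_measurable borel" by (rule test_fun_measurable[OF \<eta>(1)])
  obtain R where R: "\<forall>x. \<eta> x \<noteq> 0 \<longrightarrow> norm x \<le> R"
    using test_fun_vanishes_outside_ball[OF \<eta>(1)] by (elim exE)
  have loc: "integrable lborel (\<lambda>x. indicator (cball 0 R) x * F x)" for R
    by (rule integrable_on_ball[OF p F Fp])
  have Ff: "integrable lborel (\<lambda>x. F x * f x)" if f: "test_fun f" for f
  proof -
    obtain r where r: "\<forall>x. f x \<noteq> 0 \<longrightarrow> norm x \<le> r"
      using test_fun_vanishes_outside_ball[OF f] by (elim exE)
    have eq: "(\<lambda>x. F x * f x) = (\<lambda>x. (indicator (cball 0 r) x * F x) * f x)"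
    proof
      fix x
      show "F x * f x = (indicator (cball 0 r) x * F x) * f x"
        using r[rule_format, of x] by (auto split: split_indicator)
    qed
    show ?thesis unfolding eq by (rule integrable_times_test_fun[OF loc f])
  qed
  have "AE x in lborel. F x * (1 - \<eta> x) = 0"
  proof (rule fundamental_lemma_variations)
    show "integrable lborel (\<lambda>x. indicator (cball 0 R) x * (F x * (1 - \<eta> x)))" for R
    proof (rule Bochner_Integration.integrable_bound[OF loc])
      show "AE x in lborel. norm (indicator (cball 0 R) x * (F x * (1 - \<eta> x))) \<le> norm (indicator (cball 0 R) x * F x)"
        using \<eta>(3,4) by (intro AE_I2) (auto simp: abs_mult mult_left_le split: split_indicator)
    qed measurable
    fix f :: "real ^ 's \<Rightarrow> real" assume f: "test_fun f"
    have \<eta>f: "test_fun (\<lambda>x. \<eta> x * f x)" by (intro test_fun_mult \<eta> test_fun_smooth f)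
    have "(\<integral>x. F x * (1 - \<eta> x) * f x \<partial>lborel) = (\<integral>x. F x * f x - F x * (\<eta> x * f x) \<partial>lborel)"
      by (simp add: algebra_simps)
    also have "\<dots> = \<phi> f - \<phi> (\<lambda>x. \<eta> x * f x)"
      using Ff[OF f] Ff[OF \<eta>f] by (simp add: rep[OF f] rep[OF \<eta>f])
    also have "\<dots> = \<phi> (\<lambda>x. f x - \<eta> x * f x)" by (rule \<phi>_diff[OF f \<eta>f, symmetric])
    also have "\<dots> = 0"
    proof (rule R0)
      show "test_fun (\<lambda>x. f x - \<eta> x * f x)"
        using test_fun_linear_comb[OF f \<eta>f, of 1 "- 1"] by simp
      have "fun_support (\<lambda>x. f x - \<eta> x * f x) \<subseteq> - ball 0 (R0 + 1)"
        using \<eta>(2) by (intro fun_support_subset_closed) (auto simp: less_imp_le)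
      then show "fun_support (\<lambda>x. f x - \<eta> x * f x) \<inter> cball 0 R0 = {}" by auto
    qed
    finally show "(\<integral>x. F x * (1 - \<eta> x) * f x \<partial>lborel) = 0" .
  qed measurable
  then have supp: "AE x in lborel. x \<notin> cball 0 R \<longrightarrow> F x = 0"
  proof eventually_elim
    case (elim x)
    show ?case
    proof
      assume "x \<notin> cball 0 R"
      then have "\<eta> x = 0" using R[rule_format, of x] by auto
      with elim show "F x = 0" by simp
    qed
  qed
  have "AE x in lborel. F x = indicator (cball 0 R) x * F x"
    using supp by eventually_elim (simp split: split_indicator)
  then have "integrable lborel F"
    using loc[of R] by (subst integrable_cong_AE[where g = "\<lambda>x. indicator (cball 0 R) x * F x"]) auto
  then show ?thesis using supp by (rule that)
qed

lemma density_refinement: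
  assumes F: "integrable lborel F"
    and rep: "\<And>f. test_fun f \<Longrightarrow> \<phi> f = (\<integral>x. F x * f x \<partial>lborel)"
  shows "AE x in lborel. F x = refinement F x"
proof -
  have [measurable]: "F \<in> borel_measurable borel" using F by auto
  have int: "integrable lborel (\<lambda>x. F x - refinement F x)"
    by (intro Bochner_Integration.integrable_diff F integrable_refinement)
  have "AE x in lborel. F x - refinement F x = 0"
  proof (rule fundamental_lemma_variations)
    show "integrable lborel (\<lambda>x. indicator (cball 0 R) x * (F x - refinement F x))" for R
      using integrable_mult_indicator[OF _ int, of "cball 0 R"] by simp
    fix f :: "real ^ 's \<Rightarrow> real" assume f: "test_fun f"
    have "(\<integral>x. (F x - refinement F x) * f x \<partial>lborel) = (\<integral>x. F x * f x \<partial>lborel) - (\<integral>x. refinement F x * f x \<partial>lborel)"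
      unfolding left_diff_distrib
      by (intro Bochner_Integration.integral_diff integrable_times_test_fun integrable_refinement F f)
    also have "\<dots> = \<phi> f - (\<Sum>k\<in>\<Gamma>. c k / m * \<phi> (\<lambda>y. f (branch M k y)))"
      by (simp add: rep[OF f] rep[OF test_fun_branch[OF f]] integral_refinement_test_fun[OF F f])
    also have "\<dots> = 0" using \<phi>_refine[OF f] by simp
    finally show "(\<integral>x. (F x - refinement F x) * f x \<partial>lborel) = 0" .
  qed measurable
  then show ?thesis by eventually_elim simp
qed

lemma density_integral:
  assumes F: "integrable lborel F" and supp: "AE x in lborel. x \<notin> cball 0 R \<longrightarrow> F x = 0"
    and rep: "\<And>f. test_fun f \<Longrightarrow> \<phi> f = (\<integral>x. F x * f x \<partial>lborel)"
  shows "(\<integral>x. F x \<partial>lborel) = 1"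
proof -
  have [measurable]: "F \<in> borel_measurable borel" using F by auto
  obtain R1 where R1: "\<And>f. test_fun f \<Longrightarrow> (\<And>x. x \<in> cball 0 R1 \<Longrightarrow> f x = 1) \<Longrightarrow> \<phi> f = 1" using \<phi>_integral by blast
  obtain \<eta> :: "real ^ 's \<Rightarrow> real" where \<eta>: "test_fun \<eta>" "\<And>x. x \<in> cball 0 (max R R1) \<Longrightarrow> \<eta> x = 1"
    using cutoff_exists[of "max R R1"] by metis
  have [measurable]: "\<eta> \<in> borel_measurable borel" by (rule test_fun_measurable[OF \<eta>(1)])
  have "(\<integral>x. F x \<partial>lborel) = (\<integral>x. F x * \<eta> x \<partial>lborel)"
  proof (rule integral_cong_AE)
    show "AE x in lborel. F x = F x * \<eta> x"
      using supp
    proof eventually_elim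
      case (elim x)
      show ?case
      proof (cases "x \<in> cball 0 R")
        case True
        then have "\<eta> x = 1" by (intro \<eta>(2)) auto
        then show ?thesis by simp
      qed (use elim in simp)
    qed
  qed measurable
  also have "\<dots> = \<phi> \<eta>" by (rule rep[OF \<eta>(1), symmetric])
  also have "\<dots> = 1" using \<eta> by (intro R1) auto
  finally show ?thesis .
qed

abbreviation "dilates js x \<equiv> foldr (\<lambda>k x. real_mat M *v x - real_vec k) js x"

lemma AE_dilates: "AE x in lborel. P x \<Longrightarrow> AE x in lborel. P (dilates js x)"
proof (induction js arbitrary: P)
  case (Cons k js)
  from Cons.IH[OF AE_dilate[OF Cons.prems, of k]] show ?case by simp
qed simp

text \<open>
  Almost every point has the property that all points \<open>M x - k\<close>, and all their successors, satisfy the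
  refinement equation and the bound on the support. Among such points those with \<open>F x \<noteq> 0\<close> form a
  backward invariant set: if the refinement sum is nonzero, one of its summands is.
\<close>
lemma refinable_support_in_K:
  assumes supp: "AE x in lborel. x \<notin> cball 0 R \<longrightarrow> F x = 0"
    and ref: "AE x in lborel. F x = refinement F x"
  shows "AE x in lborel. F x \<noteq> 0 \<longrightarrow> x \<in> K"
proof -
  \<comment> \<open>The orbit uses all lattice vectors as digits; countably many null sets are discarded.\<close>
  define good where "good x \<longleftrightarrow> (x \<notin> cball 0 R \<longrightarrow> F x = 0) \<and> F x = refinement F x" for x
  have "AE x in lborel. good x" unfolding good_def using supp ref by eventually_elim blast
  then have all: "AE x in lborel. \<forall>js :: (int ^ 's) list. good (dilates js x)"
    unfolding AE_all_countable by (intro allI AE_dilates)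
  define S where "S = {x. F x \<noteq> 0 \<and> (\<forall>js :: (int ^ 's) list. good (dilates js x))}"
  have "S \<subseteq> K"
  proof (rule expansionsI_backward_invariant)
    have "S \<subseteq> cball 0 R"
    proof
      fix x assume "x \<in> S"
      then have "F x \<noteq> 0" "good (dilates [] x)" unfolding S_def by blast+
      then show "x \<in> cball 0 R" by (auto simp: good_def)
    qed
    then show "bounded S" using bounded_cball bounded_subset by blast
    fix x assume x: "x \<in> S"
    then have nz: "F x \<noteq> 0" and g: "\<And>js. good (dilates js x)" unfolding S_def by blast+
    from g[of "[]"] have "F x = refinement F x" by (simp add: good_def)
    with nz have "(\<Sum>k\<in>\<Gamma>. c k * F (real_mat M *v x - real_vec k)) \<noteq> 0" by (simp add: refinement_def)
    then obtain k where k: "k \<in> \<Gamma>" "c k * F (real_mat M *v x - real_vec k) \<noteq> 0"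
      using sum.neutral by meson
    have "good (dilates js (real_mat M *v x - real_vec k))" for js
      using g[of "js @ [k]"] by simp
    with k show "\<exists>k\<in>\<Gamma>. real_mat M *v x - real_vec k \<in> S" unfolding S_def by auto
  qed
  with all show ?thesis by (auto elim!: eventually_mono simp: S_def)
qed

lemma vanishes_off_\<Omega>_if_supported_in_K:
  assumes "AE x in lborel. F x \<noteq> 0 \<longrightarrow> x \<in> K"
  shows "vanishes_off_\<Omega> F"
proof -
  have "AE y in lborel. \<forall>l :: int ^ 's. F (y + real_vec l) \<noteq> 0 \<longrightarrow> y + real_vec l \<in> K"
    unfolding AE_all_countable by (intro allI AE_translate[OF assms])
  with AE_unique_tile show ?thesis
    unfolding vanishes_off_\<Omega>_def
  proof eventually_elim
    case (elim y)
    show ?case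
    proof (intro impI allI, rule ccontr)
      fix l assume y: "y \<in> G" and l: "l \<notin> \<Omega>" and nz: "F (y + real_vec l) \<noteq> 0"
      then have "y + real_vec l \<in> K" using elim(2) by blast
      then obtain k where "k \<in> \<Omega>" "y + real_vec l - real_vec k \<in> G" using K_subset shifted_by_iff by blast
      with elim(1) y l show False by blast
    qed
  qed
qed

lemma integral_samples:
  assumes F: "integrable lborel F" and van: "vanishes_off_\<Omega> F"
  shows "integrable lborel (\<lambda>y. indicator G y * F (y + t))"
    "(\<integral>x. F x \<partial>lborel) = (\<Sum>a\<in>UNIV. \<integral>y. indicator G y * samples F y $ a \<partial>lborel)"
proof -
  have [measurable]: "F \<in> borel_measurable borel" using F by auto
  have shift: "integrable lborel (\<lambda>x. indicator G (x - t) * F x) \<and>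
      (\<integral>x. indicator G (x - t) * F x \<partial>lborel) = (\<integral>y. indicator G y * F (y + t) \<partial>lborel) \<and>
      integrable lborel (\<lambda>y. indicator G y * F (y + t))" for t
  proof (intro conjI)
    have [measurable]: "(\<lambda>x. x - t) \<in> borel_measurable borel" by measurable
    show *: "integrable lborel (\<lambda>x. indicator G (x - t) * F x)"
    proof (rule Bochner_Integration.integrable_bound[OF F])
      show "AE x in lborel. norm (indicator G (x - t) * F x) \<le> norm (F x)"
        by (intro AE_I2) (simp split: split_indicator)
    qed measurable
    have "(\<integral>x. indicator G (x - t) * F x \<partial>lborel) = (\<integral>x. indicator G (x - t) * F x \<partial>distr lborel borel ((+) t))"
      by (simp only: lborel_distr_plus)
    also have "\<dots> = (\<integral>y. indicator G y * F (y + t) \<partial>lborel)"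
      by (subst integral_distr) (auto simp: add.commute)
    finally show "(\<integral>x. indicator G (x - t) * F x \<partial>lborel) = (\<integral>y. indicator G y * F (y + t) \<partial>lborel)" .
    have "integrable (distr lborel borel ((+) t)) (\<lambda>x. indicator G (x - t) * F x)"
      using * by (simp only: lborel_distr_plus)
    then show "integrable lborel (\<lambda>y. indicator G y * F (y + t))"
      by (subst (asm) integrable_distr_eq) (auto simp: add.commute)
  qed
  then show "integrable lborel (\<lambda>y. indicator G y * F (y + t))" by blast
  have "AE x in lborel. \<forall>k :: int ^ 's. x + - real_vec k \<in> G \<longrightarrow> (\<forall>l. l \<notin> \<Omega> \<longrightarrow> F (x + - real_vec k + real_vec l) = 0)"
    using van unfolding vanishes_off_\<Omega>_def AE_all_countable by (intro allI AE_translate)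
  with tiling have ae: "AE x in lborel. F x = (\<Sum>a\<in>UNIV. indicator G (x - real_vec (\<omega> a)) * F x)"
  proof eventually_elim
    case (elim x)
    obtain k where k: "x - real_vec k \<in> G" using G_cover by blast
    show ?case
    proof (cases "k \<in> \<Omega>")
      case True
      then obtain b where b: "k = \<omega> b" by blast
      have uniq: "\<exists>!a. a \<in> UNIV \<and> x - real_vec (\<omega> a) \<in> G"
      proof (rule ex1I[of _ b])
        show "b \<in> UNIV \<and> x - real_vec (\<omega> b) \<in> G" using k b by simp
        fix a assume "a \<in> UNIV \<and> x - real_vec (\<omega> a) \<in> G"
        then have "\<omega> a = \<omega> b" using elim(1) k b by blast
        then show "a = b" using inj_\<omega> by (simp add: inj_eq)
      qed
      have "(\<Sum>a\<in>UNIV. indicator G (x - real_vec (\<omega> a)) * F x) = (\<Sum>a\<in>UNIV. if x - real_vec (\<omega> a) \<in> G then F x else 0)"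
        by (intro sum.cong refl) (simp split: split_indicator)
      also have "\<dots> = F x" by (rule sum_if_ex1[OF finite uniq])
      finally show ?thesis by simp
    next
      case False
      then have "F x = 0" using elim(2)[rule_format, of k k] k by simp
      then show ?thesis by simp
    qed
  qed
  have "(\<integral>x. F x \<partial>lborel) = (\<integral>x. (\<Sum>a\<in>UNIV. indicator G (x - real_vec (\<omega> a)) * F x) \<partial>lborel)"
    by (rule integral_cong_AE[OF _ _ ae]) measurable
  also have "\<dots> = (\<Sum>a\<in>UNIV. \<integral>x. indicator G (x - real_vec (\<omega> a)) * F x \<partial>lborel)"
    using shift by (intro Bochner_Integration.integral_sum) blast
  also have "\<dots> = (\<Sum>a\<in>UNIV. \<integral>y. indicator G y * samples F y $ a \<partial>lborel)"
    using shift by (simp add: samples_def)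
  finally show "(\<integral>x. F x \<partial>lborel) = (\<Sum>a\<in>UNIV. \<integral>y. indicator G y * samples F y $ a \<partial>lborel)" .
qed

text \<open>
  The self-similarity of a solution of the refinement equation on the cells of its tile.
\<close>
lemma samples_branches:
  assumes van: "vanishes_off_\<Omega> F" and ref: "AE x in lborel. F x = refinement F x"
  shows "set ds \<subseteq> D \<Longrightarrow> AE y in lborel. y \<in> G \<longrightarrow> samples F (branches ds y) = prodT ds (samples F y)"
proof (induction ds)
  case (Cons d ds)
  have "AE y in lborel. branches ds y \<in> G \<longrightarrow> samples F (branch M d (branches ds y)) = T d *v samples F (branches ds y)"
    using samples_branch[OF van ref, of d] by (rule AE_branches)
  moreover have "AE y in lborel. y \<in> G \<longrightarrow> samples F (branches ds y) = prodT ds (samples F y)"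
    using Cons by simp
  ultimately show ?case
  proof eventually_elim
    case (elim y)
    show ?case
    proof
      assume "y \<in> G"
      moreover have "branches ds y \<in> G" using \<open>y \<in> G\<close> Cons.prems by (intro branches_G) auto
      ultimately show "samples F (branches (d # ds) y) = prodT (d # ds) (samples F y)"
        using elim Cons.prems by simp
    qed
  qed
qed simp

definition mean_samples :: "(real ^ 's \<Rightarrow> real) \<Rightarrow> real ^ 'n" where
  "mean_samples F = (\<chi> a. \<integral>y. indicator G y * samples F y $ a \<partial>lborel)"

text \<open>
  The matrix product that relates the samples on a cell to those on the tile is constant and may be
  pulled out of the integral.
\<close>
lemma mean_samples_on_cell:
  assumes F: "integrable lborel F" and van: "vanishes_off_\<Omega> F"
    and ref: "AE x in lborel. F x = refinement F x" and ds: "set ds \<subseteq> D"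
  shows "integrable lborel (\<lambda>y. indicator G y * samples F (branches ds y) $ a)"
    "(\<integral>y. indicator G y * samples F (branches ds y) $ a \<partial>lborel) = prodT ds (mean_samples F) $ a"
proof -
  have [measurable]: "F \<in> borel_measurable borel" using F by auto
  have [measurable]: "(\<lambda>y. samples F (branches ds y) $ a) \<in> borel_measurable borel"
    by (rule measurable_compose[OF branches_measurable samples_measurable]) measurable
  let ?B = "matrix (prodT ds)"
  have lin: "prodT ds w $ a = (\<Sum>b\<in>UNIV. ?B $ a $ b * w $ b)" for w
  proof -
    have "prodT ds w = ?B *v w"
      using matrix_vector_mul(3)[OF matrix_product_bounded_linear[of T ds]] by metis
    then show ?thesis by (simp add: matrix_vector_mult_def)
  qed
  have int: "integrable lborel (\<lambda>y. indicator G y * samples F y $ b)" for b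
    using integral_samples(1)[OF F van, of "real_vec (\<omega> b)"] by (simp add: samples_def)
  have eq: "AE y in lborel. indicator G y * samples F (branches ds y) $ a
      = (\<Sum>b\<in>UNIV. ?B $ a $ b * (indicator G y * samples F y $ b))"
    using samples_branches[OF van ref ds]
  proof eventually_elim
    case (elim y)
    show ?case
    proof (cases "y \<in> G")
      case True
      then show ?thesis using elim lin[of "samples F y"] by simp
    qed simp
  qed
  have int2: "integrable lborel (\<lambda>y. \<Sum>b\<in>UNIV. ?B $ a $ b * (indicator G y * samples F y $ b))"
    by (intro Bochner_Integration.integrable_sum integrable_mult_right int)
  show "integrable lborel (\<lambda>y. indicator G y * samples F (branches ds y) $ a)"
    by (subst integrable_cong_AE[OF _ _ eq]) (use int2 in auto)
  have "(\<integral>y. indicator G y * samples F (branches ds y) $ a \<partial>lborel)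
      = (\<integral>y. (\<Sum>b\<in>UNIV. ?B $ a $ b * (indicator G y * samples F y $ b)) \<partial>lborel)"
    by (rule integral_cong_AE[OF _ _ eq]) (use int2 in auto)
  also have "\<dots> = (\<Sum>b\<in>UNIV. ?B $ a $ b * mean_samples F $ b)"
    by (subst Bochner_Integration.integral_sum) (auto simp: mean_samples_def intro!: integrable_mult_right int)
  finally show "(\<integral>y. indicator G y * samples F (branches ds y) $ a \<partial>lborel) = prodT ds (mean_samples F) $ a"
    by (simp only: lin)
qed

lemma mean_samples_fixed:
  assumes F: "integrable lborel F" and van: "vanishes_off_\<Omega> F"
    and ref: "AE x in lborel. F x = refinement F x"
  shows "mean_matrix D T *v mean_samples F = mean_samples F"
proof -
  have [measurable]: "F \<in> borel_measurable borel" using F by auto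
  have "mean_samples F $ a = (mean_matrix D T *v mean_samples F) $ a" for a
  proof -
    have "mean_samples F $ a = (1 / m) * (\<Sum>d\<in>D. \<integral>y. indicator G y * samples F (branch M d y) $ a \<partial>lborel)"
      unfolding mean_samples_def vec_lambda_beta
    proof (rule integral_G_split)
      fix d assume "d \<in> D"
      then show "integrable lborel (\<lambda>y. indicator G y * samples F (branch M d y) $ a)"
        using mean_samples_on_cell(1)[OF F van ref, of "[d]" a] by simp
    qed measurable
    also have "\<dots> = (1 / m) * (\<Sum>d\<in>D. (T d *v mean_samples F) $ a)"
      using mean_samples_on_cell(2)[OF F van ref, of "[_]" a] by simp
    also have "\<dots> = (mean_matrix D T *v mean_samples F) $ a"
      by (simp add: mean_matrix_def matrix_vector_mult_def sum_distrib_left sum_distrib_right sum.swap[of _ D] mult_ac)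
    finally show ?thesis .
  qed
  then show ?thesis by (simp add: vec_eq_iff)
qed

text \<open>
  Component by component, the vector on the left is the difference of the averages of the samples over a
  cell and over its subcell with digit \<open>d\<close>. Jensen's inequality bounds it by the deviation of the samples
  themselves.
\<close>
lemma cell_difference_bound:
  assumes p: "1 \<le> p" and F: "integrable lborel F" and van: "vanishes_off_\<Omega> F"
    and ref: "AE x in lborel. F x = refinement F x" and d: "d \<in> D"
  shows "ennreal ((\<Sum>ds\<in>words D k. norm (prodT ds (T d *v mean_samples F - mean_samples F)) powr p) / m ^ k)
    \<le> ennreal (real CARD('n) powr p) * (\<Sum>a\<in>UNIV. oscillation p d (\<lambda>y. samples F y $ a) k)"
proof -
  have [measurable]: "F \<in> borel_measurable borel" using F by auto
  let ?z = "mean_samples F"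
  let ?w = "T d *v ?z - ?z"
  let ?O = "\<lambda>ds a. \<integral>\<^sup>+y\<in>G. ennreal (\<bar>samples F (branches (ds @ [d]) y) $ a - samples F (branches ds y) $ a\<bar> powr p) \<partial>lborel"
  have comp: "ennreal (\<bar>prodT ds ?w $ a\<bar> powr p) \<le> ?O ds a" if ds: "ds \<in> words D k" for ds a
  proof -
    have ds': "set ds \<subseteq> D" "set (ds @ [d]) \<subseteq> D" using ds d by (auto simp: words_def)
    have "prodT ds ?w $ a = prodT (ds @ [d]) ?z $ a - prodT ds ?z $ a"
      using linear_diff[OF bounded_linear.linear[OF matrix_product_bounded_linear[of T ds]], of "T d *v ?z" ?z] by simp
    also have "\<dots> = (\<integral>y. indicator G y * samples F (branches (ds @ [d]) y) $ a - indicator G y * samples F (branches ds y) $ a \<partial>lborel)"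
      unfolding mean_samples_on_cell(2)[OF F van ref ds'(1), symmetric] mean_samples_on_cell(2)[OF F van ref ds'(2), symmetric]
      by (rule Bochner_Integration.integral_diff[symmetric]) (rule mean_samples_on_cell(1)[OF F van ref]; fact ds')+
    also have "\<dots> = (\<integral>y. indicator G y * (samples F (branches (ds @ [d]) y) $ a - samples F (branches ds y) $ a) \<partial>lborel)"
      by (simp only: right_diff_distrib)
    finally have eq: "prodT ds ?w $ a = (\<integral>y. indicator G y * (samples F (branches (ds @ [d]) y) $ a - samples F (branches ds y) $ a) \<partial>lborel)" .
    show ?thesis unfolding eq
    proof (rule jensen_on_tile[OF p])
      show "integrable lborel (\<lambda>y. indicator G y * (samples F (branches (ds @ [d]) y) $ a - samples F (branches ds y) $ a))"
        unfolding right_diff_distrib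
        by (intro Bochner_Integration.integrable_diff mean_samples_on_cell(1)[OF F van ref] ds')
      show "(\<lambda>y. samples F (branches (ds @ [d]) y) $ a - samples F (branches ds y) $ a) \<in> borel_measurable borel"
        by (intro borel_measurable_diff measurable_compose[OF branches_measurable samples_measurable]) measurable
    qed
  qed
  have "ennreal (norm (prodT ds ?w) powr p) \<le> ennreal (real CARD('n) powr p) * (\<Sum>a\<in>UNIV. ?O ds a)"
    if ds: "ds \<in> words D k" for ds
  proof -
    have "norm (prodT ds ?w) powr p \<le> (\<Sum>a\<in>UNIV. \<bar>prodT ds ?w $ a\<bar>) powr p"
      using p by (intro powr_mono2 norm_le_l1_cart) auto
    also have "\<dots> \<le> real CARD('n) powr p * (\<Sum>a\<in>UNIV. \<bar>prodT ds ?w $ a\<bar> powr p)"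
      using p by (intro sum_powr_le) auto
    finally have "ennreal (norm (prodT ds ?w) powr p) \<le> ennreal (real CARD('n) powr p) * (\<Sum>a\<in>UNIV. ennreal (\<bar>prodT ds ?w $ a\<bar> powr p))"
      by (simp add: ennreal_leI ennreal_mult'[symmetric] sum_ennreal)
    also have "\<dots> \<le> ennreal (real CARD('n) powr p) * (\<Sum>a\<in>UNIV. ?O ds a)"
      by (intro mult_left_mono sum_mono comp ds) auto
    finally show ?thesis .
  qed
  then have "ennreal (1 / m ^ k) * (\<Sum>ds\<in>words D k. ennreal (norm (prodT ds ?w) powr p))
      \<le> ennreal (1 / m ^ k) * (\<Sum>ds\<in>words D k. ennreal (real CARD('n) powr p) * (\<Sum>a\<in>UNIV. ?O ds a))"
    by (intro mult_left_mono sum_mono) auto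
  also have "\<dots> = ennreal (real CARD('n) powr p) * (\<Sum>a\<in>UNIV. oscillation p d (\<lambda>y. samples F y $ a) k)"
    unfolding oscillation_def sum_distrib_left[symmetric] sum.swap[of _ UNIV]
    by (simp add: mult.left_commute)
  also have "ennreal (1 / m ^ k) * (\<Sum>ds\<in>words D k. ennreal (norm (prodT ds ?w) powr p))
      = ennreal ((\<Sum>ds\<in>words D k. norm (prodT ds ?w) powr p) / m ^ k)"
    using m_pos by (simp add: sum_ennreal ennreal_mult'[symmetric])
  finally show ?thesis .
qed

text \<open>
  The mean of the samples serves as \<open>z\<close>. The vectors \<open>T d *v z - z\<close> have vanishing means, and since the
  vectors with vanishing means form an invariant subspace, it contains \<open>U z\<close>.
\<close>
theorem p_radius_if_in_Lp:
  assumes p: "1 \<le> p" and Lp: "in_Lp \<phi> p"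
  shows "\<exists>z\<in>sum_one. mean_matrix D T *v z = z \<and>
    p_radius p D (\<lambda>d w. T d *v w) (difference_space D T z) < 1"
proof -
  obtain F where F[measurable]: "F \<in> borel_measurable borel" and Fp: "integrable lborel (\<lambda>x. \<bar>F x\<bar> powr p)"
    and rep: "\<And>f. test_fun f \<Longrightarrow> \<phi> f = (\<integral>x. F x * f x \<partial>lborel)"
    using borel_density[OF p Lp] by blast
  obtain R where Fint: "integrable lborel F" and supp: "AE x in lborel. x \<notin> cball 0 R \<longrightarrow> F x = 0"
    using density_support[OF p F Fp rep] by blast
  have ref: "AE x in lborel. F x = refinement F x" by (rule density_refinement[OF Fint rep])
  have F1: "(\<integral>x. F x \<partial>lborel) = 1" by (rule density_integral[OF Fint supp rep])
  have van: "vanishes_off_\<Omega> F"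
    by (intro vanishes_off_\<Omega>_if_supported_in_K refinable_support_in_K[OF supp ref])
  let ?z = "mean_samples F"
  let ?U = "difference_space D T ?z"
  have z: "?z \<in> sum_one"
    using integral_samples(2)[OF Fint van] F1 by (simp add: sum_one_def mean_samples_def)
  interpret U: matrix_family D T ?U p
    by unfold_locales (use finite_D D_nonempty difference_space_invariant p in auto)
  \<comment> \<open>By minimality of the hull it suffices that \<open>S\<close> is invariant and contains its generators.\<close>
  define S where "S = {w. U.vec_mean w \<longlonglongrightarrow> 0}"
  have comp_p: "integrable lborel (\<lambda>y. indicator G y * \<bar>samples F y $ a\<bar> powr p)" for a
  proof -
    have "integrable lborel (\<lambda>x. \<bar>F (real_vec (\<omega> a) + x)\<bar> powr p)"
      using Fp lborel_distr_plus[of "real_vec (\<omega> a)"] integrable_distr[of "(+) (real_vec (\<omega> a))" lborel borel "\<lambda>x. \<bar>F x\<bar> powr p"]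
      by simp
    from integrable_mult_indicator[OF _ this, of G] show ?thesis by (simp add: samples_def add.commute)
  qed
  have "T d *v ?z - ?z \<in> S" if d: "d \<in> D" for d
    unfolding S_def mem_Collect_eq
  proof (rule tendstoI)
    fix e :: real assume e: "0 < e"
    let ?c = "real CARD('n) powr p * real CARD('n)"
    have c: "0 < ?c" by simp
    have "\<forall>\<^sub>F k in sequentially. \<forall>a. oscillation p d (\<lambda>y. samples F y $ a) k \<le> ennreal (e / (2 * ?c))"
      using e c by (intro eventually_all_finite oscillation_tendsto_0[OF p d _ comp_p]) auto
    then show "\<forall>\<^sub>F k in sequentially. dist (U.vec_mean (T d *v ?z - ?z) k) 0 < e"
    proof eventually_elim
      case (elim k)
      have "ennreal (U.vec_mean (T d *v ?z - ?z) k) \<le> ennreal (real CARD('n) powr p) * (\<Sum>a\<in>UNIV. oscillation p d (\<lambda>y. samples F y $ a) k)"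
        unfolding U.vec_mean_def by (rule cell_difference_bound[OF p Fint van ref d])
      also have "\<dots> \<le> ennreal (real CARD('n) powr p) * (\<Sum>a\<in>(UNIV :: 'n set). ennreal (e / (2 * ?c)))"
        using elim by (intro mult_left_mono sum_mono) auto
      also have "\<dots> = ennreal (?c * (e / (2 * ?c)))"
        using e by (simp only: sum_constant ennreal_of_nat_eq_real_of_nat) (simp add: ennreal_mult'[symmetric] mult.assoc)
      also have "?c * (e / (2 * ?c)) = e / 2" using c by (simp only: times_divide_eq_right) simp
      finally have "U.vec_mean (T d *v ?z - ?z) k \<le> e / 2" using e by (subst (asm) ennreal_le_iff) auto
      then show ?case using e U.vec_mean_nonneg[of "T d *v ?z - ?z" k] by (simp add: dist_real_def)
    qed
  qed
  moreover have "invariant_subspace D T S"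
    unfolding S_def by (rule U.vanishing_means_invariant)
  ultimately have "?U \<subseteq> S"
    unfolding difference_space_def by (intro hull_minimal) auto
  then have "p_radius p D (\<lambda>d w. T d *v w) ?U < 1"
    by (intro U.p_radius_less_1) (auto simp: S_def)
  with z mean_samples_fixed[OF Fint van ref] show ?thesis by blast
qed

end

theorem theorem4:
  fixes M :: "int ^ 's ^ 's"
    and m :: nat
    and D :: "(int ^ 's) set"
    and G K :: "(real ^ 's) set"
    and c :: "int ^ 's \<Rightarrow> real"
    and \<phi> :: "'s::finite functional"
    and \<omega> :: "'n::finite \<Rightarrow> int ^ 's"
    and T :: "int ^ 's \<Rightarrow> real ^ 'n ^ 'n"
    and p :: real
  assumes "expansive M"
    and "int m = \<bar>det M\<bar>" and "m \<ge> 2"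
    and "complete_residues M D" and "card D = m" and "0 \<in> D"
    and "G = digit_expansions M D"
    and "emeasure lebesgue G = 1"
    and "finite {k. c k \<noteq> 0}"
    and "\<And>d. d \<in> D \<Longrightarrow> (\<Sum>k | c (M *v k - d) \<noteq> 0. c (M *v k - d)) = 1"
    and "refinable_function M c \<phi>"
    and "K = digit_expansions M {k. c k \<noteq> 0}"
    and "inj \<omega>" and "minimal_cover (range \<omega>) K G"
    and "T = transition_matrix M c \<omega>"
    and "1 \<le> p"
  shows "in_Lp \<phi> p \<longleftrightarrow>
    (\<exists>z \<in> sum_one. mean_matrix D T *v z = z \<and>
       p_radius p D (\<lambda>d w. T d *v w) (difference_space D T z) < 1)"
proof -
  have finD: "finite D" using assms(3,5) card.infinite by fastforce
  interpret expansive_matrix M by unfold_locales (rule assms(1))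
  have det: "det (real_mat M) = of_int (det M)"
    unfolding det_def real_mat_def map_matrix_def by simp
  have "emeasure lborel (digit_expansions M D) = 1"
    using assms(7,8) borel_compact[OF compact_expansions[OF finD]] by simp
  then interpret refinable_distribution M D c \<omega> \<phi>
    using assms finD det by unfold_locales auto
  show ?thesis
    unfolding assms(15) using p_radius_if_in_Lp[OF assms(16)] in_Lp_if_p_radius[OF assms(16)] by blast
qed

end
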